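(* (Weak completeness) For every $\mathbf{FOT}$-formula $\phi$: $\models\phi\iff\vdash_{\mathbf{FOT}}\phi$.
   Context: Vocabularies are first-order with equality; every model $M$ (its domain is also written $M$) is assumed to have at least two elements. A team $X$ of $M$ over a set $V$ of variables is a set of assignments $s:V\to M$; $X(a/x)=\{s(a/x)\mid s\in X\}$, with $s(a/x)$ being $s$ modified or extended to send $x$ to $a$. Barred letters denote finite sequences. $\mathbf{FOT}$: $\phi::=\lambda\mid \bar x\subseteq\bar y\mid\dot\sim\phi\mid\phi\wedge\phi\mid\phi\vee^1\phi\mid\exists^1x\phi\mid\forall^1x\phi$ ($\lambda$ a first-order atom; $\bar x,\bar y$ variable sequences of equal length). $M\models_X\lambda$ iff $M\models_s\lambda$ for all $s\in X$; $M\models_X\bar x\subseteq\bar y$ iff for all $s\in X$ there is $s'\in X$ with $s(\bar x)=s'(\bar y)$; $M\models_X\dot\sim\phi$ iff $X=\emptyset$ or $M\not\models_X\phi$; $\wedge$ is conjunction; $M\models_X\phi\vee^1\psi$ iff $M\models_X\phi$ or $M\models_X\psi$; $M\models_X\exists^1x\phi$ (resp. $\forall^1x\phi$) iff $M\models_{X(a/x)}\phi$ for some (resp. all) $a\in M$. $\models\phi$ means $M\models_X\phi$ for all models $M$ and all teams $X$ of $M$ whose domain contains the free variables of $\phi$. Abbreviations: $=\!(\bar t)$ is $\exists^1\bar x(\bar x=\bar t)$ with $\bar x$ fresh; an inclusion atom with constant symbols as arguments, e.g. $c\bar x\subseteq v\bar y$, is short for $\exists^1u(u=c\wedge u\bar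 x\subseteq v\bar y)$, $u$ fresh; $\bot$ is $\exists^1x\,\dot\sim(x=x)$. $\mathsf{Fv}$ denotes the set of free variables. Substituted terms are assumed free for the variables replaced. Fresh constant and relation symbols are always available in derivations. The natural deduction system ($\Gamma\vdash_{\mathbf{FOT}}\phi$, written $\Gamma\vdash\phi$; $\vdash\phi$ means $\emptyset\vdash\phi$) has the rules: - $\Gamma\vdash\phi$ if $\phi\in\Gamma$. $\Gamma\vdash t=t$. From $\Gamma\vdash t=t'$ and $\Gamma\vdash\phi(t/x)$ infer $\Gamma\vdash\phi(t'/x)$. - $\wedge$-introduction and both $\wedge$-eliminations. From $\Gamma\vdash\phi$ infer $\Gamma\vdash\phi\vee^1\psi$ and $\Gamma\vdash\psi\vee^1\phi$. From $\Gamma\vdash\phi\vee^1\psi$, $\Gamma,\phi\vdash\chi$, $\Gamma,\psi\vdash\chi$ infer $\Gamma\vdash\chi$. - From $\Gamma\vdash\phi(t/x)$ and $\Gamma\vdash{=\!(t)}$ infer $\Gamma\vdash\exists^1x\phi$. From $\Gamma\vdash\exists^1x\phi$ and $\Gamma,\phi(v/x),{=\!(v)}\vdash\psi$ infer $\Gamma\vdash\psi$, if $v\notin\mathsf{Fv}(\Gamma\cup\{\phi,\psi\})$. From $\Gamma\vdash\exists^1x\phi$ and $\Gamma,\phi(c/x)\vdash\psi$ infer $\Gamma\vdash\psi$, if the constant symbol $c$ does not occur in $\Gamma,\phi,\psi$. - From $\Gamma,{=\!(v)}\vdash\phi(v/x)$ infer $\Gamma\vdash\forall^1x\phi$, if $v\notin\mathsf{Fv}(\Gamma\cup\{\phi\})$.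 From $\Gamma\vdash\phi(c/x)$ infer $\Gamma\vdash\forall^1x\phi$, if $c$ does not occur in $\Gamma,\phi$. From $\Gamma\vdash\forall^1x\phi$ and $\Gamma\vdash{=\!(t)}$ infer $\Gamma\vdash\phi(t/x)$. - From $\Gamma,\phi\vdash\bot$ infer $\Gamma\vdash\dot\sim\phi$. From $\Gamma\vdash\phi$ and $\Gamma\vdash\dot\sim\phi$ infer $\Gamma\vdash\psi$. From $\Gamma,\dot\sim\phi\vdash\bot$ infer $\Gamma\vdash\phi$. - $\Gamma\vdash{=\!(\bar c)}$ for constant symbols $\bar c$. From $\Gamma\vdash{=\!(\bar t)}$ infer $\Gamma\vdash{=\!(f\bar t)}$ for a function symbol $f$. - $\Gamma\vdash\bar x\subseteq\bar x$. From $\Gamma\vdash\bar x\subseteq\bar y$ and $\Gamma\vdash\bar y\subseteq\bar z$ infer $\Gamma\vdash\bar x\subseteq\bar z$. From $\Gamma\vdash x_1\dots x_n\subseteq y_1\dots y_n$ infer $\Gamma\vdash x_{i_1}\dots x_{i_k}\subseteq y_{i_1}\dots y_{i_k}$ for $\{i_1,\dots,i_k\}\subseteq\{1,\dots,n\}$. - From $\Gamma\vdash\bar x\subseteq\bar y$ and $\Gamma\vdash\alpha(\bar y/\bar z)$ infer $\Gamma\vdash\alpha(\bar x/\bar z)$, if $\alpha$ contains neither $\dot\sim$ nor inclusion atoms and its free variables are among $\bar z$. - From $\Gamma\vdash{=\!(\bar x)}$ and $\Gamma\vdash\bar y\subseteq\bar z$ infer $\Gamma\vdash\bar x\bar y\subseteq\bar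 x\bar z$. From $\Gamma\vdash{=\!(\bar x)}$ and $\Gamma\vdash\bar x\subseteq\bar y$ infer $\Gamma\vdash\exists^1\bar z(\bar z\bar x\subseteq\bar w\bar y)$. - From $\Gamma\vdash\dot\sim\,\bar x\subseteq\bar y$ and $\Gamma,\bar c\subseteq\bar x,\dot\sim\,\bar c\subseteq\bar y\vdash\phi$ infer $\Gamma\vdash\phi$; from $\Gamma\vdash\dot\sim\lambda(\bar x)$ and $\Gamma,\bar c\subseteq\bar x,\dot\sim\lambda(\bar c)\vdash\phi$ infer $\Gamma\vdash\phi$; in both, $\bar c$ is a sequence of constant symbols not occurring in $\Gamma$ or $\phi$, and $\lambda$ is a first-order atom. - From $\Gamma,\exists^1\bar zR\bar z,\phi(R)\vdash\bot$ infer $\Gamma,\phi(\bar v)\vdash\bot$, where $\Gamma$ is a set of sentences in which $R$ does not occur, $\phi(R)$ is an inclusion-atom-free sentence in which $R$ occurs only in the form $R\bar x$ ($\bar x$ variables), and $\phi(\bar v)$ is the formula with free variables $\bar v$ obtained from $\phi(R)$ by replacing every $R\bar x$ by $\bar x\subseteq\bar v$.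
   Formalization: False as stated: ∃¹x∃¹y ~(x=y) holds in all models with ≥2 elements but is underivable. Proved instead: ⊢φ iff φ is valid in all nonempty models, and ⊨φ iff that sentence ⊢φ. In the ~λ(x̄) rule, c̄ must also not occur in λ; otherwise the rule is unsound. *)

theory Defs
  imports Main "HOL-Library.FuncSet"
begin

section \<open>Syntax\<close>

text \<open>Variables are natural numbers.  A function or relation symbol is a name together with the
  number of arguments it is applied to, so that every term and every formula is well-formed; constant
  symbols are separate.  A vocabulary is a set of such symbols, and only the symbols that occur in a
  formula matter for it.\<close>

datatype (tcsts: 'c, 'f) tm = Var nat | Cst 'c | Fn 'f "('c, 'f) tm list"

text \<open>The atom \<open>x\<^sub>1\<dots>x\<^sub>n \<subseteq> y\<^sub>1\<dots>y\<^sub>n\<close> is \<open>Incl [(x\<^sub>1,y\<^sub>1),\<dots>,(x\<^sub>n,y\<^sub>n)]\<close>, which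
  makes the two sequences equally long.  \<open>Neg\<close> is the weak classical negation of teams.\<close>

datatype (csts: 'c, 'f, 'r) fm =
    Eq "('c, 'f) tm" "('c, 'f) tm"
  | Rel 'r "('c, 'f) tm list"
  | Incl "(nat \<times> nat) list"
  | Neg "('c, 'f, 'r) fm"
  | And "('c, 'f, 'r) fm" "('c, 'f, 'r) fm"
  | Or1 "('c, 'f, 'r) fm" "('c, 'f, 'r) fm"
  | Exist1 nat "('c, 'f, 'r) fm"
  | Forall1 nat "('c, 'f, 'r) fm"

abbreviation Inc :: "nat list \<Rightarrow> nat list \<Rightarrow> ('c, 'f, 'r) fm" where
  "Inc xs ys \<equiv> Incl (zip xs ys)"

primrec tfv :: "('c, 'f) tm \<Rightarrow> nat set" where
  "tfv (Var x) = {x}"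
| "tfv (Cst c) = {}"
| "tfv (Fn f ts) = \<Union> (set (map tfv ts))"

primrec fv :: "('c, 'f, 'r) fm \<Rightarrow> nat set" where
  "fv (Eq s t) = tfv s \<union> tfv t"
| "fv (Rel r ts) = \<Union> (tfv ` set ts)"
| "fv (Incl ps) = fst ` set ps \<union> snd ` set ps"
| "fv (Neg \<phi>) = fv \<phi>"
| "fv (And \<phi> \<psi>) = fv \<phi> \<union> fv \<psi>"
| "fv (Or1 \<phi> \<psi>) = fv \<phi> \<union> fv \<psi>"
| "fv (Exist1 x \<phi>) = fv \<phi> - {x}"
| "fv (Forall1 x \<phi>) = fv \<phi> - {x}"

primrec rels :: "('c, 'f, 'r) fm \<Rightarrow> ('r \<times> nat) set" where
  "rels (Eq s t) = {}"
| "rels (Rel r ts) = {(r, length ts)}"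
| "rels (Incl ps) = {}"
| "rels (Neg \<phi>) = rels \<phi>"
| "rels (And \<phi> \<psi>) = rels \<phi> \<union> rels \<psi>"
| "rels (Or1 \<phi> \<psi>) = rels \<phi> \<union> rels \<psi>"
| "rels (Exist1 x \<phi>) = rels \<phi>"
| "rels (Forall1 x \<phi>) = rels \<phi>"

primrec is_atom :: "('c, 'f, 'r) fm \<Rightarrow> bool" where
  "is_atom (Eq s t) = True"
| "is_atom (Rel r ts) = True"
| "is_atom (Incl ps) = False"
| "is_atom (Neg \<phi>) = False"
| "is_atom (And \<phi> \<psi>) = False"
| "is_atom (Or1 \<phi> \<psi>) = False"
| "is_atom (Exist1 x \<phi>) = False"
| "is_atom (Forall1 x \<phi>) = False"

primrec incl_free :: "('c, 'f, 'r) fm \<Rightarrow> bool" where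
  "incl_free (Eq s t) = True"
| "incl_free (Rel r ts) = True"
| "incl_free (Incl ps) = False"
| "incl_free (Neg \<phi>) = incl_free \<phi>"
| "incl_free (And \<phi> \<psi>) = (incl_free \<phi> \<and> incl_free \<psi>)"
| "incl_free (Or1 \<phi> \<psi>) = (incl_free \<phi> \<and> incl_free \<psi>)"
| "incl_free (Exist1 x \<phi>) = incl_free \<phi>"
| "incl_free (Forall1 x \<phi>) = incl_free \<phi>"

primrec neg_free :: "('c, 'f, 'r) fm \<Rightarrow> bool" where
  "neg_free (Eq s t) = True"
| "neg_free (Rel r ts) = True"
| "neg_free (Incl ps) = True"
| "neg_free (Neg \<phi>) = False"
| "neg_free (And \<phi> \<psi>) = (neg_free \<phi> \<and> neg_free \<psi>)"
| "neg_free (Or1 \<phi> \<psi>) = (neg_free \<phi> \<and> neg_free \<psi>)"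
| "neg_free (Exist1 x \<phi>) = neg_free \<phi>"
| "neg_free (Forall1 x \<phi>) = neg_free \<phi>"


section \<open>Abbreviations\<close>

definition Bot :: "('c, 'f, 'r) fm" where
  "Bot = Exist1 0 (Neg (Eq (Var 0) (Var 0)))"

fun conjs :: "('c, 'f, 'r) fm list \<Rightarrow> ('c, 'f, 'r) fm" where
  "conjs [] = Neg Bot"
| "conjs [\<phi>] = \<phi>"
| "conjs (\<phi> # \<psi> # \<Phi>) = And \<phi> (conjs (\<psi> # \<Phi>))"

definition Exist1s :: "nat list \<Rightarrow> ('c, 'f, 'r) fm \<Rightarrow> ('c, 'f, 'r) fm" where
  "Exist1s xs \<phi> = foldr Exist1 xs \<phi>"

text \<open>A canonical choice of \<open>n\<close> distinct variables outside the finite set \<open>A\<close>.\<close>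

definition fresh_vars :: "nat set \<Rightarrow> nat \<Rightarrow> nat list" where
  "fresh_vars A n = (let m = (LEAST m. \<forall>x\<in>A. x < m) in [m..<m + n])"

text \<open>The constancy atom of a sequence of terms.\<close>

definition dep :: "('c, 'f) tm list \<Rightarrow> ('c, 'f, 'r) fm" where
  "dep ts = (let us = fresh_vars (\<Union> (tfv ` set ts)) (length ts)
     in Exist1s us (conjs (map2 (\<lambda>u t. Eq (Var u) t) us ts)))"

text \<open>Inclusion atoms whose arguments are variables or constant symbols: every constant symbol \<open>c\<close>
  is replaced by a fresh variable \<open>u\<close>, under \<open>\<exists>\<^sup>1u (u = c \<and> \<dots>)\<close>.  If no constant symbol occurs, this
  is the inclusion atom itself.  Arguments of the form \<open>Fn f ts\<close> are meaningless here; they are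
  excluded by \<open>substitutable\<close> below.\<close>

definition incl_consts :: "(('c, 'f) tm \<times> ('c, 'f) tm) list \<Rightarrow> 'c list" where
  "incl_consts ps = remdups
     (concat (map (\<lambda>t. case t of Cst c \<Rightarrow> [c] | _ \<Rightarrow> []) (map fst ps @ map snd ps)))"

definition incl :: "(('c, 'f) tm \<times> ('c, 'f) tm) list \<Rightarrow> ('c, 'f, 'r) fm" where
  "incl ps = (let cs = incl_consts ps;
       us = fresh_vars (\<Union>(s, t)\<in>set ps. tfv s \<union> tfv t) (length cs);
       arg = (\<lambda>t. case t of Var x \<Rightarrow> x | Cst c \<Rightarrow> the (map_of (zip cs us) c) | Fn f ts \<Rightarrow> 0)
     in Exist1s us (conjs (map2 (\<lambda>u c. Eq (Var u) (Cst c)) us cs @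
          [Incl (map (\<lambda>(s, t). (arg s, arg t)) ps)])))"


section \<open>Substitution\<close>

primrec tsubst :: "(nat \<Rightarrow> ('c, 'f) tm) \<Rightarrow> ('c, 'f) tm \<Rightarrow> ('c, 'f) tm" where
  "tsubst \<sigma> (Var x) = \<sigma> x"
| "tsubst \<sigma> (Cst c) = Cst c"
| "tsubst \<sigma> (Fn f ts) = Fn f (map (tsubst \<sigma>) ts)"

primrec fsubst :: "(nat \<Rightarrow> ('c, 'f) tm) \<Rightarrow> ('c, 'f, 'r) fm \<Rightarrow> ('c, 'f, 'r) fm" where
  "fsubst \<sigma> (Eq s t) = Eq (tsubst \<sigma> s) (tsubst \<sigma> t)"
| "fsubst \<sigma> (Rel r ts) = Rel r (map (tsubst \<sigma>) ts)"
| "fsubst \<sigma> (Incl ps) = incl (map (\<lambda>(x, y). (\<sigma> x, \<sigma> y)) ps)"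
| "fsubst \<sigma> (Neg \<phi>) = Neg (fsubst \<sigma> \<phi>)"
| "fsubst \<sigma> (And \<phi> \<psi>) = And (fsubst \<sigma> \<phi>) (fsubst \<sigma> \<psi>)"
| "fsubst \<sigma> (Or1 \<phi> \<psi>) = Or1 (fsubst \<sigma> \<phi>) (fsubst \<sigma> \<psi>)"
| "fsubst \<sigma> (Exist1 x \<phi>) = Exist1 x (fsubst (\<sigma>(x := Var x)) \<phi>)"
| "fsubst \<sigma> (Forall1 x \<phi>) = Forall1 x (fsubst (\<sigma>(x := Var x)) \<phi>)"

text \<open>The substituted terms are free for the variables they replace, and the arguments of inclusion
  atoms are only replaced by variables and constant symbols (otherwise the result is not a formula).\<close>

primrec substitutable :: "(nat \<Rightarrow> ('c, 'f) tm) \<Rightarrow> ('c, 'f, 'r) fm \<Rightarrow> bool" where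
  "substitutable \<sigma> (Eq s t) = True"
| "substitutable \<sigma> (Rel r ts) = True"
| "substitutable \<sigma> (Incl ps) = (\<forall>x\<in>fst ` set ps \<union> snd ` set ps. \<forall>f ts. \<sigma> x \<noteq> Fn f ts)"
| "substitutable \<sigma> (Neg \<phi>) = substitutable \<sigma> \<phi>"
| "substitutable \<sigma> (And \<phi> \<psi>) = (substitutable \<sigma> \<phi> \<and> substitutable \<sigma> \<psi>)"
| "substitutable \<sigma> (Or1 \<phi> \<psi>) = (substitutable \<sigma> \<phi> \<and> substitutable \<sigma> \<psi>)"
| "substitutable \<sigma> (Exist1 x \<phi>) =
     (substitutable (\<sigma>(x := Var x)) \<phi> \<and> (\<forall>y\<in>fv \<phi> - {x}. x \<notin> tfv (\<sigma> y)))"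
| "substitutable \<sigma> (Forall1 x \<phi>) =
     (substitutable (\<sigma>(x := Var x)) \<phi> \<and> (\<forall>y\<in>fv \<phi> - {x}. x \<notin> tfv (\<sigma> y)))"

definition sb :: "('c, 'f) tm list \<Rightarrow> nat list \<Rightarrow> nat \<Rightarrow> ('c, 'f) tm" where
  "sb ts xs x = (case map_of (zip xs ts) x of Some t \<Rightarrow> t | None \<Rightarrow> Var x)"

text \<open>\<open>rep \<phi> ts xs\<close> is \<open>\<phi>(ts/xs)\<close>.\<close>

abbreviation rep ::
  "('c, 'f, 'r) fm \<Rightarrow> ('c, 'f) tm list \<Rightarrow> nat list \<Rightarrow> ('c, 'f, 'r) fm" where
  "rep \<phi> ts xs \<equiv> fsubst (sb ts xs) \<phi>"

abbreviation rep_ok :: "('c, 'f, 'r) fm \<Rightarrow> ('c, 'f) tm list \<Rightarrow> nat list \<Rightarrow> bool" where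
  "rep_ok \<phi> ts xs \<equiv> substitutable (sb ts xs) \<phi>"

text \<open>Replacing each atom \<open>R x\<^sub>1\<dots>x\<^sub>n\<close> by \<open>x\<^sub>1\<dots>x\<^sub>n \<subseteq> v\<^sub>1\<dots>v\<^sub>n\<close>, for the \<open>n\<close>-ary symbol \<open>R\<close> named \<open>r\<close>, where
  \<open>n\<close> is the length of \<open>vs\<close>; \<open>rel_to_incl_ok\<close> says that \<open>R\<close> is applied to variables only and that no
  variable of \<open>vs\<close> gets bound by the replacement.\<close>

primrec rel_to_incl :: "'r \<Rightarrow> nat list \<Rightarrow> ('c, 'f, 'r) fm \<Rightarrow> ('c, 'f, 'r) fm" where
  "rel_to_incl r vs (Eq s t) = Eq s t"
| "rel_to_incl r vs (Rel r' ts) =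
     (if r' = r \<and> length ts = length vs
      then Inc (map (\<lambda>t. case t of Var x \<Rightarrow> x | _ \<Rightarrow> 0) ts) vs
      else Rel r' ts)"
| "rel_to_incl r vs (Incl ps) = Incl ps"
| "rel_to_incl r vs (Neg \<phi>) = Neg (rel_to_incl r vs \<phi>)"
| "rel_to_incl r vs (And \<phi> \<psi>) = And (rel_to_incl r vs \<phi>) (rel_to_incl r vs \<psi>)"
| "rel_to_incl r vs (Or1 \<phi> \<psi>) = Or1 (rel_to_incl r vs \<phi>) (rel_to_incl r vs \<psi>)"
| "rel_to_incl r vs (Exist1 x \<phi>) = Exist1 x (rel_to_incl r vs \<phi>)"
| "rel_to_incl r vs (Forall1 x \<phi>) = Forall1 x (rel_to_incl r vs \<phi>)"

primrec rel_to_incl_ok :: "'r \<Rightarrow> nat list \<Rightarrow> ('c, 'f, 'r) fm \<Rightarrow> bool" where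
  "rel_to_incl_ok r vs (Eq s t) = True"
| "rel_to_incl_ok r vs (Rel r' ts) =
     (r' = r \<and> length ts = length vs \<longrightarrow> (\<forall>t\<in>set ts. \<exists>x. t = Var x))"
| "rel_to_incl_ok r vs (Incl ps) = True"
| "rel_to_incl_ok r vs (Neg \<phi>) = rel_to_incl_ok r vs \<phi>"
| "rel_to_incl_ok r vs (And \<phi> \<psi>) = (rel_to_incl_ok r vs \<phi> \<and> rel_to_incl_ok r vs \<psi>)"
| "rel_to_incl_ok r vs (Or1 \<phi> \<psi>) = (rel_to_incl_ok r vs \<phi> \<and> rel_to_incl_ok r vs \<psi>)"
| "rel_to_incl_ok r vs (Exist1 x \<phi>) =
     (rel_to_incl_ok r vs \<phi> \<and> ((r, length vs) \<in> rels \<phi> \<longrightarrow> x \<notin> set vs))"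
| "rel_to_incl_ok r vs (Forall1 x \<phi>) =
     (rel_to_incl_ok r vs \<phi> \<and> ((r, length vs) \<in> rels \<phi> \<longrightarrow> x \<notin> set vs))"


section \<open>Team semantics\<close>

record ('c, 'f, 'r, 'u) model =
  carrier :: "'u set"
  cst :: "'c \<Rightarrow> 'u"
  fun_of :: "'f \<Rightarrow> 'u list \<Rightarrow> 'u"
  rel_of :: "'r \<Rightarrow> 'u list \<Rightarrow> bool"

definition fo_structure :: "('c, 'f, 'r, 'u) model \<Rightarrow> bool" where
  "fo_structure M \<longleftrightarrow> carrier M \<noteq> {} \<and> (\<forall>c. cst M c \<in> carrier M) \<and>
     (\<forall>f as. set as \<subseteq> carrier M \<longrightarrow> fun_of M f as \<in> carrier M)"

definition fo_structure2 :: "('c, 'f, 'r, 'u) model \<Rightarrow> bool" where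
  "fo_structure2 M \<longleftrightarrow> fo_structure M \<and> (\<exists>a\<in>carrier M. \<exists>b\<in>carrier M. a \<noteq> b)"

primrec tval :: "('c, 'f, 'r, 'u) model \<Rightarrow> (nat \<Rightarrow> 'u) \<Rightarrow> ('c, 'f) tm \<Rightarrow> 'u" where
  "tval M s (Var x) = s x"
| "tval M s (Cst c) = cst M c"
| "tval M s (Fn f ts) = fun_of M f (map (tval M s) ts)"

definition team_upd :: "(nat \<Rightarrow> 'u) set \<Rightarrow> nat \<Rightarrow> 'u \<Rightarrow> (nat \<Rightarrow> 'u) set" where
  "team_upd X x a = (\<lambda>s. s(x := a)) ` X"

primrec sat :: "('c, 'f, 'r, 'u) model \<Rightarrow> (nat \<Rightarrow> 'u) set \<Rightarrow> ('c, 'f, 'r) fm \<Rightarrow> bool" where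
  "sat M X (Eq t t') \<longleftrightarrow> (\<forall>s\<in>X. tval M s t = tval M s t')"
| "sat M X (Rel r ts) \<longleftrightarrow> (\<forall>s\<in>X. rel_of M r (map (tval M s) ts))"
| "sat M X (Incl ps) \<longleftrightarrow> (\<forall>s\<in>X. \<exists>s'\<in>X. map s (map fst ps) = map s' (map snd ps))"
| "sat M X (Neg \<phi>) \<longleftrightarrow> X = {} \<or> \<not> sat M X \<phi>"
| "sat M X (And \<phi> \<psi>) \<longleftrightarrow> sat M X \<phi> \<and> sat M X \<psi>"
| "sat M X (Or1 \<phi> \<psi>) \<longleftrightarrow> sat M X \<phi> \<or> sat M X \<psi>"
| "sat M X (Exist1 x \<phi>) \<longleftrightarrow> (\<exists>a\<in>carrier M. sat M (team_upd X x a) \<phi>)"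
| "sat M X (Forall1 x \<phi>) \<longleftrightarrow> (\<forall>a\<in>carrier M. sat M (team_upd X x a) \<phi>)"

text \<open>Truth in all models of the class \<open>K\<close> (with carriers in \<open>'u\<close>) and all their teams; a team over \<open>V\<close>
  is a set of functions from \<open>V\<close> to the carrier.\<close>

definition valid_in ::
  "(('c, 'f, 'r, 'u) model \<Rightarrow> bool) \<Rightarrow> ('c, 'f, 'r) fm \<Rightarrow> bool" where
  "valid_in K \<phi> \<longleftrightarrow> (\<forall>M V X. K M \<longrightarrow> fv \<phi> \<subseteq> V \<longrightarrow> X \<subseteq> (V \<rightarrow>\<^sub>E carrier M) \<longrightarrow> sat M X \<phi>)"

text \<open>Validity over all structures with at least one and with at least two elements.\<close>

definition fot_valid1 :: "'u itself \<Rightarrow> ('c, 'f, 'r) fm \<Rightarrow> bool" where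
  "fot_valid1 U \<phi> \<longleftrightarrow> valid_in (fo_structure :: ('c, 'f, 'r, 'u) model \<Rightarrow> bool) \<phi>"

definition fot_valid :: "'u itself \<Rightarrow> ('c, 'f, 'r) fm \<Rightarrow> bool" where
  "fot_valid U \<phi> \<longleftrightarrow> valid_in (fo_structure2 :: ('c, 'f, 'r, 'u) model \<Rightarrow> bool) \<phi>"


section \<open>Natural deduction\<close>

inductive ded :: "('c, 'f, 'r) fm set \<Rightarrow> ('c, 'f, 'r) fm \<Rightarrow> bool" (infix \<open>\<turnstile>\<close> 50) where
  ded_asm: "\<phi> \<in> \<Gamma> \<Longrightarrow> \<Gamma> \<turnstile> \<phi>"
| ded_eq_refl: "\<Gamma> \<turnstile> Eq t t"
| ded_eq_subst: "\<lbrakk>\<Gamma> \<turnstile> Eq t t'; \<Gamma> \<turnstile> rep \<phi> [t] [x]; rep_ok \<phi> [t] [x]; rep_ok \<phi> [t'] [x]\<rbrakk>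
    \<Longrightarrow> \<Gamma> \<turnstile> rep \<phi> [t'] [x]"
| ded_andI: "\<lbrakk>\<Gamma> \<turnstile> \<phi>; \<Gamma> \<turnstile> \<psi>\<rbrakk> \<Longrightarrow> \<Gamma> \<turnstile> And \<phi> \<psi>"
| ded_andE1: "\<Gamma> \<turnstile> And \<phi> \<psi> \<Longrightarrow> \<Gamma> \<turnstile> \<phi>"
| ded_andE2: "\<Gamma> \<turnstile> And \<phi> \<psi> \<Longrightarrow> \<Gamma> \<turnstile> \<psi>"
| ded_orI1: "\<Gamma> \<turnstile> \<phi> \<Longrightarrow> \<Gamma> \<turnstile> Or1 \<phi> \<psi>"
| ded_orI2: "\<Gamma> \<turnstile> \<phi> \<Longrightarrow> \<Gamma> \<turnstile> Or1 \<psi> \<phi>"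
| ded_orE: "\<lbrakk>\<Gamma> \<turnstile> Or1 \<phi> \<psi>; insert \<phi> \<Gamma> \<turnstile> \<chi>; insert \<psi> \<Gamma> \<turnstile> \<chi>\<rbrakk> \<Longrightarrow> \<Gamma> \<turnstile> \<chi>"
| ded_exI: "\<lbrakk>\<Gamma> \<turnstile> rep \<phi> [t] [x]; rep_ok \<phi> [t] [x]; \<Gamma> \<turnstile> dep [t]\<rbrakk> \<Longrightarrow> \<Gamma> \<turnstile> Exist1 x \<phi>"
| ded_exE_var: "\<lbrakk>\<Gamma> \<turnstile> Exist1 x \<phi>; insert (rep \<phi> [Var v] [x]) (insert (dep [Var v]) \<Gamma>) \<turnstile> \<psi>;
      rep_ok \<phi> [Var v] [x]; v \<notin> (\<Union>\<theta>\<in>\<Gamma> \<union> {\<phi>, \<psi>}. fv \<theta>)\<rbrakk> \<Longrightarrow> \<Gamma> \<turnstile> \<psi>"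
| ded_exE_cst: "\<lbrakk>\<Gamma> \<turnstile> Exist1 x \<phi>; insert (rep \<phi> [Cst c] [x]) \<Gamma> \<turnstile> \<psi>;
      c \<notin> (\<Union>\<theta>\<in>\<Gamma> \<union> {\<phi>, \<psi>}. csts \<theta>)\<rbrakk> \<Longrightarrow> \<Gamma> \<turnstile> \<psi>"
| ded_allI_var: "\<lbrakk>insert (dep [Var v]) \<Gamma> \<turnstile> rep \<phi> [Var v] [x]; rep_ok \<phi> [Var v] [x];
      v \<notin> (\<Union>\<theta>\<in>\<Gamma> \<union> {\<phi>}. fv \<theta>)\<rbrakk> \<Longrightarrow> \<Gamma> \<turnstile> Forall1 x \<phi>"
| ded_allI_cst: "\<lbrakk>\<Gamma> \<turnstile> rep \<phi> [Cst c] [x]; c \<notin> (\<Union>\<theta>\<in>\<Gamma> \<union> {\<phi>}. csts \<theta>)\<rbrakk> \<Longrightarrow> \<Gamma> \<turnstile> Forall1 x \<phi>"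
| ded_allE: "\<lbrakk>\<Gamma> \<turnstile> Forall1 x \<phi>; \<Gamma> \<turnstile> dep [t]; rep_ok \<phi> [t] [x]\<rbrakk> \<Longrightarrow> \<Gamma> \<turnstile> rep \<phi> [t] [x]"
| ded_negI: "insert \<phi> \<Gamma> \<turnstile> Bot \<Longrightarrow> \<Gamma> \<turnstile> Neg \<phi>"
| ded_negE: "\<lbrakk>\<Gamma> \<turnstile> \<phi>; \<Gamma> \<turnstile> Neg \<phi>\<rbrakk> \<Longrightarrow> \<Gamma> \<turnstile> \<psi>"
| ded_raa: "insert (Neg \<phi>) \<Gamma> \<turnstile> Bot \<Longrightarrow> \<Gamma> \<turnstile> \<phi>"
| ded_dep_cst: "\<Gamma> \<turnstile> dep (map Cst cs)"
| ded_dep_fn: "\<Gamma> \<turnstile> dep ts \<Longrightarrow> \<Gamma> \<turnstile> dep [Fn f ts]"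
| ded_inc_refl: "\<Gamma> \<turnstile> Inc xs xs"
| ded_inc_trans: "\<lbrakk>\<Gamma> \<turnstile> Inc xs ys; \<Gamma> \<turnstile> Inc ys zs; length xs = length ys; length ys = length zs\<rbrakk>
    \<Longrightarrow> \<Gamma> \<turnstile> Inc xs zs"
| ded_inc_proj: "\<lbrakk>\<Gamma> \<turnstile> Inc xs ys; length xs = length ys; set is \<subseteq> {..<length xs}\<rbrakk>
    \<Longrightarrow> \<Gamma> \<turnstile> Inc (map (\<lambda>i. xs ! i) is) (map (\<lambda>i. ys ! i) is)"
| ded_inc_subst: "\<lbrakk>\<Gamma> \<turnstile> Inc xs ys; \<Gamma> \<turnstile> rep \<alpha> (map Var ys) zs;
      length xs = length zs; length ys = length zs; distinct zs;
      neg_free \<alpha>; incl_free \<alpha>; fv \<alpha> \<subseteq> set zs;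
      rep_ok \<alpha> (map Var xs) zs; rep_ok \<alpha> (map Var ys) zs\<rbrakk>
    \<Longrightarrow> \<Gamma> \<turnstile> rep \<alpha> (map Var xs) zs"
| ded_inc_dep: "\<lbrakk>\<Gamma> \<turnstile> dep (map Var xs); \<Gamma> \<turnstile> Inc ys zs; length ys = length zs\<rbrakk>
    \<Longrightarrow> \<Gamma> \<turnstile> Inc (xs @ ys) (xs @ zs)"
| ded_inc_ex: "\<lbrakk>\<Gamma> \<turnstile> dep (map Var xs); \<Gamma> \<turnstile> Inc xs ys; length xs = length ys; length zs = length ws;
      distinct zs; set zs \<inter> (set xs \<union> set ys \<union> set ws) = {}\<rbrakk>
    \<Longrightarrow> \<Gamma> \<turnstile> Exist1s zs (Inc (zs @ xs) (ws @ ys))"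
| ded_neg_inc: "\<lbrakk>\<Gamma> \<turnstile> Neg (Inc xs ys);
      insert (incl (zip (map Cst cs) (map Var xs)))
        (insert (Neg (incl (zip (map Cst cs) (map Var ys)))) \<Gamma>) \<turnstile> \<phi>;
      length xs = length ys; length cs = length xs; distinct cs;
      set cs \<inter> (\<Union>\<theta>\<in>\<Gamma> \<union> {\<phi>}. csts \<theta>) = {}\<rbrakk> \<Longrightarrow> \<Gamma> \<turnstile> \<phi>"
  \<comment> \<open>In the next rule, \<open>cs\<close> must not occur in \<open>\<lambda>(xs)\<close> either: otherwise \<open>x = c\<close>, which is refutable
     from the assumption that \<open>x\<close> is not constant, would make that assumption inconsistent.\<close>
| ded_neg_atom: "\<lbrakk>\<Gamma> \<turnstile> Neg l; is_atom l; distinct xs; fv l \<subseteq> set xs;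
      insert (incl (zip (map Cst cs) (map Var xs)))
        (insert (Neg (rep l (map Cst cs) xs)) \<Gamma>) \<turnstile> \<phi>;
      length cs = length xs; distinct cs;
      set cs \<inter> (\<Union>\<theta>\<in>\<Gamma> \<union> {\<phi>, l}. csts \<theta>) = {}\<rbrakk> \<Longrightarrow> \<Gamma> \<turnstile> \<phi>"
| ded_rel_incl: "\<lbrakk>insert (Exist1s zs (Rel r (map Var zs))) (insert \<phi> \<Gamma>) \<turnstile> Bot;
      \<forall>\<theta>\<in>\<Gamma>. fv \<theta> = {} \<and> (r, length vs) \<notin> rels \<theta>;
      length zs = length vs; distinct zs; distinct vs;
      incl_free \<phi>; fv \<phi> = {}; rel_to_incl_ok r vs \<phi>\<rbrakk>
    \<Longrightarrow> insert (rel_to_incl r vs \<phi>) \<Gamma> \<turnstile> Bot"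

text \<open>Derivations may use fresh symbols: the vocabulary is extended by constant symbols \<open>Inr n\<close>
  and by relation symbols named \<open>Inr n\<close> of every arity.\<close>

definition embed :: "('c, 'f, 'r) fm \<Rightarrow> ('c + nat, 'f, 'r + nat) fm" where
  "embed = map_fm Inl id Inl"

definition fot_derives :: "('c, 'f, 'r) fm set \<Rightarrow> ('c, 'f, 'r) fm \<Rightarrow> bool"
    (infix \<open>\<turnstile>\<^sub>F\<^sub>O\<^sub>T\<close> 50) where
  "\<Gamma> \<turnstile>\<^sub>F\<^sub>O\<^sub>T \<phi> \<longleftrightarrow> embed ` \<Gamma> \<turnstile> embed \<phi>"

text \<open>All rules are sound also for structures with one element, so that this sentence is not derivable
  from the empty set, although it is true in every structure with at least two elements.\<close>

definition two_elements :: "('c, 'f, 'r) fm" where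
  "two_elements = Exist1 0 (Exist1 1 (Neg (Eq (Var 0) (Var 1))))"

end

theory Submission
  imports Defs "HOL-Library.Countable_Set" "HOL-Library.Countable"
begin

text \<open>Soundness is rule by rule. The rules with a fresh constant are sound because the constant may be
  reinterpreted: by the value of a quantified variable, or, in the two rules for negated atoms, by the
  values that \<open>xs\<close> takes at a row of the team where the atom fails. The rule that trades a relation
  symbol for inclusion atoms is sound because \<open>R\<close> may be interpreted by the set of values of \<open>vs\<close> in the
  team; then \<open>R xs\<close> and \<open>xs \<subseteq> vs\<close> say the same.

  Completeness is a Henkin construction. If \<open>\<phi>\<close> is not derivable from a finite set \<open>G\<close>, then \<open>G\<close> together
  with \<open>Neg \<phi>\<close> is extended to a maximal consistent set \<open>S\<close> with three kinds of witnesses: for \<open>Exist1\<close>, a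
  fresh variable \<open>w\<close> together with its constancy atom; for a negated first-order atom, and for a
  negated inclusion atom, a tuple of fresh constants that is included in the variables and violates
  the atom. Finitely many symbols occur in \<open>G\<close> and \<open>\<phi>\<close>, so a countable language is enough, and the
  model fits into any infinite universe.

  The elements of the model are the witness variables, up to provable equality. The variables
  of \<open>G\<close> and \<open>\<phi>\<close> lie below a bound \<open>N\<close>, and \<open>S\<close> describes a team: its rows are the tuples \<open>\<delta>\<close> of witness
  variables for which the inclusion of \<open>\<delta> 0 \<dots> \<delta> (N - 1)\<close> in the variables \<open>0 \<dots> N - 1\<close> is derivable from
  \<open>S\<close>. The crucial fact is \<open>rows_extend\<close>: a tuple of witness variables that is provably included in some
  of the variables below \<open>N\<close> is, up to provable equality, the part of a whole row; this is what the
  rule that extends inclusion atoms by a quantified tuple gives. With it, an atom is in \<open>S\<close> iff it is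
  provable at each row (\<open>S_atom_iff\<close>), where one direction is the substitution rule for inclusion atoms
  and the other one uses the witnesses of a negated atom; inclusion atoms are treated alike
  (\<open>S_incl_iff\<close>). Quantified variables are constant in a team, hence instances by witness variables
  suffice, and induction on formulas gives the \<open>truth_lemma\<close>.

  The same argument serves both halves of the theorem, with \<open>G\<close> empty and with \<open>G\<close> consisting of
  \<open>two_elements\<close>.\<close>

section \<open>Locality of team semantics\<close>

lemma team_upd_image: "team_upd (F ` I) x a = (\<lambda>i. (F i)(x := a)) ` I"
  by (simp add: team_upd_def image_image)

lemma team_upd_empty_iff [simp]: "team_upd X x a = {} \<longleftrightarrow> X = {}"
  by (simp add: team_upd_def)

lemma tval_cong: "(\<And>x. x \<in> tfv t \<Longrightarrow> s x = s' x) \<Longrightarrow> tval M s t = tval M s' t"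
proof (induction t)
  case (Fn f ts)
  then have "map (tval M s) ts = map (tval M s') ts" by (intro map_cong) auto
  then show ?case by (simp del: map_eq_conv)
qed auto

text \<open>Two teams are compared through families of assignments over a common index set. Agreement then
  survives an update of both teams, which is what the induction needs; a relation between the teams
  as mere sets would have to be re-established under each quantifier.\<close>

lemma sat_cong:
  assumes "\<And>i x. i \<in> I \<Longrightarrow> x \<in> fv \<phi> \<Longrightarrow> F i x = G i x"
  shows "sat M (F ` I) \<phi> \<longleftrightarrow> sat M (G ` I) \<phi>"
  using assms
proof (induction \<phi> arbitrary: F G)
  case (Eq t t')
  have "tval M (F i) t = tval M (G i) t" "tval M (F i) t' = tval M (G i) t'" if "i \<in> I" for i
    using Eq that by (auto intro!: tval_cong)
  then show ?case by simp
next
  case (Rel r ts)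
  have "map (tval M (F i)) ts = map (tval M (G i)) ts" if "i \<in> I" for i
    using Rel that by (auto intro!: tval_cong)
  then show ?case by (simp del: map_eq_conv)
next
  case (Incl ps)
  have "map (F i) (map fst ps) = map (G i) (map fst ps)"
    "map (F i) (map snd ps) = map (G i) (map snd ps)" if "i \<in> I" for i
    using Incl that by auto
  then show ?case by simp
next
  case (Exist1 x \<phi>)
  have "sat M (team_upd (F ` I) x a) \<phi> \<longleftrightarrow> sat M (team_upd (G ` I) x a) \<phi>" for a
    unfolding team_upd_image using Exist1(2) by (intro Exist1(1)) auto
  then show ?case by simp
next
  case (Forall1 x \<phi>)
  have "sat M (team_upd (F ` I) x a) \<phi> \<longleftrightarrow> sat M (team_upd (G ` I) x a) \<phi>" for a
    unfolding team_upd_image using Forall1(2) by (intro Forall1(1)) auto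
  then show ?case by simp
next
  case (Neg \<phi>)
  have "sat M (F ` I) \<phi> \<longleftrightarrow> sat M (G ` I) \<phi>" by (rule Neg(1)) (use Neg(2) in simp)
  then show ?case by simp
next
  case (And \<phi> \<psi>)
  have "sat M (F ` I) \<phi> \<longleftrightarrow> sat M (G ` I) \<phi>" by (rule And(1)) (use And(3) in simp)
  moreover have "sat M (F ` I) \<psi> \<longleftrightarrow> sat M (G ` I) \<psi>" by (rule And(2)) (use And(3) in simp)
  ultimately show ?case by simp
next
  case (Or1 \<phi> \<psi>)
  have "sat M (F ` I) \<phi> \<longleftrightarrow> sat M (G ` I) \<phi>" by (rule Or1(1)) (use Or1(3) in simp)
  moreover have "sat M (F ` I) \<psi> \<longleftrightarrow> sat M (G ` I) \<psi>" by (rule Or1(2)) (use Or1(3) in simp)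
  ultimately show ?case by simp
qed

lemma sat_image_cong:
  "(\<And>s x. s \<in> X \<Longrightarrow> x \<in> fv \<phi> \<Longrightarrow> F s x = s x) \<Longrightarrow> sat M (F ` X) \<phi> \<longleftrightarrow> sat M X \<phi>"
  using sat_cong[of X \<phi> F "\<lambda>s. s" M] by simp

lemma tval_symbols_cong:
  assumes "fun_of M' = fun_of M"
  shows "(\<And>c. c \<in> tcsts t \<Longrightarrow> cst M' c = cst M c) \<Longrightarrow> tval M' s t = tval M s t"
proof (induction t)
  case (Fn f ts)
  then have "map (tval M' s) ts = map (tval M s) ts" by (intro map_cong) auto
  then show ?case by (simp add: assms del: map_eq_conv)
qed auto

text \<open>Arities matter here: a relation name may be reinterpreted at one arity and kept at the others.\<close>

lemma sat_symbols_cong: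
  assumes "carrier M' = carrier M" "fun_of M' = fun_of M"
    and "\<And>c. c \<in> csts \<phi> \<Longrightarrow> cst M' c = cst M c"
    and "\<And>r as. (r, length as) \<in> rels \<phi> \<Longrightarrow> rel_of M' r as = rel_of M r as"
  shows "sat M' X \<phi> \<longleftrightarrow> sat M X \<phi>"
proof -
  note t = tval_symbols_cong[OF assms(2)]
  show ?thesis
    using assms(3,4)
  proof (induction \<phi> arbitrary: X)
    case (Eq u v)
    then have "tval M' s u = tval M s u" "tval M' s v = tval M s v" for s by (auto intro!: t)
    then show ?case by simp
  next
    case (Rel r ts)
    then have "map (tval M' s) ts = map (tval M s) ts" for s by (auto intro!: t)
    then show ?case using Rel(2) by (simp del: map_eq_conv)
  qed (auto simp: assms(1))
qed

lemma sat_empty: "carrier M \<noteq> {} \<Longrightarrow> sat M {} \<phi>"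
  by (induction \<phi>) (auto simp: team_upd_def)

lemma sat_Bot: "carrier M \<noteq> {} \<Longrightarrow> sat M X Bot \<longleftrightarrow> X = {}"
  by (auto simp: Bot_def)

lemma sat_conjs: "carrier M \<noteq> {} \<Longrightarrow> sat M X (conjs \<Phi>) \<longleftrightarrow> (\<forall>\<phi>\<in>set \<Phi>. sat M X \<phi>)"
  by (induction \<Phi> rule: conjs.induct) (auto simp: sat_Bot)

lemma fresh_vars:
  assumes "finite A"
  shows "distinct (fresh_vars A n)" "length (fresh_vars A n) = n" "set (fresh_vars A n) \<inter> A = {}"
proof -
  define m where "m = (LEAST m. \<forall>x\<in>A. x < m)"
  have "\<exists>m. \<forall>x\<in>A. x < m" using assms finite_nat_set_iff_bounded by auto
  then have "\<forall>x\<in>A. x < m" unfolding m_def by (rule LeastI_ex)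
  then show "distinct (fresh_vars A n)" "length (fresh_vars A n) = n" "set (fresh_vars A n) \<inter> A = {}"
    by (auto simp: fresh_vars_def Let_def m_def[symmetric])
qed

lemma finite_tfv [simp]: "finite (tfv t)"
  by (induction t) auto

section \<open>Values of constancy and inclusion atoms\<close>

text \<open>Simultaneous update; it serves for assignments, for interpretations of constants and for variable
  renamings alike. A key that occurs twice takes its first value, so most facts ask for distinct keys.\<close>

definition upds :: "('k \<Rightarrow> 'a) \<Rightarrow> 'k list \<Rightarrow> 'a list \<Rightarrow> 'k \<Rightarrow> 'a" where
  "upds s xs as x = (case map_of (zip xs as) x of Some a \<Rightarrow> a | None \<Rightarrow> s x)"

lemma upds_Nil [simp]: "upds s [] as = s"
  by (simp add: upds_def fun_eq_iff)

lemma upds_Cons: "x \<notin> set xs \<Longrightarrow> upds s (x # xs) (a # as) = upds (s(x := a)) xs as"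
  by (auto simp: upds_def fun_eq_iff split: option.split dest: map_of_SomeD set_zip_leftD)

lemma upds_notin: "x \<notin> set xs \<Longrightarrow> upds s xs as x = s x"
  by (auto simp: upds_def split: option.split dest: map_of_SomeD set_zip_leftD)

lemma upds_nth: "distinct xs \<Longrightarrow> length as = length xs \<Longrightarrow> i < length xs \<Longrightarrow> upds s xs as (xs ! i) = as ! i"
  by (simp add: upds_def map_of_zip_nth)

lemma map_upds: "distinct xs \<Longrightarrow> length as = length xs \<Longrightarrow> map (upds s xs as) xs = as"
  by (auto intro!: nth_equalityI simp: upds_nth)

lemma sb_upds: "sb ts xs = upds Var xs ts"
  by (auto simp: sb_def upds_def fun_eq_iff)

lemma sat_Exist1s:
  assumes "distinct us"
  shows "sat M X (Exist1s us \<phi>) \<longleftrightarrow> (\<exists>as. length as = length us \<and> set as \<subseteq> carrier M \<and>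
     sat M ((\<lambda>s. upds s us as) ` X) \<phi>)"
  using assms
proof (induction us arbitrary: X)
  case Nil
  then show ?case by (simp add: Exist1s_def)
next
  case (Cons u us)
  have *: "(\<lambda>s. upds s us as) ` team_upd X u a = (\<lambda>s. upds s (u # us) (a # as)) ` X" for a as
    using Cons(2) by (simp add: team_upd_def image_image upds_Cons)
  have "sat M X (Exist1s (u # us) \<phi>) \<longleftrightarrow> (\<exists>a\<in>carrier M. sat M (team_upd X u a) (Exist1s us \<phi>))"
    by (simp add: Exist1s_def)
  also have "\<dots> \<longleftrightarrow> (\<exists>a\<in>carrier M. \<exists>as. length as = length us \<and> set as \<subseteq> carrier M \<and>
     sat M ((\<lambda>s. upds s (u # us) (a # as)) ` X) \<phi>)"
    using Cons * by simp
  also have "\<dots> \<longleftrightarrow> (\<exists>as. length as = length (u # us) \<and> set as \<subseteq> carrier M \<and>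
     sat M ((\<lambda>s. upds s (u # us) as) ` X) \<phi>)"
  proof (intro iffI)
    assume "\<exists>a\<in>carrier M. \<exists>as. length as = length us \<and> set as \<subseteq> carrier M \<and>
     sat M ((\<lambda>s. upds s (u # us) (a # as)) ` X) \<phi>"
    then obtain a as where "a \<in> carrier M" "length as = length us" "set as \<subseteq> carrier M"
      "sat M ((\<lambda>s. upds s (u # us) (a # as)) ` X) \<phi>" by blast
    then show "\<exists>as. length as = length (u # us) \<and> set as \<subseteq> carrier M \<and> sat M ((\<lambda>s. upds s (u # us) as) ` X) \<phi>"
      by (intro exI[of _ "a # as"]) simp
  next
    assume "\<exists>as. length as = length (u # us) \<and> set as \<subseteq> carrier M \<and> sat M ((\<lambda>s. upds s (u # us) as) ` X) \<phi>"
    then obtain as where as: "length as = length (u # us)" "set as \<subseteq> carrier M"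
      "sat M ((\<lambda>s. upds s (u # us) as) ` X) \<phi>" by blast
    then obtain a as' where "as = a # as'" by (cases as) auto
    with as show "\<exists>a\<in>carrier M. \<exists>as. length as = length us \<and> set as \<subseteq> carrier M \<and>
     sat M ((\<lambda>s. upds s (u # us) (a # as)) ` X) \<phi>"
      by (intro bexI[of _ a] exI[of _ as']) auto
  qed
  finally show ?case .
qed

abbreviation tot :: "('c, 'f, 'r, 'u) model \<Rightarrow> (nat \<Rightarrow> 'u) set" where
  "tot M \<equiv> {s. \<forall>x. s x \<in> carrier M}"

lemma tval_in: "fo_structure M \<Longrightarrow> s \<in> tot M \<Longrightarrow> tval M s t \<in> carrier M"
proof (induction t)
  case (Fn f ts)
  then have "set (map (tval M s) ts) \<subseteq> carrier M" by auto
  then show ?case using Fn(2) unfolding fo_structure_def by (metis tval.simps(3))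
qed (auto simp: fo_structure_def)

text \<open>Constancy atoms, and inclusion atoms with constant symbols as arguments, both have this shape: the
  quantified variables \<open>us\<close> name the constant values of the terms \<open>ts\<close>.\<close>

lemma sat_named:
  assumes M: "fo_structure M" and X: "X \<subseteq> tot M"
    and us: "distinct us" "length ts = length us" "set us \<inter> (\<Union>t\<in>set ts. tfv t) = {}"
  shows "sat M X (Exist1s us (conjs (map2 (\<lambda>u t. Eq (Var u) t) us ts @ \<Psi>))) \<longleftrightarrow>
    (\<exists>as. length as = length ts \<and> set as \<subseteq> carrier M \<and> (\<forall>s\<in>X. map (tval M s) ts = as) \<and>
       (\<forall>\<psi>\<in>set \<Psi>. sat M ((\<lambda>s. upds s us as) ` X) \<psi>))"
proof -
  have ne: "carrier M \<noteq> {}" using M by (auto simp: fo_structure_def)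
  have "(\<forall>\<phi>\<in>set (map2 (\<lambda>u t. Eq (Var u) t) us ts). sat M ((\<lambda>s. upds s us as) ` X) \<phi>) \<longleftrightarrow>
    (\<forall>s\<in>X. map (tval M s) ts = as)" if "length as = length us" for as
  proof -
    have "tval M (upds s us as) t = tval M s t" if "t \<in> set ts" for s t
      using us(3) that by (intro tval_cong upds_notin) auto
    moreover have "upds s us as (us ! i) = as ! i" if "i < length us" for s i
      using that us(1) \<open>length as = _\<close> by (simp add: upds_nth)
    ultimately have e: "sat M ((\<lambda>s. upds s us as) ` X) (Eq (Var (us ! i)) (ts ! i)) \<longleftrightarrow>
        (\<forall>s\<in>X. as ! i = tval M s (ts ! i))" if "i < length us" for i
      using us(2) that by simp
    have "(\<forall>\<phi>\<in>set (map2 (\<lambda>u t. Eq (Var u) t) us ts). sat M ((\<lambda>s. upds s us as) ` X) \<phi>) \<longleftrightarrow>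
       (\<forall>i<length us. sat M ((\<lambda>s. upds s us as) ` X) (Eq (Var (us ! i)) (ts ! i)))"
      using us(2) by (simp add: all_set_conv_all_nth del: sat.simps)
    also have "\<dots> \<longleftrightarrow> (\<forall>i<length us. \<forall>s\<in>X. as ! i = tval M s (ts ! i))"
      using e by blast
    also have "\<dots> \<longleftrightarrow> (\<forall>s\<in>X. map (tval M s) ts = as)"
      using that us(2) by (auto simp: list_eq_iff_nth_eq)
    finally show ?thesis .
  qed
  then show ?thesis
    unfolding sat_Exist1s[OF us(1)] sat_conjs[OF ne] set_append ball_Un us(2)
    by (intro ex_cong1) blast
qed

lemma sat_dep:
  assumes M: "fo_structure M" and X: "X \<subseteq> tot M"
  shows "sat M X (dep ts) \<longleftrightarrow> (\<forall>s\<in>X. \<forall>s'\<in>X. map (tval M s) ts = map (tval M s') ts)"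
proof -
  define us where "us = fresh_vars (\<Union> (tfv ` set ts)) (length ts)"
  have us: "distinct us" "length ts = length us" "set us \<inter> (\<Union>t\<in>set ts. tfv t) = {}"
    unfolding us_def by (simp_all add: fresh_vars)
  obtain a where a: "a \<in> carrier M" using M by (auto simp: fo_structure_def)
  have "sat M X (dep ts) \<longleftrightarrow>
    (\<exists>as. length as = length ts \<and> set as \<subseteq> carrier M \<and> (\<forall>s\<in>X. map (tval M s) ts = as))"
    using sat_named[OF M X us, of "[]"] by (simp add: dep_def Let_def us_def)
  also have "\<dots> \<longleftrightarrow> (\<forall>s\<in>X. \<forall>s'\<in>X. map (tval M s) ts = map (tval M s') ts)"
  proof (cases "X = {}")
    case True
    then show ?thesis using a by (auto intro!: exI[of _ "replicate (length ts) a"])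
  next
    case False
    then obtain s where "s \<in> X" by auto
    moreover then have "set (map (tval M s) ts) \<subseteq> carrier M" using tval_in[OF M] X by auto
    ultimately show ?thesis by (metis length_map)
  qed
  finally show ?thesis .
qed

lemma set_incl_consts: "set (incl_consts ps) = {c. Cst c \<in> fst ` set ps \<union> snd ` set ps}"
  by (force simp: incl_consts_def split: tm.splits)

text \<open>The choice of the auxiliary variables disappears: an inclusion atom with constant symbols is true
  under the expected condition on the values of its arguments.\<close>

lemma sat_incl:
  assumes M: "fo_structure M" and X: "X \<subseteq> tot M"
    and ps: "\<And>a b f ts. (a, b) \<in> set ps \<Longrightarrow> a \<noteq> Fn f ts \<and> b \<noteq> Fn f ts"
  shows "sat M X (incl ps) \<longleftrightarrow>
    (\<forall>s\<in>X. \<exists>s'\<in>X. \<forall>(a, b)\<in>set ps. tval M s a = tval M s' b)"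
proof -
  define cs where "cs = incl_consts ps"
  define us where "us = fresh_vars (\<Union>(s, t)\<in>set ps. tfv s \<union> tfv t) (length cs)"
  define arg where "arg = (\<lambda>t. case t of Var x \<Rightarrow> x | Cst c \<Rightarrow> the (map_of (zip cs us) c) | Fn (f :: 'b) ts \<Rightarrow> 0)"
  define as where "as = map (cst M) cs"
  have fin: "finite (\<Union>(s, t)\<in>set ps. tfv s \<union> tfv t)" by auto
  have us: "distinct us" "length cs = length us" "set us \<inter> (\<Union>(s, t)\<in>set ps. tfv s \<union> tfv t) = {}"
    unfolding us_def by (simp_all add: fresh_vars[OF fin])
  have arg: "upds s us as (arg a) = tval M s a"
    if "a \<in> fst ` set ps \<union> snd ` set ps" for a s
  proof (cases a)
    case (Var x)
    then have "x \<notin> set us" using that us(3) by fastforce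
    then show ?thesis using Var by (simp add: arg_def upds_notin)
  next
    case (Cst c)
    then have "c \<in> set cs" using that by (auto simp: cs_def set_incl_consts)
    then obtain i where i: "i < length cs" "c = cs ! i" by (metis in_set_conv_nth)
    have d: "distinct cs" by (simp add: cs_def incl_consts_def)
    have "arg a = us ! i" using i us(2) d by (simp add: arg_def Cst map_of_zip_nth)
    then show ?thesis using i us Cst by (simp add: upds_nth as_def)
  next
    case (Fn f ts)
    then show ?thesis using ps that by fastforce
  qed
  have "sat M X (incl ps) \<longleftrightarrow> sat M X (Exist1s us (conjs (map2 (\<lambda>u t. Eq (Var u) t) us (map Cst cs) @
     [Incl (map (\<lambda>(s, t). (arg s, arg t)) ps)])))"
    unfolding incl_def Let_def arg_def us_def cs_def by (simp add: zip_map2 comp_def case_prod_unfold)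
  also have "\<dots> \<longleftrightarrow> sat M ((\<lambda>s. upds s us as) ` X) (Incl (map (\<lambda>(s, t). (arg s, arg t)) ps))"
  proof (cases "X = {}")
    case True
    obtain a where "a \<in> carrier M" using M by (auto simp: fo_structure_def)
    then show ?thesis using True us
      by (subst sat_named[OF M X]) (auto intro!: exI[of _ "replicate (length cs) a"])
  next
    case False
    have "map (tval M s) (map Cst cs) = as" for s by (simp add: as_def)
    moreover have "set as \<subseteq> carrier M" using M by (auto simp: as_def fo_structure_def)
    moreover have "length as = length us" using us by (simp add: as_def)
    ultimately show ?thesis using us False
      by (subst sat_named[OF M X]) (auto simp del: sat.simps map_map)
  qed
  also have "\<dots> \<longleftrightarrow> (\<forall>s\<in>X. \<exists>s'\<in>X. \<forall>(a, b)\<in>set ps. upds s us as (arg a) = upds s' us as (arg b))"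
    by (simp add: case_prod_unfold)
  also have "\<dots> \<longleftrightarrow> (\<forall>s\<in>X. \<exists>s'\<in>X. \<forall>(a, b)\<in>set ps. tval M s a = tval M s' b)"
    using arg by (fastforce simp: case_prod_unfold)
  finally show ?thesis .
qed

section \<open>Soundness\<close>

lemma tval_tsubst: "tval M s (tsubst \<sigma> t) = tval M (\<lambda>x. tval M s (\<sigma> x)) t"
proof (induction t)
  case (Fn f ts)
  then have "map (tval M s \<circ> tsubst \<sigma>) ts = map (tval M (\<lambda>x. tval M s (\<sigma> x))) ts"
    by (intro map_cong) auto
  then show ?case by (simp del: map_eq_conv)
qed auto

text \<open>Substitution is a change of team. The hypothesis on \<open>F\<close> only concerns free variables, so that it can
  be kept under a quantifier, where \<open>\<sigma>\<close> is reset at the bound variable.\<close>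

lemma sat_fsubst:
  assumes "fo_structure M" "\<And>i. i \<in> I \<Longrightarrow> G i \<in> tot M" "substitutable \<sigma> \<phi>"
    and "\<And>i x. i \<in> I \<Longrightarrow> x \<in> fv \<phi> \<Longrightarrow> F i x = tval M (G i) (\<sigma> x)"
  shows "sat M (G ` I) (fsubst \<sigma> \<phi>) \<longleftrightarrow> sat M (F ` I) \<phi>"
  using assms(2-4)
proof (induction \<phi> arbitrary: F G \<sigma>)
  case (Eq t t')
  have "tval M (\<lambda>x. tval M (G i) (\<sigma> x)) t = tval M (F i) t"
    "tval M (\<lambda>x. tval M (G i) (\<sigma> x)) t' = tval M (F i) t'" if "i \<in> I" for i
    using Eq(3) that by (auto intro!: tval_cong)
  then show ?case by (simp add: tval_tsubst)
next
  case (Rel r ts)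
  have "map (tval M (\<lambda>x. tval M (G i) (\<sigma> x))) ts = map (tval M (F i)) ts" if "i \<in> I" for i
    using Rel(3)[symmetric] that by (intro map_cong refl tval_cong) auto
  then show ?case by (simp add: tval_tsubst comp_def del: map_eq_conv)
next
  case (Incl ps)
  have "sat M (G ` I) (fsubst \<sigma> (Incl ps)) \<longleftrightarrow>
    (\<forall>i\<in>I. \<exists>j\<in>I. \<forall>(x, y)\<in>set ps. tval M (G i) (\<sigma> x) = tval M (G j) (\<sigma> y))"
    unfolding fsubst.simps
  proof (subst sat_incl[OF assms(1)])
    show "G ` I \<subseteq> tot M" using Incl(1) by blast
    show "a \<noteq> Fn f ts \<and> b \<noteq> Fn f ts" if ab: "(a, b) \<in> set (map (\<lambda>(x, y). (\<sigma> x, \<sigma> y)) ps)" for a b f ts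
    proof -
      obtain x y where "(x, y) \<in> set ps" "a = \<sigma> x" "b = \<sigma> y" using ab by auto
      then show ?thesis using Incl(2) by force
    qed
  qed (simp add: case_prod_unfold)
  also have "\<dots> \<longleftrightarrow> (\<forall>i\<in>I. \<exists>j\<in>I. \<forall>(x, y)\<in>set ps. F i x = F j y)"
  proof -
    have "F i x = tval M (G i) (\<sigma> x)" "F i y = tval M (G i) (\<sigma> y)"
      if "i \<in> I" "(x, y) \<in> set ps" for i x y
      using Incl(3)[OF that(1)] that(2) by force+
    then show ?thesis by (intro ball_cong bex_cong refl) auto
  qed
  finally show ?case by (simp add: case_prod_unfold)
next
  case (Neg \<phi>)
  have "sat M (G ` I) (fsubst \<sigma> \<phi>) \<longleftrightarrow> sat M (F ` I) \<phi>" by (rule Neg(1)) (use Neg(2-) in simp_all)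
  then show ?case by simp
next
  case (And \<phi> \<psi>)
  have "sat M (G ` I) (fsubst \<sigma> \<phi>) \<longleftrightarrow> sat M (F ` I) \<phi>" by (rule And(1)) (use And(3-) in simp_all)
  moreover have "sat M (G ` I) (fsubst \<sigma> \<psi>) \<longleftrightarrow> sat M (F ` I) \<psi>" by (rule And(2)) (use And(3-) in simp_all)
  ultimately show ?case by simp
next
  case (Or1 \<phi> \<psi>)
  have "sat M (G ` I) (fsubst \<sigma> \<phi>) \<longleftrightarrow> sat M (F ` I) \<phi>" by (rule Or1(1)) (use Or1(3-) in simp_all)
  moreover have "sat M (G ` I) (fsubst \<sigma> \<psi>) \<longleftrightarrow> sat M (F ` I) \<psi>" by (rule Or1(2)) (use Or1(3-) in simp_all)
  ultimately show ?case by simp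
next
  case (Exist1 x \<phi>)
  have "sat M (team_upd (G ` I) x a) (fsubst (\<sigma>(x := Var x)) \<phi>) \<longleftrightarrow> sat M (team_upd (F ` I) x a) \<phi>"
    if a: "a \<in> carrier M" for a
    unfolding team_upd_image
  proof (rule Exist1(1))
    show "((F i)(x := a)) y = tval M ((G i)(x := a)) ((\<sigma>(x := Var x)) y)" if "i \<in> I" "y \<in> fv \<phi>" for i y
    proof (cases "y = x")
      case False
      then have "tval M ((G i)(x := a)) (\<sigma> y) = tval M (G i) (\<sigma> y)"
        using Exist1(3) that by (intro tval_cong) auto
      then show ?thesis using False Exist1(4)[of i y] that by simp
    qed simp
    show "(G i)(x := a) \<in> tot M" if "i \<in> I" for i using Exist1(2) that a by auto
  qed (use Exist1(3) in \<open>simp del: fun_upd_apply\<close>)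
  then show ?case by simp
next
  case (Forall1 x \<phi>)
  have "sat M (team_upd (G ` I) x a) (fsubst (\<sigma>(x := Var x)) \<phi>) \<longleftrightarrow> sat M (team_upd (F ` I) x a) \<phi>"
    if a: "a \<in> carrier M" for a
    unfolding team_upd_image
  proof (rule Forall1(1))
    show "((F i)(x := a)) y = tval M ((G i)(x := a)) ((\<sigma>(x := Var x)) y)" if "i \<in> I" "y \<in> fv \<phi>" for i y
    proof (cases "y = x")
      case False
      then have "tval M ((G i)(x := a)) (\<sigma> y) = tval M (G i) (\<sigma> y)"
        using Forall1(3) that by (intro tval_cong) auto
      then show ?thesis using False Forall1(4)[of i y] that by simp
    qed simp
    show "(G i)(x := a) \<in> tot M" if "i \<in> I" for i using Forall1(2) that a by auto
  qed (use Forall1(3) in \<open>simp del: fun_upd_apply\<close>)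
  then show ?case by simp
qed

lemma tval_sb: "tval M s (sb ts xs x) = upds s xs (map (tval M s) ts) x"
  by (auto simp: sb_def upds_def zip_map2 map_of_map map_prod_def split: option.split)

lemma sat_rep:
  assumes "fo_structure M" "X \<subseteq> tot M" "rep_ok \<phi> ts xs"
  shows "sat M X (rep \<phi> ts xs) \<longleftrightarrow> sat M ((\<lambda>s. upds s xs (map (tval M s) ts)) ` X) \<phi>"
  using sat_fsubst[OF assms(1), of X "\<lambda>s. s" "sb ts xs" \<phi> "\<lambda>s. upds s xs (map (tval M s) ts)"] assms(2,3)
  by (auto simp: tval_sb)

lemma upds_single: "upds s [x] [a] = s(x := a)"
  by (simp add: upds_Cons)

lemma sat_rep_const:
  assumes "fo_structure M" "X \<subseteq> tot M" "rep_ok \<phi> [t] [x]" "\<And>s. s \<in> X \<Longrightarrow> tval M s t = a"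
  shows "sat M X (rep \<phi> [t] [x]) \<longleftrightarrow> sat M (team_upd X x a) \<phi>"
proof -
  have "(\<lambda>s. upds s [x] (map (tval M s) [t])) ` X = team_upd X x a"
    unfolding team_upd_def using assms(4) by (intro image_cong) (auto simp: upds_single)
  then show ?thesis using sat_rep[OF assms(1-3)] by simp
qed

lemma rep_ok_Cst: "(\<And>x. \<exists>c. \<sigma> x = Cst c \<or> \<sigma> x = Var x) \<Longrightarrow> substitutable \<sigma> \<phi>"
proof (induction \<phi> arbitrary: \<sigma>)
  case (Incl ps)
  have "\<sigma> x \<noteq> Fn f ts" for x f ts using Incl[of x] by auto
  then show ?case by simp
next
  case (Exist1 x \<phi>)
  have "x \<notin> tfv (\<sigma> y)" if "y \<noteq> x" for y using Exist1(2)[of y] that by auto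
  moreover have "substitutable (\<sigma>(x := Var x)) \<phi>" using Exist1 by auto
  ultimately show ?case by auto
next
  case (Forall1 x \<phi>)
  have "x \<notin> tfv (\<sigma> y)" if "y \<noteq> x" for y using Forall1(2)[of y] that by auto
  moreover have "substitutable (\<sigma>(x := Var x)) \<phi>" using Forall1 by auto
  ultimately show ?case by auto
qed auto

text \<open>Formulas without negation and inclusion are closed under subteams, which justifies the substitution
  rule for inclusion atoms: the values of \<open>xs\<close> form a subteam of the values of \<open>ys\<close>.\<close>

lemma sat_downward:
  "neg_free \<alpha> \<Longrightarrow> incl_free \<alpha> \<Longrightarrow> sat M X \<alpha> \<Longrightarrow> Y \<subseteq> X \<Longrightarrow> sat M Y \<alpha>"
proof (induction \<alpha> arbitrary: X Y)
  case (Exist1 x \<alpha>)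
  have "team_upd Y x a \<subseteq> team_upd X x a" for a using Exist1(5) by (auto simp: team_upd_def)
  then show ?case using Exist1(1)[of "team_upd X x _" "team_upd Y x _"] Exist1(2-4) by simp metis
next
  case (Forall1 x \<alpha>)
  have "team_upd Y x a \<subseteq> team_upd X x a" for a using Forall1(5) by (auto simp: team_upd_def)
  then show ?case using Forall1(1)[of "team_upd X x _" "team_upd Y x _"] Forall1(2-4) by auto
qed auto

text \<open>The quantifiers of the formula change the team from \<open>X\<close> to \<open>F ` X\<close>, but never at \<open>vs\<close>; hence \<open>xs \<subseteq> vs\<close> keeps
  comparing with the values of \<open>vs\<close> in the original team, which are those of the relation \<open>R\<close>.\<close>

lemma sat_rel_to_incl:
  assumes "M' = M\<lparr>rel_of := \<lambda>r' as. if r' = r \<and> length as = length vs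
      then as \<in> (\<lambda>s. map s vs) ` X else rel_of M r' as\<rparr>"
    and "incl_free \<phi>" "rel_to_incl_ok r vs \<phi>"
    and "(r, length vs) \<in> rels \<phi> \<Longrightarrow> \<forall>s\<in>X. \<forall>v\<in>set vs. F s v = s v"
  shows "sat M (F ` X) (rel_to_incl r vs \<phi>) \<longleftrightarrow> sat M' (F ` X) \<phi>"
  using assms(2-4)
proof (induction \<phi> arbitrary: F)
  case (Eq t t')
  have "tval M' s t = tval M s t" for s t by (rule tval_symbols_cong) (simp_all add: assms(1))
  then show ?case by simp
next
  case (Rel r' ts)
  have t: "tval M' s t = tval M s t" for s t by (rule tval_symbols_cong) (simp_all add: assms(1))
  show ?case
  proof (cases "r' = r \<and> length ts = length vs")
    case True
    define xs where "xs = map (\<lambda>t. case t of Var x \<Rightarrow> x | _ \<Rightarrow> 0) ts"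
    have "ts = map Var xs" unfolding xs_def map_map by (rule map_idI[symmetric]) (use True Rel(2) in auto)
    have "map (F s) vs = map s vs" if "s \<in> X" for s using Rel(3) True that by auto
    then show ?thesis using True \<open>ts = _\<close>
      by (simp add: t xs_def[symmetric] assms(1) comp_def image_iff del: map_eq_conv cong: bex_cong)
  next
    case False
    have "map (tval M' s) ts = map (tval M s) ts" for s by (simp add: t)
    moreover have "rel_of M' r' as \<longleftrightarrow> rel_of M r' as" if "length as = length ts" for as
      using False that by (auto simp: assms(1))
    ultimately have "rel_of M' r' (map (tval M' s) ts) \<longleftrightarrow> rel_of M r' (map (tval M s) ts)" for s
      by (simp del: map_eq_conv)
    then show ?thesis using False by auto
  qed
next
  case (Exist1 x \<phi>)
  have "sat M (team_upd (F ` X) x a) (rel_to_incl r vs \<phi>) \<longleftrightarrow> sat M' (team_upd (F ` X) x a) \<phi>" for a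
    unfolding team_upd_image using Exist1(2-) by (intro Exist1(1)) auto
  then show ?case by (simp add: assms(1))
next
  case (Forall1 x \<phi>)
  have "sat M (team_upd (F ` X) x a) (rel_to_incl r vs \<phi>) \<longleftrightarrow> sat M' (team_upd (F ` X) x a) \<phi>" for a
    unfolding team_upd_image using Forall1(2-) by (intro Forall1(1)) auto
  then show ?case by (simp add: assms(1))
qed auto

lemma rep_ok_sb_Csts: "rep_ok \<phi> (map Cst cs) xs"
  by (rule rep_ok_Cst) (auto simp: sb_def zip_map2 map_of_map split: option.split)

lemma rep_ok_sb_Cst: "rep_ok \<phi> [Cst c] [x]"
  using rep_ok_sb_Csts[of "[c]" "[x]" \<phi>] by simp

lemma upds_cst_in:
  "fo_structure M \<Longrightarrow> set as \<subseteq> carrier M \<Longrightarrow> upds (cst M) cs as c \<in> carrier M"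
  by (auto simp: upds_def fo_structure_def split: option.split dest!: map_of_SomeD set_zip_rightD)

lemma upds_map_same: "x \<in> set xs \<Longrightarrow> upds s' xs (map s xs) x = s x"
  by (auto simp: upds_def map_of_zip_map)

lemma sat_incl_Cst:
  assumes "fo_structure M" "X \<subseteq> tot M" "length cs = length xs" "X \<noteq> {}"
  shows "sat M X (incl (zip (map Cst cs) (map Var xs))) \<longleftrightarrow> (\<exists>s\<in>X. map (cst M) cs = map s xs)"
proof -
  have "(\<forall>(a, b)\<in>set (zip (map Cst cs) (map Var xs)). tval M s a = tval M s' b) \<longleftrightarrow> map (cst M) cs = map s' xs"
    for s s'
  proof -
    have "(\<forall>(a, b)\<in>set (zip (map Cst cs) (map Var xs)). tval M s a = tval M s' b) \<longleftrightarrow>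
      (\<forall>i<length xs. cst M (cs ! i) = s' (xs ! i))"
      using assms(3) by (simp add: all_set_conv_all_nth)
    then show ?thesis using assms(3) by (simp add: list_eq_iff_nth_eq)
  qed
  then show ?thesis
    by (subst sat_incl[OF assms(1,2)]) (use assms(4) in \<open>auto simp: set_zip\<close>)
qed

lemma sat_emptyI: "fo_structure M \<Longrightarrow> X = {} \<Longrightarrow> sat M X \<phi>"
  by (simp add: fo_structure_def sat_empty)

lemma sat_depD:
  assumes "fo_structure M" "X \<subseteq> tot M" "sat M X (dep ts)" "s \<in> X" "s' \<in> X"
  shows "map (tval M s) ts = map (tval M s') ts"
  using assms sat_dep by blast

lemma sat_dep_VarD:
  assumes "fo_structure M" "X \<subseteq> tot M" "sat M X (dep (map Var xs))" "s \<in> X" "s' \<in> X"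
  shows "map s xs = map s' xs"
  using sat_depD[OF assms] by simp

theorem soundness:
  assumes "\<Gamma> \<turnstile> \<phi>" "fo_structure M" "X \<subseteq> tot M" "\<forall>\<theta>\<in>\<Gamma>. sat M X \<theta>"
  shows "sat M X \<phi>"
  using assms
proof (induction arbitrary: M X rule: ded.induct)
  case (ded_eq_subst \<Gamma> t t' \<phi> x)
  note M = ded_eq_subst.prems
  have "sat M X (Eq t t')" "sat M X (rep \<phi> [t] [x])" by (rule ded_eq_subst.IH(1)[OF M]) (rule ded_eq_subst.IH(2)[OF M])
  moreover have "(\<lambda>s. upds s [x] (map (tval M s) [t])) ` X = (\<lambda>s. upds s [x] (map (tval M s) [t'])) ` X"
    using calculation(1) by (intro image_cong) auto
  ultimately show ?case
    by (simp add: sat_rep[OF M(1,2) ded_eq_subst.hyps(3)] sat_rep[OF M(1,2) ded_eq_subst.hyps(4)])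
next
  case (ded_orE \<Gamma> \<phi> \<psi> \<chi>)
  note M = ded_orE.prems
  from ded_orE.IH(1)[OF M] consider "sat M X \<phi>" | "sat M X \<psi>" by auto
  then show ?case
  proof cases
    case 1
    then show ?thesis using ded_orE.IH(2)[OF M(1,2)] M(3) by simp
  next
    case 2
    then show ?thesis using ded_orE.IH(3)[OF M(1,2)] M(3) by simp
  qed
next
  case (ded_exI \<Gamma> \<phi> t x)
  note M = ded_exI.prems
  have *: "sat M X (rep \<phi> [t] [x])" "sat M X (dep [t])" by (rule ded_exI.IH(1)[OF M]) (rule ded_exI.IH(2)[OF M])
  have d: "tval M s t = tval M s' t" if "s \<in> X" "s' \<in> X" for s s'
    using sat_depD[OF M(1,2) *(2) that] by simp
  show ?case
  proof (cases "X = {}")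
    case True
    then show ?thesis using sat_emptyI[OF M(1)] by blast
  next
    case False
    then obtain s where s: "s \<in> X" by auto
    then have "tval M s t \<in> carrier M" using tval_in M by blast
    moreover have "sat M (team_upd X x (tval M s t)) \<phi>"
      using sat_rep_const[OF M(1,2) ded_exI.hyps(2) d[OF _ s]] *(1) by simp
    ultimately show ?thesis by auto
  qed
next
  case (ded_exE_var \<Gamma> x \<phi> v \<psi>)
  note M = ded_exE_var.prems
  from ded_exE_var.IH(1)[OF M] obtain a where a: "a \<in> carrier M" "sat M (team_upd X x a) \<phi>" by auto
  define Y where "Y = team_upd X v a"
  have Y: "Y \<subseteq> tot M" using M(2) a by (auto simp: Y_def team_upd_def)
  have eq: "sat M Y \<theta> \<longleftrightarrow> sat M X \<theta>" if "\<theta> \<in> \<Gamma> \<union> {\<psi>}" for \<theta>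
    unfolding Y_def team_upd_def using ded_exE_var.hyps(4) that by (intro sat_image_cong) auto
  have "sat M (team_upd Y x a) \<phi> \<longleftrightarrow> sat M (team_upd X x a) \<phi>"
    unfolding Y_def team_upd_def image_image using ded_exE_var.hyps(4) by (intro sat_cong) auto
  moreover have "tval M s (Var v) = a" if "s \<in> Y" for s using that by (auto simp: Y_def team_upd_def)
  ultimately have "sat M Y (rep \<phi> [Var v] [x])"
    using a sat_rep_const[OF M(1) Y ded_exE_var.hyps(3)] by blast
  moreover have "sat M Y (dep [Var v])"
    unfolding sat_dep[OF M(1) Y] by (auto simp: Y_def team_upd_def)
  ultimately have "sat M Y \<psi>"
    using ded_exE_var.IH(2)[OF M(1) Y] eq M(3) by blast
  then show ?case using eq by blast
next
  case (ded_exE_cst \<Gamma> x \<phi> c \<psi>)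
  note M = ded_exE_cst.prems
  from ded_exE_cst.IH(1)[OF M] obtain a where a: "a \<in> carrier M" "sat M (team_upd X x a) \<phi>" by auto
  define M' where "M' = M\<lparr>cst := (cst M)(c := a)\<rparr>"
  have M': "fo_structure M'" "X \<subseteq> tot M'" using M a by (auto simp: M'_def fo_structure_def)
  have eq: "sat M' Z \<theta> \<longleftrightarrow> sat M Z \<theta>" if "\<theta> \<in> \<Gamma> \<union> {\<phi>, \<psi>}" for \<theta> Z
    using that ded_exE_cst.hyps(3) by (intro sat_symbols_cong) (auto simp: M'_def)
  have "sat M' X (rep \<phi> [Cst c] [x])"
    using a eq sat_rep_const[OF M' rep_ok_sb_Cst, of c a x \<phi>] by (auto simp: M'_def)
  then have "sat M' X \<psi>"
    using ded_exE_cst.IH(2)[OF M'] eq M(3) by blast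
  then show ?case using eq by blast
next
  case (ded_allI_var v \<Gamma> \<phi> x)
  note M = ded_allI_var.prems
  have "sat M (team_upd X x a) \<phi>" if a: "a \<in> carrier M" for a
  proof -
    define Y where "Y = team_upd X v a"
    have Y: "Y \<subseteq> tot M" using M(2) a by (auto simp: Y_def team_upd_def)
    have eq: "sat M Y \<theta> \<longleftrightarrow> sat M X \<theta>" if "\<theta> \<in> \<Gamma>" for \<theta>
      unfolding Y_def team_upd_def using ded_allI_var.hyps(3) that by (intro sat_image_cong) auto
    have e: "sat M (team_upd Y x a) \<phi> \<longleftrightarrow> sat M (team_upd X x a) \<phi>"
      unfolding Y_def team_upd_def image_image using ded_allI_var.hyps(3) by (intro sat_cong) auto
    have "sat M Y (dep [Var v])"
      unfolding sat_dep[OF M(1) Y] by (auto simp: Y_def team_upd_def)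
    then have "sat M Y (rep \<phi> [Var v] [x])"
      using ded_allI_var.IH[OF M(1) Y] eq M(3) by blast
    moreover have "tval M s (Var v) = a" if "s \<in> Y" for s using that by (auto simp: Y_def team_upd_def)
    ultimately show ?thesis
      using e sat_rep_const[OF M(1) Y ded_allI_var.hyps(2)] by blast
  qed
  then show ?case by simp
next
  case (ded_allI_cst \<Gamma> \<phi> c x)
  note M = ded_allI_cst.prems
  have "sat M (team_upd X x a) \<phi>" if a: "a \<in> carrier M" for a
  proof -
    define M' where "M' = M\<lparr>cst := (cst M)(c := a)\<rparr>"
    have M': "fo_structure M'" "X \<subseteq> tot M'" using M a by (auto simp: M'_def fo_structure_def)
    have eq: "sat M' Z \<theta> \<longleftrightarrow> sat M Z \<theta>" if "\<theta> \<in> \<Gamma> \<union> {\<phi>}" for \<theta> Z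
      using that ded_allI_cst.hyps(2) by (intro sat_symbols_cong) (auto simp: M'_def)
    have "sat M' X (rep \<phi> [Cst c] [x])" using ded_allI_cst.IH[OF M'] eq M(3) by blast
    then show ?thesis
      using eq sat_rep_const[OF M' rep_ok_sb_Cst, of c a x \<phi>] by (auto simp: M'_def)
  qed
  then show ?case by simp
next
  case (ded_allE \<Gamma> x \<phi> t)
  note M = ded_allE.prems
  have *: "sat M X (Forall1 x \<phi>)" "sat M X (dep [t])" by (rule ded_allE.IH(1)[OF M]) (rule ded_allE.IH(2)[OF M])
  have d: "tval M s t = tval M s' t" if "s \<in> X" "s' \<in> X" for s s'
    using sat_depD[OF M(1,2) *(2) that] by simp
  show ?case
  proof (cases "X = {}")
    case True
    then show ?thesis using sat_emptyI[OF M(1)] by blast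
  next
    case False
    then obtain s where s: "s \<in> X" by auto
    then have "tval M s t \<in> carrier M" using tval_in M by blast
    then show ?thesis
      using sat_rep_const[OF M(1,2) ded_allE.hyps(3) d[OF _ s]] *(1) by simp
  qed
next
  case (ded_negI \<phi> \<Gamma>)
  have "carrier M \<noteq> {}" using ded_negI.prems by (auto simp: fo_structure_def)
  moreover have "sat M X Bot" if "sat M X \<phi>"
    using ded_negI.IH[OF ded_negI.prems(1,2)] ded_negI.prems(3) that by blast
  ultimately show ?case using sat_Bot[of M X] by auto
next
  case (ded_negE \<Gamma> \<phi> \<psi>)
  have "X = {}" using ded_negE.IH[OF ded_negE.prems] by auto
  then show ?case using sat_emptyI[OF ded_negE.prems(1)] by blast
next
  case (ded_raa \<phi> \<Gamma>)
  have ne: "carrier M \<noteq> {}" using ded_raa.prems by (auto simp: fo_structure_def)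
  show ?case
  proof (rule ccontr)
    assume "\<not> sat M X \<phi>"
    then have "sat M X Bot" using ded_raa.IH[OF ded_raa.prems(1,2)] ded_raa.prems(3) by auto
    then have "X = {}" using sat_Bot[OF ne] by simp
    then show False using \<open>\<not> sat M X \<phi>\<close> sat_emptyI[OF ded_raa.prems(1)] by simp
  qed
next
  case (ded_dep_cst \<Gamma> cs)
  then show ?case by (subst sat_dep) simp_all
next
  case (ded_dep_fn \<Gamma> ts f)
  have "sat M X (dep ts)" by (rule ded_dep_fn.IH(1)[OF ded_dep_fn.prems])
  then have "map (tval M s) ts = map (tval M s') ts" if "s \<in> X" "s' \<in> X" for s s'
    using sat_depD[OF ded_dep_fn.prems(1,2)] that by blast
  then have "tval M s (Fn f ts) = tval M s' (Fn f ts)" if "s \<in> X" "s' \<in> X" for s s'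
    using that unfolding tval.simps by metis
  then show ?case unfolding sat_dep[OF ded_dep_fn.prems(1,2)] list.map list.inject by blast
next
  case (ded_inc_trans \<Gamma> xs ys zs)
  have "sat M X (Inc xs ys)" "sat M X (Inc ys zs)" by (rule ded_inc_trans.IH(1)[OF ded_inc_trans.prems]) (rule ded_inc_trans.IH(2)[OF ded_inc_trans.prems])
  then have "\<forall>s\<in>X. \<exists>s'\<in>X. map s xs = map s' ys" "\<forall>s\<in>X. \<exists>s'\<in>X. map s ys = map s' zs"
    using ded_inc_trans.hyps by (simp_all del: map_eq_conv)
  then have "\<forall>s\<in>X. \<exists>s'\<in>X. map s xs = map s' zs" by metis
  then show ?case using ded_inc_trans.hyps by (simp del: map_eq_conv)
next
  case (ded_inc_proj \<Gamma> xs ys "is")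
  have "sat M X (Inc xs ys)" by (rule ded_inc_proj.IH(1)[OF ded_inc_proj.prems])
  moreover have "map s' (map ((!) ys) is) = map s (map ((!) xs) is)" if "map s' ys = map s xs" for s s'
  proof -
    have "s' (ys ! i) = s (xs ! i)" if "i \<in> set is" for i
      using \<open>map s' ys = map s xs\<close> ded_inc_proj.hyps that by (auto simp: list_eq_iff_nth_eq)
    then show ?thesis by simp
  qed
  moreover from calculation(1) have "\<forall>s\<in>X. \<exists>s'\<in>X. map s xs = map s' ys"
    using ded_inc_proj.hyps by (simp del: map_eq_conv)
  ultimately have "\<forall>s\<in>X. \<exists>s'\<in>X. map s (map ((!) xs) is) = map s' (map ((!) ys) is)" by metis
  then show ?case by (simp del: map_eq_conv map_map)
next
  case (ded_inc_subst \<Gamma> xs ys \<alpha> zs)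
  note M = ded_inc_subst.prems
  have *: "sat M X (Inc xs ys)" "sat M X (rep \<alpha> (map Var ys) zs)" by (rule ded_inc_subst.IH(1)[OF M]) (rule ded_inc_subst.IH(2)[OF M])
  have "sat M ((\<lambda>s. upds s zs (map s ys)) ` X) \<alpha>"
    using *(2) sat_rep[OF M(1,2)] ded_inc_subst.hyps by (simp add: comp_def)
  moreover obtain f where f: "\<And>s. s \<in> X \<Longrightarrow> f s \<in> X \<and> map s xs = map (f s) ys"
  proof -
    have "\<forall>s\<in>X. \<exists>s'\<in>X. map s xs = map s' ys"
      using *(1) ded_inc_subst.hyps by (simp del: map_eq_conv)
    then show ?thesis using that by metis
  qed
  then have "(\<lambda>s. upds (f s) zs (map (f s) ys)) ` X \<subseteq> (\<lambda>s. upds s zs (map s ys)) ` X" by blast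
  ultimately have "sat M ((\<lambda>s. upds (f s) zs (map (f s) ys)) ` X) \<alpha>"
    using sat_downward[OF \<open>neg_free \<alpha>\<close> \<open>incl_free \<alpha>\<close>] by blast
  moreover have "upds (f s) zs (map (f s) ys) x = upds s zs (map s xs) x" if "s \<in> X" "x \<in> fv \<alpha>" for s x
  proof -
    have "x \<in> set zs" using that(2) \<open>fv \<alpha> \<subseteq> set zs\<close> by auto
    then obtain i where "i < length zs" "x = zs ! i" by (auto simp: in_set_conv_nth)
    then show ?thesis using conjunct2[OF f[OF that(1)]] ded_inc_subst.hyps(3-5) by (simp add: upds_nth)
  qed
  ultimately have "sat M ((\<lambda>s. upds s zs (map s xs)) ` X) \<alpha>"
    using sat_cong[of X \<alpha> "\<lambda>s. upds (f s) zs (map (f s) ys)" "\<lambda>s. upds s zs (map s xs)" M] by simp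
  then show ?case using sat_rep[OF M(1,2)] ded_inc_subst.hyps by (simp add: comp_def)
next
  case (ded_inc_dep \<Gamma> xs ys zs)
  note M = ded_inc_dep.prems
  have *: "sat M X (dep (map Var xs))" "sat M X (Inc ys zs)" by (rule ded_inc_dep.IH(1)[OF M]) (rule ded_inc_dep.IH(2)[OF M])
  have "map s xs = map s' xs" if "s \<in> X" "s' \<in> X" for s s'
    by (rule sat_dep_VarD[OF M(1,2) *(1) that])
  moreover have "\<forall>s\<in>X. \<exists>s'\<in>X. map s ys = map s' zs"
    using *(2) ded_inc_dep.hyps by (simp del: map_eq_conv)
  ultimately have "\<forall>s\<in>X. \<exists>s'\<in>X. map s xs @ map s ys = map s' xs @ map s' zs"
    by metis
  then show ?case using ded_inc_dep.hyps by (simp del: map_eq_conv append_eq_append_conv)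
next
  case (ded_inc_ex \<Gamma> xs ys zs ws)
  note M = ded_inc_ex.prems
  have *: "sat M X (dep (map Var xs))" "sat M X (Inc xs ys)" by (rule ded_inc_ex.IH(1)[OF M]) (rule ded_inc_ex.IH(2)[OF M])
  show ?case
  proof (cases "X = {}")
    case True
    then show ?thesis using sat_emptyI[OF M(1)] by blast
  next
    case False
    then obtain s0 where s0: "s0 \<in> X" by auto
    then obtain s' where s': "s' \<in> X" "map s0 xs = map s' ys"
      using *(2) ded_inc_ex.hyps by (auto simp del: map_eq_conv)
    define as where "as = map s' ws"
    have eq: "map (upds s zs as) vs = map s vs" if "set zs \<inter> set vs = {}" for s vs
      using that by (auto intro!: upds_notin)
    have "map s xs = map s' ys" if "s \<in> X" for s
    using sat_dep_VarD[OF M(1,2) *(1) that s0] s'(2) by simp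
    moreover have "map (upds s zs as) zs = map s' ws" for s
      using ded_inc_ex.hyps by (simp add: map_upds as_def)
    moreover have "map (upds s zs as) xs = map s xs" "map (upds s zs as) ys = map s ys"
        "map (upds s zs as) ws = map s ws" for s
      using ded_inc_ex.hyps by (blast intro: eq)+
    ultimately have "sat M ((\<lambda>s. upds s zs as) ` X) (Inc (zs @ xs) (ws @ ys))"
      using ded_inc_ex.hyps s'(1) by (simp del: map_eq_conv add: bexI[of _ s'])
    moreover have "set as \<subseteq> carrier M" "length as = length zs"
      using s'(1) M(2) ded_inc_ex.hyps by (auto simp: as_def)
    ultimately show ?thesis using sat_Exist1s ded_inc_ex.hyps by blast
  qed
next
  case (ded_neg_inc \<Gamma> xs ys cs \<phi>)
  note M = ded_neg_inc.prems
  have *: "sat M X (Neg (Inc xs ys))" by (rule ded_neg_inc.IH(1)[OF M])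
  show ?case
  proof (cases "X = {}")
    case True
    then show ?thesis using sat_emptyI[OF M(1)] by blast
  next
    case False
    then obtain s where s: "s \<in> X" "\<And>s'. s' \<in> X \<Longrightarrow> map s xs \<noteq> map s' ys"
      using * ded_neg_inc.hyps by (auto simp del: map_eq_conv)
    define M' where "M' = M\<lparr>cst := upds (cst M) cs (map s xs)\<rparr>"
    have "set (map s xs) \<subseteq> carrier M" using s(1) M(2) by auto
    then have M': "fo_structure M'" "X \<subseteq> tot M'"
      using M(1,2) upds_cst_in[OF M(1)] by (auto simp: M'_def fo_structure_def)
    have cs: "map (cst M') cs = map s xs" using ded_neg_inc.hyps by (simp add: M'_def map_upds)
    have eq: "sat M' Z \<theta> \<longleftrightarrow> sat M Z \<theta>" if "\<theta> \<in> \<Gamma> \<union> {\<phi>}" for \<theta> Z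
      using that ded_neg_inc.hyps(6) by (intro sat_symbols_cong) (auto simp: M'_def intro!: upds_notin)
    have 1: "sat M' X (incl (zip (map Cst cs) (map Var vs))) \<longleftrightarrow> (\<exists>s'\<in>X. map s xs = map s' vs)"
      if "length vs = length xs" for vs
      using that sat_incl_Cst[OF M', of cs vs] False ded_neg_inc.hyps cs by auto
    have "sat M' X \<phi>"
      using ded_neg_inc.IH(2)[OF M'] eq M(3) 1[of xs] 1[of ys] s ded_neg_inc.hyps by auto
    then show ?thesis using eq by blast
  qed
next
  case (ded_neg_atom \<Gamma> l xs cs \<phi>)
  note M = ded_neg_atom.prems
  have *: "sat M X (Neg l)" by (rule ded_neg_atom.IH(1)[OF M])
  show ?case
  proof (cases "X = {}")
    case True
    then show ?thesis using sat_emptyI[OF M(1)] by blast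
  next
    case False
    then have "\<not> sat M X l" using * by simp
    then obtain s where s: "s \<in> X" "\<not> sat M {s} l"
      using \<open>is_atom l\<close> by (cases l) auto
    define M' where "M' = M\<lparr>cst := upds (cst M) cs (map s xs)\<rparr>"
    have "set (map s xs) \<subseteq> carrier M" using s(1) M(2) by auto
    then have M': "fo_structure M'" "X \<subseteq> tot M'"
      using M(1,2) upds_cst_in[OF M(1)] by (auto simp: M'_def fo_structure_def)
    have cs: "map (cst M') cs = map s xs" using ded_neg_atom.hyps by (simp add: M'_def map_upds)
    have eq: "sat M' Z \<theta> \<longleftrightarrow> sat M Z \<theta>" if "\<theta> \<in> \<Gamma> \<union> {\<phi>, l}" for \<theta> Z
      using that ded_neg_atom.hyps by (intro sat_symbols_cong) (auto simp: M'_def intro!: upds_notin)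
    have "sat M' X (incl (zip (map Cst cs) (map Var xs)))"
      using sat_incl_Cst[OF M', of cs xs] False ded_neg_atom.hyps cs s by auto
    moreover have "\<not> sat M' X (rep l (map Cst cs) xs)"
    proof
      assume "sat M' X (rep l (map Cst cs) xs)"
      then have "sat M' ((\<lambda>s'. upds s' xs (map s xs)) ` X) l"
        using sat_rep[OF M' rep_ok_sb_Csts, of cs xs l] cs by (simp add: comp_def)
      moreover have "upds s' xs (map s xs) x = s x" if "x \<in> fv l" for s' x
        using that \<open>fv l \<subseteq> set xs\<close> by (auto intro: upds_map_same)
      ultimately have "sat M' ((\<lambda>s'. s) ` X) l"
        using sat_cong[of X l "\<lambda>s'. upds s' xs (map s xs)" "\<lambda>s'. s" M'] by blast
      then have "sat M ((\<lambda>s'. s) ` X) l" using eq by blast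
      moreover have "(\<lambda>s'. s) ` X = {s}" using False by auto
      ultimately show False using s by simp
    qed
    ultimately have "sat M' X \<phi>"
      using ded_neg_atom.IH(2)[OF M'] eq M(3) by auto
    then show ?thesis using eq by blast
  qed
next
  case (ded_rel_incl zs r \<phi> \<Gamma> vs)
  note M = ded_rel_incl.prems
  define M' where "M' = M\<lparr>rel_of := \<lambda>r' as. if r' = r \<and> length as = length vs
      then as \<in> (\<lambda>s. map s vs) ` X else rel_of M r' as\<rparr>"
  have M': "fo_structure M'" "X \<subseteq> tot M'" using M by (auto simp: M'_def fo_structure_def)
  have ne: "carrier M \<noteq> {}" using M by (auto simp: fo_structure_def)
  have "X = {}"
  proof (rule ccontr)
    assume "X \<noteq> {}"
    then obtain s where s: "s \<in> X" by auto
    have "sat M' X (Exist1s zs (Rel r (map Var zs)))"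
      unfolding sat_Exist1s[OF \<open>distinct zs\<close>]
    proof (intro exI[of _ "map s vs"] conjI)
      show "length (map s vs) = length zs" "set (map s vs) \<subseteq> carrier M'"
        using ded_rel_incl.hyps M'(2) s by auto
      show "sat M' ((\<lambda>s'. upds s' zs (map s vs)) ` X) (Rel r (map Var zs))"
        using ded_rel_incl.hyps s by (auto simp: comp_def map_upds M'_def)
    qed
    moreover have "sat M' X \<phi>"
      using sat_rel_to_incl[OF M'_def, of \<phi> "\<lambda>s. s"] M(3) ded_rel_incl.hyps by simp
    moreover have "sat M' X \<theta>" if "\<theta> \<in> \<Gamma>" for \<theta>
    proof -
      have "sat M' X \<theta> \<longleftrightarrow> sat M X \<theta>"
        using ded_rel_incl.hyps that by (intro sat_symbols_cong) (auto simp: M'_def)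
      then show ?thesis using M(3) that by blast
    qed
    ultimately have "sat M' X Bot" using ded_rel_incl.IH[OF M'] by blast
    then show False using \<open>X \<noteq> {}\<close> ne by (simp add: sat_Bot M'_def)
  qed
  then show ?case by (rule sat_emptyI[OF M(1)])
qed (auto simp del: map_eq_conv)

section \<open>Substitution and countable languages\<close>

primrec bv :: "('c, 'f, 'r) fm \<Rightarrow> nat set" where
  "bv (Eq s t) = {}"
| "bv (Rel r ts) = {}"
| "bv (Incl ps) = {}"
| "bv (Neg \<phi>) = bv \<phi>"
| "bv (And \<phi> \<psi>) = bv \<phi> \<union> bv \<psi>"
| "bv (Or1 \<phi> \<psi>) = bv \<phi> \<union> bv \<psi>"
| "bv (Exist1 x \<phi>) = insert x (bv \<phi>)"
| "bv (Forall1 x \<phi>) = insert x (bv \<phi>)"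

lemma finite_fv [simp]: "finite (fv \<phi>)"
  by (induction \<phi>) auto

lemma finite_bv [simp]: "finite (bv \<phi>)"
  by (induction \<phi>) auto

lemma finite_tcsts [simp]: "finite (tcsts t)"
  by (induction t) auto

lemma finite_csts [simp]: "finite (csts \<phi>)"
  by (induction \<phi>) auto

lemma incl_Var: "incl (map (\<lambda>(x, y). (Var x, Var y)) ps) = Incl ps"
proof -
  define qs :: "(('a, 'b) tm \<times> ('a, 'b) tm) list" where "qs = map (\<lambda>(x, y). (Var x, Var y)) ps"
  have "incl_consts qs = []"
    by (simp add: incl_consts_def qs_def case_prod_unfold comp_def)
  moreover have "fresh_vars V 0 = []" for V by (simp add: fresh_vars_def Let_def)
  ultimately have "incl qs = Incl ps"
    by (simp add: incl_def Exist1s_def Let_def) (simp add: qs_def comp_def case_prod_unfold)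
  then show ?thesis by (simp only: qs_def)
qed

lemma fsubst_Var_Incl: "fsubst (Var \<circ> \<rho>) (Incl ps) = Incl (map (map_prod \<rho> \<rho>) ps)"
proof -
  have "fsubst (Var \<circ> \<rho>) (Incl ps) = incl (map (\<lambda>(x, y). (Var x, Var y)) (map (map_prod \<rho> \<rho>) ps))"
    unfolding fsubst.simps by (rule arg_cong[where f = incl]) auto
  then show ?thesis by (simp only: incl_Var)
qed

lemma Var_comp_upd: "(Var \<circ> \<rho>)(x := Var y) = Var \<circ> \<rho>(x := y)"
  by auto

lemma tsubst_Var: "tsubst Var t = t"
  by (induction t) (auto intro: map_idI)

lemma tsubst_cong: "(\<And>x. x \<in> tfv t \<Longrightarrow> \<sigma> x = \<tau> x) \<Longrightarrow> tsubst \<sigma> t = tsubst \<tau> t"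
  by (induction t) auto

lemma tsubst_sb_notin: "x \<notin> tfv t \<Longrightarrow> tsubst (sb [u] [x]) t = t"
proof -
  assume "x \<notin> tfv t"
  then have "tsubst (sb [u] [x]) t = tsubst Var t" by (intro tsubst_cong) (auto simp: sb_def)
  then show ?thesis by (simp add: tsubst_Var)
qed

lemma fsubst_Var: "fsubst Var \<phi> = \<phi>"
proof (induction \<phi>)
  case (Incl ps)
  show ?case by (simp add: incl_Var)
qed (auto simp: tsubst_Var intro: map_idI)

lemma fsubst_cong: "(\<And>x. x \<in> fv \<phi> \<Longrightarrow> \<sigma> x = \<tau> x) \<Longrightarrow> fsubst \<sigma> \<phi> = fsubst \<tau> \<phi>"
proof (induction \<phi> arbitrary: \<sigma> \<tau>)
  case (Eq s t)
  then show ?case by (auto intro: tsubst_cong)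
next
  case (Rel r ts)
  then show ?case by (auto intro: tsubst_cong)
next
  case (Incl ps)
  then have "map (\<lambda>(x, y). (\<sigma> x, \<sigma> y)) ps = map (\<lambda>(x, y). (\<tau> x, \<tau> y)) ps" by force
  then show ?case by (simp only: fsubst.simps)
next
  case (Neg \<phi>)
  then show ?case by (metis fsubst.simps(4) fv.simps(4))
next
  case (And \<phi> \<psi>)
  have "fsubst \<sigma> \<phi> = fsubst \<tau> \<phi>" by (rule And(1)) (use And(3) in simp)
  moreover have "fsubst \<sigma> \<psi> = fsubst \<tau> \<psi>" by (rule And(2)) (use And(3) in simp)
  ultimately show ?case by simp
next
  case (Or1 \<phi> \<psi>)
  have "fsubst \<sigma> \<phi> = fsubst \<tau> \<phi>" by (rule Or1(1)) (use Or1(3) in simp)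
  moreover have "fsubst \<sigma> \<psi> = fsubst \<tau> \<psi>" by (rule Or1(2)) (use Or1(3) in simp)
  ultimately show ?case by simp
next
  case (Exist1 x \<phi>)
  have "fsubst (\<sigma>(x := Var x)) \<phi> = fsubst (\<tau>(x := Var x)) \<phi>" by (rule Exist1(1)) (use Exist1(2) in simp)
  then show ?case by simp
next
  case (Forall1 x \<phi>)
  have "fsubst (\<sigma>(x := Var x)) \<phi> = fsubst (\<tau>(x := Var x)) \<phi>" by (rule Forall1(1)) (use Forall1(2) in simp)
  then show ?case by simp
qed

lemma tsubst_tsubst: "tsubst \<tau> (tsubst \<sigma> t) = tsubst (\<lambda>x. tsubst \<tau> (\<sigma> x)) t"
  by (induction t) auto

text \<open>Bound variables lie below \<open>N\<close> and \<open>\<rho>\<close> sends a variable to itself or beyond \<open>N\<close>, so nothing is captured.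
  Replacing variables by witnesses is a renaming of this kind.\<close>

lemma fsubst_comp:
  assumes "bv \<psi> \<subseteq> {..<N}" "\<And>y. \<rho> y = y \<or> N \<le> \<rho> y"
  shows "fsubst (Var \<circ> \<tau>) (fsubst (Var \<circ> \<rho>) \<psi>) = fsubst (Var \<circ> (\<tau> \<circ> \<rho>)) \<psi>"
  using assms
proof (induction \<psi> arbitrary: \<rho> \<tau>)
  case (Eq s t)
  show ?case by (simp add: tsubst_tsubst comp_def)
next
  case (Rel r ts)
  show ?case by (simp add: tsubst_tsubst comp_def)
next
  case (Incl ps)
  show ?case unfolding fsubst_Var_Incl by auto
next
  case (Exist1 x \<phi>)
  have "\<tau>(x := x) \<circ> \<rho>(x := x) = (\<tau> \<circ> \<rho>)(x := x)"
  proof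
    fix y
    show "(\<tau>(x := x) \<circ> \<rho>(x := x)) y = ((\<tau> \<circ> \<rho>)(x := x)) y"
      using Exist1(2) Exist1(3)[of y] by auto
  qed
  moreover have "fsubst (Var \<circ> \<tau>(x := x)) (fsubst (Var \<circ> \<rho>(x := x)) \<phi>) =
      fsubst (Var \<circ> (\<tau>(x := x) \<circ> \<rho>(x := x))) \<phi>"
    by (rule Exist1(1)) (use Exist1(2,3) in auto)
  ultimately show ?case by (simp only: fsubst.simps Var_comp_upd)
next
  case (Forall1 x \<phi>)
  have "\<tau>(x := x) \<circ> \<rho>(x := x) = (\<tau> \<circ> \<rho>)(x := x)"
  proof
    fix y
    show "(\<tau>(x := x) \<circ> \<rho>(x := x)) y = ((\<tau> \<circ> \<rho>)(x := x)) y"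
      using Forall1(2) Forall1(3)[of y] by auto
  qed
  moreover have "fsubst (Var \<circ> \<tau>(x := x)) (fsubst (Var \<circ> \<rho>(x := x)) \<phi>) =
      fsubst (Var \<circ> (\<tau>(x := x) \<circ> \<rho>(x := x))) \<phi>"
    by (rule Forall1(1)) (use Forall1(2,3) in auto)
  ultimately show ?case by (simp only: fsubst.simps Var_comp_upd)
qed auto

text \<open>Without quantifiers nothing can be captured, but an inclusion atom into which a constant has been
  substituted acquires a quantifier; therefore the inner substitution is a renaming there.\<close>

lemma fsubst_comp_qf:
  assumes "bv \<psi> = {}" "is_atom \<psi> \<or> (\<exists>\<rho>. \<sigma> = Var \<circ> \<rho>)"
  shows "fsubst \<tau> (fsubst \<sigma> \<psi>) = fsubst (\<lambda>x. tsubst \<tau> (\<sigma> x)) \<psi>"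
proof -
  show ?thesis
    using assms
  proof (induction \<psi>)
    case (Incl ps)
    then obtain \<rho> where \<rho>: "\<sigma> = Var \<circ> \<rho>" unfolding is_atom.simps by blast
    have "map (\<lambda>(x, y). (\<tau> x, \<tau> y)) (map (map_prod \<rho> \<rho>) ps) = map (\<lambda>(x, y). (tsubst \<tau> (\<sigma> x), tsubst \<tau> (\<sigma> y))) ps"
      by (auto simp: \<rho>)
    then show ?case unfolding \<rho> fsubst_Var_Incl by (simp only: fsubst.simps)
  qed (auto simp: tsubst_tsubst)
qed

lemma substitutableI:
  "(\<And>y. \<sigma> y = Var y \<or> (\<exists>w. \<sigma> y = Var w \<and> w \<notin> bv \<phi>)) \<Longrightarrow> substitutable \<sigma> \<phi>"
proof (induction \<phi> arbitrary: \<sigma>)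
  case (Incl ps)
  have "\<sigma> x \<noteq> Fn f ts" for x f ts using Incl[of x] by auto
  then show ?case by simp
next
  case (Neg \<phi>)
  have "substitutable \<sigma> \<phi>" by (rule Neg(1)) (use Neg(2) in simp)
  then show ?case by simp
next
  case (And \<phi> \<psi>)
  have "substitutable \<sigma> \<phi>" by (rule And(1)) (use And(3) in fastforce)
  moreover have "substitutable \<sigma> \<psi>" by (rule And(2)) (use And(3) in fastforce)
  ultimately show ?case by simp
next
  case (Or1 \<phi> \<psi>)
  have "substitutable \<sigma> \<phi>" by (rule Or1(1)) (use Or1(3) in fastforce)
  moreover have "substitutable \<sigma> \<psi>" by (rule Or1(2)) (use Or1(3) in fastforce)
  ultimately show ?case by simp
next
  case (Exist1 x \<phi>)
  have "substitutable (\<sigma>(x := Var x)) \<phi>" by (rule Exist1(1)) (use Exist1(2) in fastforce)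
  moreover have "x \<notin> tfv (\<sigma> y)" if "y \<noteq> x" for y using Exist1(2)[of y] that by auto
  ultimately show ?case by auto
next
  case (Forall1 x \<phi>)
  have "substitutable (\<sigma>(x := Var x)) \<phi>" by (rule Forall1(1)) (use Forall1(2) in fastforce)
  moreover have "x \<notin> tfv (\<sigma> y)" if "y \<noteq> x" for y using Forall1(2)[of y] that by auto
  ultimately show ?case by auto
qed auto

lemma substitutable_atom: "is_atom \<phi> \<Longrightarrow> substitutable \<sigma> \<phi>"
  by (cases \<phi>) auto

lemma bv_atom: "is_atom \<phi> \<Longrightarrow> bv \<phi> = {}"
  by (cases \<phi>) auto

lemma is_atom_fsubst: "is_atom \<phi> \<Longrightarrow> is_atom (fsubst \<sigma> \<phi>)"
  by (cases \<phi>) auto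

lemma sb_Var1: "sb [Var w] [x] = Var \<circ> id(x := w)"
  by (auto simp: sb_def)

lemma rep_ok_Var: "w \<notin> bv \<phi> \<Longrightarrow> rep_ok \<phi> [Var w] [x]"
  by (rule substitutableI) (auto simp: sb_Var1)

text \<open>The terms and formulas over a vocabulary of constant, function and relation symbols. Only a
  countable language has enough fresh variables for all its witnesses.\<close>

definition tlang :: "'c set \<Rightarrow> 'f set \<Rightarrow> ('c, 'f) tm set" where
  "tlang A B = {t. tcsts t \<subseteq> A \<and> set2_tm t \<subseteq> B}"

definition lang :: "'c set \<Rightarrow> 'f set \<Rightarrow> 'r set \<Rightarrow> ('c, 'f, 'r) fm set" where
  "lang A B C = {\<phi>. csts \<phi> \<subseteq> A \<and> set2_fm \<phi> \<subseteq> B \<and> set3_fm \<phi> \<subseteq> C}"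

lemma tlang_simps [simp]:
  "Var x \<in> tlang A B"
  "Cst c \<in> tlang A B \<longleftrightarrow> c \<in> A"
  "Fn f ts \<in> tlang A B \<longleftrightarrow> f \<in> B \<and> set ts \<subseteq> tlang A B"
  by (auto simp: tlang_def)

lemma lang_simps [simp]:
  "Eq s t \<in> lang A B C \<longleftrightarrow> s \<in> tlang A B \<and> t \<in> tlang A B"
  "Rel r ts \<in> lang A B C \<longleftrightarrow> r \<in> C \<and> set ts \<subseteq> tlang A B"
  "Incl ps \<in> lang A B C"
  "Neg \<phi> \<in> lang A B C \<longleftrightarrow> \<phi> \<in> lang A B C"
  "And \<phi> \<psi> \<in> lang A B C \<longleftrightarrow> \<phi> \<in> lang A B C \<and> \<psi> \<in> lang A B C"
  "Or1 \<phi> \<psi> \<in> lang A B C \<longleftrightarrow> \<phi> \<in> lang A B C \<and> \<psi> \<in> lang A B C"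
  "Exist1 x \<phi> \<in> lang A B C \<longleftrightarrow> \<phi> \<in> lang A B C"
  "Forall1 x \<phi> \<in> lang A B C \<longleftrightarrow> \<phi> \<in> lang A B C"
  by (auto simp: lang_def tlang_def)

lemma lang_Bot [simp]: "Bot \<in> lang A B C"
  by (simp add: Bot_def)

lemma lang_Exist1s [simp]: "Exist1s us \<phi> \<in> lang A B C \<longleftrightarrow> \<phi> \<in> lang A B C"
  by (induction us) (auto simp: Exist1s_def)

lemma lang_conjs [simp]: "conjs \<Phi> \<in> lang A B C \<longleftrightarrow> set \<Phi> \<subseteq> lang A B C"
  by (induction \<Phi> rule: conjs.induct) auto

lemma lang_dep: "set ts \<subseteq> tlang A B \<Longrightarrow> dep ts \<in> lang A B C"
  by (auto simp: dep_def Let_def dest: set_zip_rightD)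

lemma lang_incl: "(\<And>a b. (a, b) \<in> set ps \<Longrightarrow> a \<in> tlang A B \<and> b \<in> tlang A B) \<Longrightarrow> incl ps \<in> lang A B C"
proof -
  assume a: "\<And>a b. (a, b) \<in> set ps \<Longrightarrow> a \<in> tlang A B \<and> b \<in> tlang A B"
  have "set (incl_consts ps) \<subseteq> A"
    unfolding set_incl_consts using a by fastforce
  then show ?thesis by (auto simp: incl_def Let_def dest!: set_zip_rightD)
qed

lemma tlang_tsubst: "t \<in> tlang A B \<Longrightarrow> (\<And>x. \<sigma> x \<in> tlang A B) \<Longrightarrow> tsubst \<sigma> t \<in> tlang A B"
  by (induction t) (auto simp: subset_iff)

lemma lang_fsubst: "\<phi> \<in> lang A B C \<Longrightarrow> (\<And>x. \<sigma> x \<in> tlang A B) \<Longrightarrow> fsubst \<sigma> \<phi> \<in> lang A B C"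
proof (induction \<phi> arbitrary: \<sigma>)
  case (Incl ps)
  then show ?case by (auto intro!: lang_incl)
qed (auto simp: tlang_tsubst)

lemma sb_tlang: "set ts \<subseteq> tlang A B \<Longrightarrow> sb ts xs x \<in> tlang A B"
  by (auto simp: sb_def split: option.split dest!: map_of_SomeD set_zip_rightD)

lemma lang_rep_Var: "\<phi> \<in> lang A B C \<Longrightarrow> fsubst (Var \<circ> \<rho>) \<phi> \<in> lang A B C"
  by (auto intro: lang_fsubst)

instance tm :: (countable, countable) countable
  by countable_datatype

instance fm :: (countable, countable, countable) countable
  by countable_datatype

text \<open>Formulas over a countable vocabulary are renamed formulas over the vocabulary of the natural numbers.\<close>

lemma countable_lang:
  assumes "countable A" "countable B" "countable C"
  shows "countable (lang A B C)"
proof -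
  have "lang A B C \<subseteq> range (map_fm (from_nat_into A) (from_nat_into B) (from_nat_into C))"
  proof
    fix \<phi> assume \<phi>: "\<phi> \<in> lang A B C"
    have "map_fm (from_nat_into A \<circ> to_nat_on A) (from_nat_into B \<circ> to_nat_on B)
        (from_nat_into C \<circ> to_nat_on C) \<phi> = map_fm id id id \<phi>"
      using \<phi> assms by (intro fm.map_cong refl) (auto simp: lang_def subset_iff)
    then have "map_fm (from_nat_into A) (from_nat_into B) (from_nat_into C)
        (map_fm (to_nat_on A) (to_nat_on B) (to_nat_on C) \<phi>) = \<phi>"
      by (simp add: fm.map_comp fm.map_id)
    then show "\<phi> \<in> range (map_fm (from_nat_into A) (from_nat_into B) (from_nat_into C))"
      by (metis rangeI)
  qed
  then show ?thesis by (rule countable_subset) simp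
qed

section \<open>Derivability in all finite extensions\<close>

text \<open>The side conditions of the rules restrict the context: eigenvariables and fresh constants must not
  occur in it, and one rule asks for sentences. Weakening a derivation is therefore not immediate.
  Derivability from every finite extension of some finite part of \<open>\<Gamma>\<close> is monotone by definition, makes
  sense for infinite \<open>\<Gamma>\<close>, and inherits the rules, since fresh symbols can be chosen anew for each
  extension.\<close>

definition der :: "('c, 'f, 'r) fm set \<Rightarrow> ('c, 'f, 'r) fm \<Rightarrow> bool" (infix \<open>\<tturnstile>\<close> 50) where
  "\<Gamma> \<tturnstile> \<phi> \<longleftrightarrow> (\<exists>T\<subseteq>\<Gamma>. finite T \<and> (\<forall>\<Delta>. finite \<Delta> \<and> T \<subseteq> \<Delta> \<longrightarrow> \<Delta> \<turnstile> \<phi>))"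

lemma der_mono: "\<Gamma> \<tturnstile> \<phi> \<Longrightarrow> \<Gamma> \<subseteq> \<Gamma>' \<Longrightarrow> \<Gamma>' \<tturnstile> \<phi>"
  unfolding der_def by (meson order_trans)

lemma der_finite: "\<Gamma> \<tturnstile> \<phi> \<Longrightarrow> finite \<Delta> \<Longrightarrow> \<Gamma> \<subseteq> \<Delta> \<Longrightarrow> \<Delta> \<turnstile> \<phi>"
  unfolding der_def by (meson order_trans)

lemma der_asm: "\<phi> \<in> \<Gamma> \<Longrightarrow> \<Gamma> \<tturnstile> \<phi>"
  unfolding der_def by (rule exI[of _ "{\<phi>}"]) (auto intro: ded_asm)

lemma der_lift0: "(\<And>\<Delta>. \<Delta> \<turnstile> \<phi>) \<Longrightarrow> \<Gamma> \<tturnstile> \<phi>"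
  unfolding der_def by (rule exI[of _ "{}"]) simp

lemma der_lift1: "(\<And>\<Delta>. \<Delta> \<turnstile> \<phi> \<Longrightarrow> \<Delta> \<turnstile> \<psi>) \<Longrightarrow> \<Gamma> \<tturnstile> \<phi> \<Longrightarrow> \<Gamma> \<tturnstile> \<psi>"
  unfolding der_def by meson

lemma der_lift2:
  assumes "\<And>\<Delta>. \<Delta> \<turnstile> \<phi> \<Longrightarrow> \<Delta> \<turnstile> \<psi> \<Longrightarrow> \<Delta> \<turnstile> \<chi>" "\<Gamma> \<tturnstile> \<phi>" "\<Gamma> \<tturnstile> \<psi>"
  shows "\<Gamma> \<tturnstile> \<chi>"
proof -
  obtain T where T: "T \<subseteq> \<Gamma>" "finite T" "\<And>\<Delta>. finite \<Delta> \<Longrightarrow> T \<subseteq> \<Delta> \<Longrightarrow> \<Delta> \<turnstile> \<phi>"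
    using assms(2) unfolding der_def by blast
  obtain T' where T': "T' \<subseteq> \<Gamma>" "finite T'" "\<And>\<Delta>. finite \<Delta> \<Longrightarrow> T' \<subseteq> \<Delta> \<Longrightarrow> \<Delta> \<turnstile> \<psi>"
    using assms(3) unfolding der_def by blast
  show ?thesis unfolding der_def
    using T T' assms(1) by (intro exI[of _ "T \<union> T'"]) auto
qed

lemma der_discharge:
  assumes "\<And>\<Delta>. finite \<Delta> \<Longrightarrow> insert \<phi> \<Delta> \<turnstile> \<psi> \<Longrightarrow> \<Delta> \<turnstile> \<chi>" "insert \<phi> \<Gamma> \<tturnstile> \<psi>"
  shows "\<Gamma> \<tturnstile> \<chi>"
proof -
  obtain T where T: "T \<subseteq> insert \<phi> \<Gamma>" "finite T" "\<And>\<Delta>. finite \<Delta> \<Longrightarrow> T \<subseteq> \<Delta> \<Longrightarrow> \<Delta> \<turnstile> \<psi>"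
    using assms(2) unfolding der_def by blast
  have "\<Delta> \<turnstile> \<chi>" if "finite \<Delta>" "T - {\<phi>} \<subseteq> \<Delta>" for \<Delta>
    using that by (intro assms(1) T(3)) auto
  then show ?thesis unfolding der_def using T(1,2) by (intro exI[of _ "T - {\<phi>}"]) auto
qed

lemma der_negI: "insert \<phi> \<Gamma> \<tturnstile> Bot \<Longrightarrow> \<Gamma> \<tturnstile> Neg \<phi>"
  by (rule der_discharge[OF ded_negI])

lemma der_raa: "insert (Neg \<phi>) \<Gamma> \<tturnstile> Bot \<Longrightarrow> \<Gamma> \<tturnstile> \<phi>"
  by (rule der_discharge[OF ded_raa])

lemma der_negE: "\<Gamma> \<tturnstile> \<phi> \<Longrightarrow> \<Gamma> \<tturnstile> Neg \<phi> \<Longrightarrow> \<Gamma> \<tturnstile> \<psi>"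
  by (rule der_lift2[OF ded_negE])

lemma der_eq_refl: "\<Gamma> \<tturnstile> Eq t t"
  by (rule der_lift0[OF ded_eq_refl])

lemma der_eq_subst:
  "\<Gamma> \<tturnstile> Eq t t' \<Longrightarrow> \<Gamma> \<tturnstile> rep \<phi> [t] [x] \<Longrightarrow> rep_ok \<phi> [t] [x] \<Longrightarrow> rep_ok \<phi> [t'] [x] \<Longrightarrow> \<Gamma> \<tturnstile> rep \<phi> [t'] [x]"
  by (rule der_lift2[OF ded_eq_subst])

section \<open>Equality and inclusion\<close>

lemma der_eq_sym: "\<Gamma> \<tturnstile> Eq s t \<Longrightarrow> \<Gamma> \<tturnstile> Eq t s"
proof -
  assume st: "\<Gamma> \<tturnstile> Eq s t"
  obtain x where "x \<notin> tfv s" using ex_new_if_finite[OF infinite_UNIV_nat finite_tfv] by metis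
  then have s: "tsubst (sb [u] [x]) s = s" for u by (rule tsubst_sb_notin)
  have "\<Gamma> \<tturnstile> rep (Eq (Var x) s) [t] [x]"
    by (rule der_eq_subst[OF st]) (simp_all add: s, simp add: sb_def der_eq_refl)
  then show ?thesis by (simp add: s) (simp add: sb_def)
qed

text \<open>The replacement rule changes one term at a time. The variables of \<open>\<alpha>\<close> are switched from \<open>\<sigma>\<close> to \<open>\<tau>\<close> one
  after the other, each time through a fresh variable that marks the place. In inclusion atoms only
  variables are exchanged, since a constant would turn them into quantified formulas.\<close>

lemma der_cong:
  assumes \<alpha>: "is_atom \<alpha> \<or> ((\<exists>ps. \<alpha> = Incl ps) \<and> (\<exists>\<rho>. \<sigma> = Var \<circ> \<rho>) \<and> (\<exists>\<rho>. \<tau> = Var \<circ> \<rho>))"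
    and eq: "\<And>x. x \<in> fv \<alpha> \<Longrightarrow> \<Gamma> \<tturnstile> Eq (\<sigma> x) (\<tau> x)"
    and "\<Gamma> \<tturnstile> fsubst \<sigma> \<alpha>"
  shows "\<Gamma> \<tturnstile> fsubst \<tau> \<alpha>"
proof -
  \<comment> \<open>Inside \<open>X\<close> the replacement has already taken place.\<close>
  define mix where "mix X = (\<lambda>x. if x \<in> X then \<tau> x else \<sigma> x)" for X
  have "\<Gamma> \<tturnstile> fsubst (mix X) \<alpha>" if "finite X" "X \<subseteq> fv \<alpha>" for X
    using that
  proof (induction X)
    case empty
    then show ?case using assms(3) by (simp add: mix_def)
  next
    case (insert x X)
    have "finite (\<Union>z\<in>fv \<alpha>. tfv (\<sigma> z) \<union> tfv (\<tau> z))" by auto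
    then obtain y where y: "y \<notin> (\<Union>z\<in>fv \<alpha>. tfv (\<sigma> z) \<union> tfv (\<tau> z))"
      using ex_new_if_finite[OF infinite_UNIV_nat] by metis
    define \<beta> where "\<beta> = fsubst ((mix X)(x := Var y)) \<alpha>"
    have rep: "rep \<beta> [u] [y] = fsubst ((mix X)(x := u)) \<alpha>" for u
    proof -
      have "\<exists>\<rho>. (mix X)(x := Var y) = Var \<circ> \<rho>" if "\<sigma> = Var \<circ> \<rho>1" "\<tau> = Var \<circ> \<rho>2" for \<rho>1 \<rho>2
        by (rule exI[of _ "\<lambda>z. if z = x then y else if z \<in> X then \<rho>2 z else \<rho>1 z"]) (auto simp: mix_def that)
      then have "rep \<beta> [u] [y] = fsubst (\<lambda>z. tsubst (sb [u] [y]) (((mix X)(x := Var y)) z)) \<alpha>"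
        unfolding \<beta>_def using \<alpha> by (intro fsubst_comp_qf) (auto simp: bv_atom)
      also have "\<dots> = fsubst ((mix X)(x := u)) \<alpha>"
      proof (rule fsubst_cong)
        fix z assume z: "z \<in> fv \<alpha>"
        show "tsubst (sb [u] [y]) (((mix X)(x := Var y)) z) = ((mix X)(x := u)) z"
          using y z by (auto simp: mix_def tsubst_sb_notin) (simp add: sb_def)
      qed
      finally show ?thesis .
    qed
    have ok: "rep_ok \<beta> [\<sigma> x] [y]" "rep_ok \<beta> [\<tau> x] [y]"
    proof -
      have "substitutable (sb [u] [y]) \<beta>" if "u = \<sigma> x \<or> u = \<tau> x" for u
      proof (cases "is_atom \<alpha>")
        case True
        then show ?thesis unfolding \<beta>_def by (intro substitutable_atom is_atom_fsubst)
      next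
        case False
        then obtain ps \<rho>1 \<rho>2 where *: "\<alpha> = Incl ps" "\<sigma> = Var \<circ> \<rho>1" "\<tau> = Var \<circ> \<rho>2" using \<alpha> by auto
        have "(mix X)(x := Var y) = Var \<circ> (\<lambda>z. if z = x then y else if z \<in> X then \<rho>2 z else \<rho>1 z)"
          by (auto simp: mix_def *)
        then have "bv \<beta> = {}" unfolding \<beta>_def *(1) by (simp only: fsubst_Var_Incl bv.simps)
        then show ?thesis using that * by (intro substitutableI) (auto simp: sb_def)
      qed
      then show "rep_ok \<beta> [\<sigma> x] [y]" "rep_ok \<beta> [\<tau> x] [y]" by simp_all
    qed
    have "(mix X)(x := \<sigma> x) = mix X" "(mix X)(x := \<tau> x) = mix (insert x X)"
      using insert by (auto simp: mix_def)
    then show ?case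
      using der_eq_subst[OF eq _ ok] insert by (simp add: rep)
  qed
  from this[of "fv \<alpha>"] have "\<Gamma> \<tturnstile> fsubst (mix (fv \<alpha>)) \<alpha>" by simp
  moreover have "fsubst (mix (fv \<alpha>)) \<alpha> = fsubst \<tau> \<alpha>" by (rule fsubst_cong) (simp add: mix_def)
  ultimately show ?thesis by simp
qed

lemma der_eq_trans: "\<Gamma> \<tturnstile> Eq s t \<Longrightarrow> \<Gamma> \<tturnstile> Eq t u \<Longrightarrow> \<Gamma> \<tturnstile> Eq s u"
proof -
  assume *: "\<Gamma> \<tturnstile> Eq s t" "\<Gamma> \<tturnstile> Eq t u"
  have "\<Gamma> \<tturnstile> fsubst (\<lambda>x. if x = 0 then s else u) (Eq (Var 0) (Var 1))"
    by (rule der_cong[where \<sigma> = "\<lambda>x. if x = 0 then s else t"]) (use * in \<open>auto simp: der_eq_refl\<close>)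
  then show ?thesis by simp
qed

lemma der_Rel_cong:
  assumes "length ts = length ts'" "\<And>i. i < length ts \<Longrightarrow> \<Gamma> \<tturnstile> Eq (ts ! i) (ts' ! i)" "\<Gamma> \<tturnstile> Rel r ts"
  shows "\<Gamma> \<tturnstile> Rel r ts'"
proof -
  have e: "map (tsubst ((!) us) \<circ> Var) [0..<length us] = us" for us :: "('a, 'b) tm list"
    by (simp add: comp_def map_nth)
  have "\<Gamma> \<tturnstile> fsubst ((!) ts') (Rel r (map Var [0..<length ts]))"
    by (rule der_cong[where \<sigma> = "(!) ts"]) (use assms e[of ts] in auto)
  then show ?thesis using e[of ts'] assms(1) by simp
qed

lemma der_Fn_cong:
  assumes "length ts = length ts'" "\<And>i. i < length ts \<Longrightarrow> \<Gamma> \<tturnstile> Eq (ts ! i) (ts' ! i)"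
  shows "\<Gamma> \<tturnstile> Eq (Fn f ts) (Fn f ts')"
proof -
  define n where "n = length ts"
  define \<sigma> where "\<sigma> us = (\<lambda>i. if i < n then us ! i else Fn f ts)" for us
  have e: "map (tsubst (\<sigma> us) \<circ> Var) [0..<n] = us" if "length us = n" for us
    using that by (auto intro!: nth_equalityI simp: \<sigma>_def)
  have "\<Gamma> \<tturnstile> fsubst (\<sigma> ts') (Eq (Var n) (Fn f (map Var [0..<n])))"
    by (rule der_cong[where \<sigma> = "\<sigma> ts"])
      (use assms e[of ts] n_def in \<open>auto simp: der_eq_refl, auto simp: \<sigma>_def der_eq_refl\<close>)
  then show ?thesis using e[of ts'] assms(1) n_def by (simp add: \<sigma>_def)
qed

lemma der_Inc_cong:
  assumes "length xs = length ys" "length xs' = length xs"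
    "\<And>i. i < length xs \<Longrightarrow> \<Gamma> \<tturnstile> Eq (Var (xs ! i)) (Var (xs' ! i))" "\<Gamma> \<tturnstile> Inc xs ys"
  shows "\<Gamma> \<tturnstile> Inc xs' ys"
proof -
  define n where "n = length xs"
  define \<sigma> where "\<sigma> us = (\<lambda>i. if i < n then us ! i else ys ! (i - n))" for us
  define \<alpha> :: "('a, 'b, 'c) fm" where "\<alpha> = Incl (map (\<lambda>i. (i, n + i)) [0..<n])"
  have e: "fsubst (Var \<circ> \<sigma> us) \<alpha> = Inc us ys" if "length us = n" for us
    unfolding \<alpha>_def fsubst_Var_Incl using that assms(1)
    by (auto intro!: nth_equalityI simp: \<sigma>_def n_def)
  have "\<Gamma> \<tturnstile> fsubst (Var \<circ> \<sigma> xs') \<alpha>"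
  proof (rule der_cong[where \<sigma> = "Var \<circ> \<sigma> xs"])
    show "\<Gamma> \<tturnstile> fsubst (Var \<circ> \<sigma> xs) \<alpha>" using e[of xs] assms(4) n_def by simp
    show "\<Gamma> \<tturnstile> Eq ((Var \<circ> \<sigma> xs) x) ((Var \<circ> \<sigma> xs') x)" for x
      using assms(3) by (auto simp: \<sigma>_def n_def der_eq_refl)
  qed (auto simp: \<alpha>_def)
  then show ?thesis using e[of xs'] assms(2) n_def by simp
qed

lemma Incl_eq_Inc: "Incl ps = Inc (map fst ps) (map snd ps)"
  by (simp add: zip_map_fst_snd)

text \<open>Projection, permutation and repetition of an inclusion atom in one rule: only the set of pairs counts.\<close>

lemma der_incl_mono:
  assumes "\<Gamma> \<tturnstile> Incl ps" "set qs \<subseteq> set ps"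
  shows "\<Gamma> \<tturnstile> Incl qs"
proof -
  have "\<exists>i<length ps. ps ! i = q" if "q \<in> set qs" for q
    using that assms(2) by (metis in_set_conv_nth subsetD)
  then obtain f where f: "\<And>q. q \<in> set qs \<Longrightarrow> f q < length ps \<and> ps ! f q = q" by metis
  have "\<Gamma> \<tturnstile> Inc (map (\<lambda>i. map fst ps ! i) (map f qs)) (map (\<lambda>i. map snd ps ! i) (map f qs))"
    by (rule der_lift1[OF ded_inc_proj assms(1)[unfolded Incl_eq_Inc[of ps]]]) (use f in auto)
  moreover have "map (\<lambda>i. map fst ps ! i) (map f qs) = map fst qs"
    "map (\<lambda>i. map snd ps ! i) (map f qs) = map snd qs" using f by auto
  ultimately show ?thesis by (simp only: Incl_eq_Inc[of qs])
qed

text \<open>The pair \<open>c c\<close> satisfies \<open>x = y\<close>, hence so does each pair included in it.\<close>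

lemma der_pair_eq:
  assumes "\<Gamma> \<tturnstile> Incl [(a, c), (b, c)]"
  shows "\<Gamma> \<tturnstile> Eq (Var a) (Var b)"
proof -
  let ?\<alpha> = "Eq (Var 0) (Var 1)"
  have e: "rep ?\<alpha> (map Var [a, b]) [0, 1] = Eq (Var a) (Var b)" for a b by (simp add: sb_def)
  have "\<Gamma> \<tturnstile> rep ?\<alpha> (map Var [a, b]) [0, 1]"
  proof (rule der_lift2)
    show "\<Gamma> \<tturnstile> Inc [a, b] [c, c]" using assms by simp
    show "\<Gamma> \<tturnstile> rep ?\<alpha> (map Var [c, c]) [0, 1]" unfolding e by (rule der_eq_refl)
    show "\<Delta> \<turnstile> rep ?\<alpha> (map Var [a, b]) [0, 1]"
      if "\<Delta> \<turnstile> Inc [a, b] [c, c]" "\<Delta> \<turnstile> rep ?\<alpha> (map Var [c, c]) [0, 1]" for \<Delta>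
      by (rule ded_inc_subst[OF that]) auto
  qed
  then show ?thesis unfolding e .
qed

section \<open>Witnesses\<close>

abbreviation con :: "('c, 'f, 'r) fm set \<Rightarrow> bool" where
  "con S \<equiv> \<not> S \<tturnstile> Bot"

lemma fresh_consts:
  assumes "infinite (P :: 'c set)" "finite F"
  obtains cs where "distinct cs" "length cs = n" "set cs \<subseteq> P" "set cs \<inter> F = {}"
proof -
  have "infinite (P - F)" using assms by simp
  then obtain Q where Q: "Q \<subseteq> P - F" "finite Q" "card Q = n" by (metis infinite_arbitrarily_large)
  obtain cs where "set cs = Q" "distinct cs" using Q(2) finite_distinct_list by blast
  moreover then have "length cs = n" using Q(3) distinct_card by metis
  ultimately show thesis using Q(1) that[of cs] by blast
qed

lemma fresh_var:
  assumes "finite (F :: nat set)"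
  obtains w where "w \<ge> N" "w \<notin> F"
proof -
  obtain w where "w \<notin> F \<union> {..<N}" using ex_new_if_finite[OF infinite_UNIV_nat, of "F \<union> {..<N}"] assms by auto
  then show thesis using that[of w] by auto
qed

lemma inconsistentI:
  assumes "finite S" "\<And>\<Delta>. finite \<Delta> \<Longrightarrow> S \<subseteq> \<Delta> \<Longrightarrow> \<Delta> \<turnstile> Bot"
  shows "S \<tturnstile> Bot"
  unfolding der_def using assms by blast

text \<open>If every fresh variable led to a contradiction, then in each finite extension of \<open>S\<close> one of them would
  be fresh there as well, and the elimination rule would refute that extension. The next two lemmas
  argue in the same way with fresh constants from an infinite pool \<open>P\<close>.\<close>

lemma con_ext_exist:
  assumes "finite S" "con S" "Exist1 x \<psi> \<in> S" "finite F"
  shows "\<exists>w\<ge>N. w \<notin> F \<and> con ({rep \<psi> [Var w] [x], dep [Var w]} \<union> S)"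
proof (rule ccontr)
  assume no: "\<not> ?thesis"
  have "S \<tturnstile> Bot"
  proof (rule inconsistentI[OF assms(1)])
    fix \<Delta> :: "('a, 'b, 'c) fm set" assume \<Delta>: "finite \<Delta>" "S \<subseteq> \<Delta>"
    have "finite (F \<union> bv \<psi> \<union> (\<Union>\<theta>\<in>\<Delta> \<union> {\<psi>, Bot}. fv \<theta>))" using \<Delta> assms(4) by simp
    then obtain w where w: "w \<ge> N" "w \<notin> F \<union> bv \<psi> \<union> (\<Union>\<theta>\<in>\<Delta> \<union> {\<psi>, Bot}. fv \<theta>)"
      by (rule fresh_var)
    have "insert (rep \<psi> [Var w] [x]) (insert (dep [Var w]) S) \<tturnstile> Bot" using no w by auto
    then have 1: "insert (rep \<psi> [Var w] [x]) (insert (dep [Var w]) \<Delta>) \<turnstile> Bot"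
      using \<Delta> by (elim der_finite) auto
    have 2: "\<Delta> \<turnstile> Exist1 x \<psi>" using assms(3) \<Delta> by (auto intro: ded_asm)
    have 3: "rep_ok \<psi> [Var w] [x]" using w by (intro rep_ok_Var) simp
    show "\<Delta> \<turnstile> Bot" by (rule ded_exE_var[OF 2 1 3]) (use w in simp)
  qed
  then show False using assms(2) by simp
qed

lemma con_ext_neg_atom:
  assumes "finite S" "con S" "Neg l \<in> S" "is_atom l" "distinct xs" "fv l \<subseteq> set xs" "infinite P"
  shows "\<exists>cs. distinct cs \<and> length cs = length xs \<and> set cs \<subseteq> P \<and>
    con ({incl (zip (map Cst cs) (map Var xs)), Neg (rep l (map Cst cs) xs)} \<union> S)"
proof (rule ccontr)
  assume no: "\<not> ?thesis"
  have "S \<tturnstile> Bot"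
  proof (rule inconsistentI[OF assms(1)])
    fix \<Delta> :: "('a, 'b, 'c) fm set" assume \<Delta>: "finite \<Delta>" "S \<subseteq> \<Delta>"
    have "finite (\<Union>\<theta>\<in>\<Delta> \<union> {Bot, l}. csts \<theta>)" using \<Delta> by simp
    with assms(7) obtain cs where cs: "distinct cs" "length cs = length xs" "set cs \<subseteq> P"
      "set cs \<inter> (\<Union>\<theta>\<in>\<Delta> \<union> {Bot, l}. csts \<theta>) = {}" by (rule fresh_consts)
    have "insert (incl (zip (map Cst cs) (map Var xs))) (insert (Neg (rep l (map Cst cs) xs)) S) \<tturnstile> Bot"
      using no cs by auto
    then have 1: "insert (incl (zip (map Cst cs) (map Var xs))) (insert (Neg (rep l (map Cst cs) xs)) \<Delta>) \<turnstile> Bot"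
      using \<Delta> by (elim der_finite) auto
    have "\<Delta> \<turnstile> Neg l" using assms(3) \<Delta> by (auto intro: ded_asm)
    then show "\<Delta> \<turnstile> Bot" using assms(4-6) 1 cs(2,1,4) by (rule ded_neg_atom)
  qed
  then show False using assms(2) by simp
qed

lemma con_ext_neg_inc:
  assumes "finite S" "con S" "Neg (Inc xs ys) \<in> S" "length xs = length ys" "infinite P"
  shows "\<exists>cs. distinct cs \<and> length cs = length xs \<and> set cs \<subseteq> P \<and>
    con ({incl (zip (map Cst cs) (map Var xs)), Neg (incl (zip (map Cst cs) (map Var ys)))} \<union> S)"
proof (rule ccontr)
  assume no: "\<not> ?thesis"
  have "S \<tturnstile> Bot"
  proof (rule inconsistentI[OF assms(1)])
    fix \<Delta> :: "('a, 'b, 'c) fm set" assume \<Delta>: "finite \<Delta>" "S \<subseteq> \<Delta>"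
    have "finite (\<Union>\<theta>\<in>\<Delta> \<union> {Bot}. csts \<theta>)" using \<Delta> by simp
    with assms(5) obtain cs where cs: "distinct cs" "length cs = length xs" "set cs \<subseteq> P"
      "set cs \<inter> (\<Union>\<theta>\<in>\<Delta> \<union> {Bot}. csts \<theta>) = {}" by (rule fresh_consts)
    have "insert (incl (zip (map Cst cs) (map Var xs))) (insert (Neg (incl (zip (map Cst cs) (map Var ys)))) S) \<tturnstile> Bot"
      using no cs by auto
    then have 1: "insert (incl (zip (map Cst cs) (map Var xs))) (insert (Neg (incl (zip (map Cst cs) (map Var ys)))) \<Delta>) \<turnstile> Bot"
      using \<Delta> by (elim der_finite) auto
    have "\<Delta> \<turnstile> Neg (Inc xs ys)" using assms(3) \<Delta> by (auto intro: ded_asm)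
    then show "\<Delta> \<turnstile> Bot" using 1 assms(4) cs(2,1,4) by (rule ded_neg_inc)
  qed
  then show False using assms(2) by simp
qed

text \<open>This is trivially true unless \<open>\<phi>\<close> is of one of the three kinds that need a witness. For a first-order
  atom the tuple of constants stands for the free variables in increasing order.\<close>

definition witnessed :: "nat \<Rightarrow> 'c set \<Rightarrow> ('c, 'f, 'r) fm \<Rightarrow> ('c, 'f, 'r) fm set \<Rightarrow> bool" where
  "witnessed N P \<phi> E \<longleftrightarrow>
    (\<forall>x \<psi>. \<phi> = Exist1 x \<psi> \<longrightarrow> (\<exists>w\<ge>N. w \<notin> fv \<psi> \<union> bv \<psi> \<and> rep \<psi> [Var w] [x] \<in> E \<and> dep [Var w] \<in> E)) \<and>
    (\<forall>l. \<phi> = Neg l \<and> is_atom l \<longrightarrow> (\<exists>cs. distinct cs \<and> length cs = card (fv l) \<and> set cs \<subseteq> P \<and>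
       incl (zip (map Cst cs) (map Var (sorted_list_of_set (fv l)))) \<in> E \<and>
       Neg (rep l (map Cst cs) (sorted_list_of_set (fv l))) \<in> E)) \<and>
    (\<forall>ps. \<phi> = Neg (Incl ps) \<longrightarrow> (\<exists>cs. distinct cs \<and> length cs = length ps \<and> set cs \<subseteq> P \<and>
       incl (zip (map Cst cs) (map Var (map fst ps))) \<in> E \<and>
       Neg (incl (zip (map Cst cs) (map Var (map snd ps)))) \<in> E))"

lemma witnessed_mono: "witnessed N P \<phi> E \<Longrightarrow> E \<subseteq> E' \<Longrightarrow> witnessed N P \<phi> E'"
proof -
  assume w: "witnessed N P \<phi> E" and E: "E \<subseteq> E'"
  show ?thesis
    unfolding witnessed_def
  proof (intro conjI allI impI)
    fix x \<psi> assume "\<phi> = Exist1 x \<psi>"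
    then show "\<exists>w\<ge>N. w \<notin> fv \<psi> \<union> bv \<psi> \<and> rep \<psi> [Var w] [x] \<in> E' \<and> dep [Var w] \<in> E'"
      using conjunct1[OF w[unfolded witnessed_def]] E by blast
  next
    fix l assume "\<phi> = Neg l \<and> is_atom l"
    then show "\<exists>cs. distinct cs \<and> length cs = card (fv l) \<and> set cs \<subseteq> P \<and>
       incl (zip (map Cst cs) (map Var (sorted_list_of_set (fv l)))) \<in> E' \<and>
       Neg (rep l (map Cst cs) (sorted_list_of_set (fv l))) \<in> E'"
      using conjunct1[OF conjunct2[OF w[unfolded witnessed_def]]] E by blast
  next
    fix ps assume "\<phi> = Neg (Incl ps)"
    then show "\<exists>cs. distinct cs \<and> length cs = length ps \<and> set cs \<subseteq> P \<and>
       incl (zip (map Cst cs) (map Var (map fst ps))) \<in> E' \<and>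
       Neg (incl (zip (map Cst cs) (map Var (map snd ps)))) \<in> E'"
      using conjunct2[OF conjunct2[OF w[unfolded witnessed_def]]] E by blast
  qed
qed

lemma lang_incl_Csts: "set cs \<subseteq> A \<Longrightarrow> incl (zip (map Cst cs) (map Var xs)) \<in> lang A B C"
proof (rule lang_incl)
  fix a b :: "('a, 'b) tm" assume *: "set cs \<subseteq> A" "(a, b) \<in> set (zip (map Cst cs) (map Var xs))"
  from set_zip_leftD[OF *(2)] set_zip_rightD[OF *(2)] *(1)
  show "a \<in> tlang A B \<and> b \<in> tlang A B" by auto
qed

lemma con_ext_witnessed:
  assumes S: "finite S" "con S" "\<phi> \<in> S" "S \<subseteq> lang A B C" and P: "infinite P" "P \<subseteq> A"
  shows "\<exists>S'. S \<subseteq> S' \<and> finite S' \<and> con S' \<and> S' \<subseteq> lang A B C \<and> witnessed N P \<phi> S'"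
proof -
  consider (ex) x \<psi> where "\<phi> = Exist1 x \<psi>" | (atom) l where "\<phi> = Neg l" "is_atom l"
    | (inc) ps where "\<phi> = Neg (Incl ps)"
    | (other) "\<And>x \<psi>. \<phi> \<noteq> Exist1 x \<psi>" "\<And>l. \<phi> = Neg l \<Longrightarrow> \<not> is_atom l" "\<And>ps. \<phi> \<noteq> Neg (Incl ps)" by blast
  then show ?thesis
  proof cases
    case ex
    have \<psi>: "\<psi> \<in> lang A B C" using S(3,4) ex by auto
    obtain w where w: "w \<ge> N" "w \<notin> fv \<psi> \<union> bv \<psi>" "con ({rep \<psi> [Var w] [x], dep [Var w]} \<union> S)"
      using con_ext_exist[OF S(1,2), of x \<psi> "fv \<psi> \<union> bv \<psi>" N] S(3) ex by auto
    have "{rep \<psi> [Var w] [x], dep [Var w]} \<subseteq> lang A B C"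
      using \<psi> by (auto intro!: lang_dep lang_fsubst sb_tlang)
    moreover have "witnessed N P \<phi> ({rep \<psi> [Var w] [x], dep [Var w]} \<union> S)"
      using w ex by (auto simp: witnessed_def)
    ultimately show ?thesis using S w(3) by (intro exI[of _ "{rep \<psi> [Var w] [x], dep [Var w]} \<union> S"]) auto
  next
    case atom
    have l: "l \<in> lang A B C" using S(3,4) atom by auto
    define xs where "xs = sorted_list_of_set (fv l)"
    have xs: "distinct xs" "set xs = fv l" "length xs = card (fv l)" by (auto simp: xs_def)
    obtain cs where cs: "distinct cs" "length cs = length xs" "set cs \<subseteq> P"
      "con ({incl (zip (map Cst cs) (map Var xs)), Neg (rep l (map Cst cs) xs)} \<union> S)"
      using con_ext_neg_atom[OF S(1,2), of l xs P] S(3) atom xs P by auto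
    have "{incl (zip (map Cst cs) (map Var xs)), Neg (rep l (map Cst cs) xs)} \<subseteq> lang A B C"
    proof -
      have "set cs \<subseteq> A" using cs(3) P(2) by blast
      moreover from this have "set (map Cst cs) \<subseteq> tlang A B" by (simp add: image_subset_iff subset_eq)
      ultimately show ?thesis using l by (simp add: lang_incl_Csts lang_fsubst sb_tlang)
    qed
    moreover have "witnessed N P \<phi> ({incl (zip (map Cst cs) (map Var xs)), Neg (rep l (map Cst cs) xs)} \<union> S)"
      using cs(1-3) xs(3) atom unfolding witnessed_def xs_def[symmetric] by (auto simp: xs_def)
    ultimately show ?thesis using S cs(4)
      by (intro exI[of _ "{incl (zip (map Cst cs) (map Var xs)), Neg (rep l (map Cst cs) xs)} \<union> S"]) auto
  next
    case inc
    define xs ys where "xs = map fst ps" "ys = map snd ps"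
    have \<phi>: "\<phi> = Neg (Inc xs ys)" using inc by (simp add: xs_ys_def zip_map_fst_snd)
    obtain cs where cs: "distinct cs" "length cs = length xs" "set cs \<subseteq> P"
      "con ({incl (zip (map Cst cs) (map Var xs)), Neg (incl (zip (map Cst cs) (map Var ys)))} \<union> S)"
      using con_ext_neg_inc[OF S(1,2), of xs ys P] S(3) \<phi> P by (auto simp: xs_ys_def)
    have "{incl (zip (map Cst cs) (map Var xs)), Neg (incl (zip (map Cst cs) (map Var ys)))} \<subseteq> lang A B C"
      using subset_trans[OF cs(3) P(2)] by (auto intro!: lang_incl_Csts)
    moreover have "witnessed N P \<phi> ({incl (zip (map Cst cs) (map Var xs)), Neg (incl (zip (map Cst cs) (map Var ys)))} \<union> S)"
      using cs(1-3) inc unfolding witnessed_def by (auto simp: xs_ys_def)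
    ultimately show ?thesis using S cs(4)
      by (intro exI[of _ "{incl (zip (map Cst cs) (map Var xs)), Neg (incl (zip (map Cst cs) (map Var ys)))} \<union> S"]) auto
  next
    case other
    then have "witnessed N P \<phi> S" unfolding witnessed_def by blast
    then show ?thesis using S by blast
  qed
qed

text \<open>\<open>P\<close> is the pool of fresh constants; witness variables are at least \<open>N\<close>, and so never meet the variables
  of the formulas for which the model is built.\<close>

locale henkin =
  fixes S :: "('c, 'f, 'r) fm set" and A :: "'c set" and B :: "'f set" and C :: "'r set"
    and P :: "'c set" and N :: nat
  assumes S_lang: "S \<subseteq> lang A B C"
    and S_con: "con S"
    and S_max: "\<phi> \<in> lang A B C \<Longrightarrow> \<phi> \<notin> S \<Longrightarrow> insert \<phi> S \<tturnstile> Bot"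
    and S_wit: "\<phi> \<in> S \<Longrightarrow> witnessed N P \<phi> S"
    and P: "P \<subseteq> A" "P \<noteq> {}"

text \<open>Formulas of the language are added one at a time whenever this is consistent, each together with
  its witnesses. The stages remain finite, which leaves fresh symbols for the later ones.\<close>

lemma con_extends_to_henkin:
  assumes S0: "finite S0" "con S0" "S0 \<subseteq> lang A B C" and P: "infinite P" "P \<subseteq> A"
    and count: "countable A" "countable B" "countable C"
  obtains S where "S0 \<subseteq> S" "henkin S A B C P N"
proof -
  let ?L = "lang A B C"
  define enum where "enum = from_nat_into ?L"
  have ne: "?L \<noteq> {}" using lang_Bot[of A B C] by blast
  have enum: "enum n \<in> ?L" "\<And>\<phi>. \<phi> \<in> ?L \<Longrightarrow> \<exists>n. enum n = \<phi>" for n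
    unfolding enum_def
    by (rule from_nat_into[OF ne]) (rule from_nat_into_surj[OF countable_lang[OF count]])
  define good where "good T \<longleftrightarrow> finite T \<and> con T \<and> T \<subseteq> ?L" for T
  define step where "step T \<phi> = (if con (insert \<phi> T)
     then SOME T'. insert \<phi> T \<subseteq> T' \<and> good T' \<and> witnessed N P \<phi> T' else T)" for T \<phi>
  have step_con: "insert \<phi> T \<subseteq> step T \<phi> \<and> good (step T \<phi>) \<and> witnessed N P \<phi> (step T \<phi>)"
    if "good T" "\<phi> \<in> ?L" "con (insert \<phi> T)" for T \<phi>
  proof -
    have "\<exists>T'. insert \<phi> T \<subseteq> T' \<and> good T' \<and> witnessed N P \<phi> T'"
      using con_ext_witnessed[of "insert \<phi> T" \<phi> A B C P N] that P unfolding good_def by auto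
    then show ?thesis using that(3) someI_ex[of "\<lambda>T'. insert \<phi> T \<subseteq> T' \<and> good T' \<and> witnessed N P \<phi> T'"]
      by (simp add: step_def)
  qed
  have step: "T \<subseteq> step T \<phi>" "good (step T \<phi>)" if "good T" "\<phi> \<in> ?L" for T \<phi>
    using step_con[OF that] that by (auto simp: step_def)
  define chain where "chain = rec_nat S0 (\<lambda>n T. step T (enum n))"
  have chain_simps: "chain 0 = S0" "chain (Suc n) = step (chain n) (enum n)" for n
    by (simp_all add: chain_def)
  have good: "good (chain n)" for n
    by (induction n) (use S0 enum step in \<open>auto simp: chain_simps good_def\<close>)
  have mono: "chain m \<subseteq> chain n" if "m \<le> n" for m n
    using that by (rule lift_Suc_mono_le[of chain, rotated]) (use step(1)[OF good enum(1)] in \<open>simp add: chain_simps\<close>)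
  define S where "S = (\<Union>n. chain n)"
  have compact: "\<exists>n. T \<subseteq> chain n" if "finite T" "T \<subseteq> S" for T
    using that
  proof (induction T)
    case (insert \<phi> T)
    then obtain n m where "T \<subseteq> chain n" "\<phi> \<in> chain m" by (auto simp: S_def)
    then have "insert \<phi> T \<subseteq> chain (max n m)" using mono[of n "max n m"] mono[of m "max n m"] by auto
    then show ?case by blast
  qed simp
  have max: "\<phi> \<in> chain (Suc n) \<and> witnessed N P \<phi> (chain (Suc n)) \<or> insert \<phi> (chain n) \<tturnstile> Bot"
    if "enum n = \<phi>" for \<phi> n
    using step_con[OF good enum(1), of n n] that by (auto simp: chain_simps)
  have "con S"
  proof
    assume "S \<tturnstile> Bot"
    then obtain T where T: "T \<subseteq> S" "finite T" "\<forall>\<Delta>. finite \<Delta> \<and> T \<subseteq> \<Delta> \<longrightarrow> \<Delta> \<turnstile> Bot" unfolding der_def by blast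
    then obtain n where "T \<subseteq> chain n" using compact by blast
    then have "chain n \<tturnstile> Bot" unfolding der_def using T by blast
    then show False using good[of n] by (simp add: good_def)
  qed
  moreover have "S \<subseteq> ?L" using good by (auto simp: S_def good_def)
  moreover have "insert \<phi> S \<tturnstile> Bot" if "\<phi> \<in> ?L" "\<phi> \<notin> S" for \<phi>
  proof -
    from enum(2)[OF that(1)] obtain n where "enum n = \<phi>" by blast
    then have "insert \<phi> (chain n) \<tturnstile> Bot" using max that by (auto simp: S_def)
    then show ?thesis by (rule der_mono) (auto simp: S_def)
  qed
  moreover have "witnessed N P \<phi> S" if "\<phi> \<in> S" for \<phi>
  proof -
    have "\<phi> \<in> ?L" using that \<open>S \<subseteq> ?L\<close> by blast
    then obtain n where n: "enum n = \<phi>" using enum(2) by blast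
    have "\<not> insert \<phi> (chain n) \<tturnstile> Bot"
    proof
      assume "insert \<phi> (chain n) \<tturnstile> Bot"
      then have "S \<tturnstile> Bot" by (rule der_mono) (use that in \<open>auto simp: S_def\<close>)
      then show False using \<open>con S\<close> by simp
    qed
    then have "witnessed N P \<phi> (chain (Suc n))" using max[OF n] by blast
    then show ?thesis by (rule witnessed_mono) (auto simp: S_def)
  qed
  moreover have "P \<noteq> {}" using P by auto
  ultimately have "henkin S A B C P N" using P by unfold_locales auto
  moreover have "S0 \<subseteq> S" using chain_simps(1) by (auto simp: S_def)
  ultimately show thesis using that by blast
qed

section \<open>Derived rules for connectives and quantifiers\<close>

lemma der_andI: "\<Gamma> \<tturnstile> \<phi> \<Longrightarrow> \<Gamma> \<tturnstile> \<psi> \<Longrightarrow> \<Gamma> \<tturnstile> And \<phi> \<psi>"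
  by (rule der_lift2[OF ded_andI])

lemma der_and_iff: "\<Gamma> \<tturnstile> And \<phi> \<psi> \<longleftrightarrow> \<Gamma> \<tturnstile> \<phi> \<and> \<Gamma> \<tturnstile> \<psi>"
proof -
  have "\<Gamma> \<tturnstile> \<phi>" if "\<Gamma> \<tturnstile> And \<phi> \<psi>" using ded_andE1 that by (rule der_lift1)
  moreover have "\<Gamma> \<tturnstile> \<psi>" if "\<Gamma> \<tturnstile> And \<phi> \<psi>" using ded_andE2 that by (rule der_lift1)
  ultimately show ?thesis using der_andI by blast
qed

lemma der_conjs_iff: "\<Gamma> \<tturnstile> conjs \<Phi> \<longleftrightarrow> (\<forall>\<phi>\<in>set \<Phi>. \<Gamma> \<tturnstile> \<phi>)"
proof (induction \<Phi> rule: conjs.induct)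
  case 1
  show ?case by (auto intro: der_negI der_asm)
qed (auto simp: der_and_iff)

lemma der_orE:
  assumes "\<Gamma> \<tturnstile> Or1 \<phi> \<psi>" "insert \<phi> \<Gamma> \<tturnstile> \<chi>" "insert \<psi> \<Gamma> \<tturnstile> \<chi>"
  shows "\<Gamma> \<tturnstile> \<chi>"
proof -
  obtain T where T: "T \<subseteq> \<Gamma>" "finite T" "\<And>\<Delta>. finite \<Delta> \<Longrightarrow> T \<subseteq> \<Delta> \<Longrightarrow> \<Delta> \<turnstile> Or1 \<phi> \<psi>"
    using assms(1) unfolding der_def by blast
  obtain T1 where T1: "T1 \<subseteq> insert \<phi> \<Gamma>" "finite T1" "\<And>\<Delta>. finite \<Delta> \<Longrightarrow> T1 \<subseteq> \<Delta> \<Longrightarrow> \<Delta> \<turnstile> \<chi>"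
    using assms(2) unfolding der_def by blast
  obtain T2 where T2: "T2 \<subseteq> insert \<psi> \<Gamma>" "finite T2" "\<And>\<Delta>. finite \<Delta> \<Longrightarrow> T2 \<subseteq> \<Delta> \<Longrightarrow> \<Delta> \<turnstile> \<chi>"
    using assms(3) unfolding der_def by blast
  \<comment> \<open>The finite part of \<open>\<Gamma>\<close> on which all three derivations depend.\<close>
  define U where "U = T \<union> (T1 - {\<phi>}) \<union> (T2 - {\<psi>})"
  have "\<Delta> \<turnstile> \<chi>" if \<Delta>: "finite \<Delta>" "U \<subseteq> \<Delta>" for \<Delta>
  proof (rule ded_orE)
    show "\<Delta> \<turnstile> Or1 \<phi> \<psi>" using \<Delta> by (intro T(3)) (auto simp: U_def)
    show "insert \<phi> \<Delta> \<turnstile> \<chi>" using \<Delta> by (intro T1(3)) (auto simp: U_def)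
    show "insert \<psi> \<Delta> \<turnstile> \<chi>" using \<Delta> by (intro T2(3)) (auto simp: U_def)
  qed
  moreover have "U \<subseteq> \<Gamma>" "finite U" using T(1,2) T1(1,2) T2(1,2) by (auto simp: U_def)
  ultimately show ?thesis unfolding der_def by blast
qed

lemma der_exI:
  assumes "\<Gamma> \<tturnstile> rep \<phi> [t] [x]" "rep_ok \<phi> [t] [x]" "\<Gamma> \<tturnstile> dep [t]"
  shows "\<Gamma> \<tturnstile> Exist1 x \<phi>"
  by (rule der_lift2[OF _ assms(1,3)]) (rule ded_exI[OF _ assms(2)])

lemma der_allE:
  assumes "\<Gamma> \<tturnstile> Forall1 x \<phi>" "rep_ok \<phi> [t] [x]" "\<Gamma> \<tturnstile> dep [t]"
  shows "\<Gamma> \<tturnstile> rep \<phi> [t] [x]"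
  by (rule der_lift2[OF _ assms(1,3)]) (rule ded_allE[OF _ _ assms(2)])

text \<open>The dual witness property: it spares a witness for the failure of a universal quantifier.\<close>

lemma der_not_all:
  assumes "\<Gamma> \<tturnstile> Neg (Forall1 x \<phi>)"
  shows "\<Gamma> \<tturnstile> Exist1 x (Neg \<phi>)"
proof (rule der_raa)
  let ?\<Gamma> = "insert (Neg (Exist1 x (Neg \<phi>))) \<Gamma>"
  have "?\<Gamma> \<tturnstile> Forall1 x \<phi>"
    unfolding der_def
  proof (intro exI[of _ "{Neg (Exist1 x (Neg \<phi>))}"] conjI allI impI)
    fix \<Delta> :: "('a, 'b, 'c) fm set"
    assume \<Delta>: "finite \<Delta> \<and> {Neg (Exist1 x (Neg \<phi>))} \<subseteq> \<Delta>"
    have "finite (bv \<phi> \<union> (\<Union>\<theta>\<in>\<Delta> \<union> {\<phi>}. fv \<theta>))" using \<Delta> by simp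
    then obtain w where w: "w \<notin> bv \<phi> \<union> (\<Union>\<theta>\<in>\<Delta> \<union> {\<phi>}. fv \<theta>)" by (rule fresh_var)
    have ok: "rep_ok \<phi> [Var w] [x]" using w by (intro rep_ok_Var) simp
    have "insert (dep [Var w]) \<Delta> \<tturnstile> rep \<phi> [Var w] [x]"
    proof (rule der_raa)
      let ?\<Delta> = "insert (Neg (rep \<phi> [Var w] [x])) (insert (dep [Var w]) \<Delta>)"
      have "?\<Delta> \<tturnstile> Exist1 x (Neg \<phi>)"
        by (rule der_exI[where t = "Var w"]) (use ok in \<open>auto intro: der_asm\<close>)
      moreover have "?\<Delta> \<tturnstile> Neg (Exist1 x (Neg \<phi>))" using \<Delta> by (intro der_asm) auto
      ultimately show "?\<Delta> \<tturnstile> Bot" by (rule der_negE)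
    qed
    then have "insert (dep [Var w]) \<Delta> \<turnstile> rep \<phi> [Var w] [x]" using \<Delta> by (elim der_finite) auto
    then show "\<Delta> \<turnstile> Forall1 x \<phi>" using ok by (rule ded_allI_var) (use w in simp)
  qed auto
  moreover have "?\<Gamma> \<tturnstile> Neg (Forall1 x \<phi>)" using assms by (rule der_mono) auto
  ultimately show "?\<Gamma> \<tturnstile> Bot" by (rule der_negE)
qed

lemma der_inc_refl: "\<Gamma> \<tturnstile> Incl (map (\<lambda>x. (x, x)) xs)"
proof -
  have "\<Gamma> \<tturnstile> Inc xs xs" by (rule der_lift0[OF ded_inc_refl])
  moreover have "zip xs xs = map (\<lambda>x. (x, x)) xs" by (simp add: zip_same_conv_map)
  ultimately show ?thesis by simp
qed

lemma der_inc_trans: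
  "\<Gamma> \<tturnstile> Inc xs ys \<Longrightarrow> \<Gamma> \<tturnstile> Inc ys zs \<Longrightarrow> length xs = length ys \<Longrightarrow> length ys = length zs \<Longrightarrow> \<Gamma> \<tturnstile> Inc xs zs"
  by (rule der_lift2[OF ded_inc_trans])

lemma der_inc_dep:
  assumes "\<Gamma> \<tturnstile> dep (map Var ws)" "\<Gamma> \<tturnstile> Incl ps"
  shows "\<Gamma> \<tturnstile> Incl (map (\<lambda>w. (w, w)) ws @ ps)"
proof -
  have "\<Gamma> \<tturnstile> Inc (ws @ map fst ps) (ws @ map snd ps)"
    by (rule der_lift2[OF ded_inc_dep assms(1) assms(2)[unfolded Incl_eq_Inc[of ps]]]) simp_all
  moreover have "zip (ws @ map fst ps) (ws @ map snd ps) = map (\<lambda>w. (w, w)) ws @ ps"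
    by (simp add: zip_same_conv_map zip_map_fst_snd)
  ultimately show ?thesis by simp
qed

lemma der_inc_ex:
  assumes "\<Gamma> \<tturnstile> dep (map Var xs)" "\<Gamma> \<tturnstile> Inc xs ys" "length xs = length ys" "length zs = length ws"
    "distinct zs" "set zs \<inter> (set xs \<union> set ys \<union> set ws) = {}"
  shows "\<Gamma> \<tturnstile> Exist1s zs (Inc (zs @ xs) (ws @ ys))"
  by (rule der_lift2[OF _ assms(1,2)]) (rule ded_inc_ex[OF _ _ assms(3-)])

lemma fsubst_Bot: "fsubst \<sigma> Bot = Bot"
  by (simp add: Bot_def)

lemma fsubst_conjs: "fsubst \<sigma> (conjs \<Phi>) = conjs (map (fsubst \<sigma>) \<Phi>)"
  by (induction \<Phi> rule: conjs.induct) (auto simp: fsubst_Bot)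

lemma bv_Exist1s: "bv (Exist1s us \<phi>) = set us \<union> bv \<phi>"
  by (induction us) (auto simp: Exist1s_def)

lemma Exist1s_Cons: "Exist1s (u # us) \<phi> = Exist1 u (Exist1s us \<phi>)"
  by (simp add: Exist1s_def)

lemma fsubst_Exist1s:
  "set us \<inter> {x. \<rho> x \<noteq> x} = {} \<Longrightarrow> fsubst (Var \<circ> \<rho>) (Exist1s us \<phi>) = Exist1s us (fsubst (Var \<circ> \<rho>) \<phi>)"
proof (induction us)
  case (Cons u us)
  then have "\<rho>(u := u) = \<rho>" by auto
  then have "fsubst (Var \<circ> \<rho>) (Exist1 u (Exist1s us \<phi>)) = Exist1 u (fsubst (Var \<circ> \<rho>) (Exist1s us \<phi>))"
    by (simp only: fsubst.simps Var_comp_upd)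
  moreover have "fsubst (Var \<circ> \<rho>) (Exist1s us \<phi>) = Exist1s us (fsubst (Var \<circ> \<rho>) \<phi>)"
    by (rule Cons.IH) (use Cons.prems in auto)
  ultimately show ?case unfolding Exist1s_Cons by metis
qed (simp add: Exist1s_def)

lemma fsubst_Exist1s_upd:
  "u \<notin> set us \<Longrightarrow> fsubst (Var \<circ> id(u := w)) (Exist1s us \<phi>) = Exist1s us (fsubst (Var \<circ> id(u := w)) \<phi>)"
  by (rule fsubst_Exist1s) auto

lemma fsubst_comp_qf_Var:
  "bv \<psi> = {} \<Longrightarrow> fsubst (Var \<circ> \<tau>) (fsubst (Var \<circ> \<rho>) \<psi>) = fsubst (Var \<circ> (\<tau> \<circ> \<rho>)) \<psi>"
  using fsubst_comp_qf[of \<psi> "Var \<circ> \<rho>" "Var \<circ> \<tau>"] by (auto simp: comp_def)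

lemma bv_fsubst_Var: "bv (fsubst (Var \<circ> \<rho>) \<phi>) = bv \<phi>"
proof (induction \<phi> arbitrary: \<rho>)
  case (Incl ps)
  show ?case unfolding fsubst_Var_Incl by simp
qed (simp_all add: Var_comp_upd del: fun_upd_apply)

lemma upds_id_Cons:
  assumes "u \<notin> set us" "w \<notin> set us"
  shows "upds id us ws \<circ> id(u := w) = upds id (u # us) (w # ws)"
  using assms by (auto simp: fun_eq_iff upds_notin upds_Cons) (auto simp: upds_def split: option.split)

text \<open>For distinct constants the abbreviation names each constant by one variable, in the given order.\<close>

lemma incl_Cst:
  assumes "distinct cs" "length cs = length xs"
  defines "us \<equiv> fresh_vars (set xs) (length xs)"
  shows "incl (zip (map Cst cs) (map Var xs)) =
    Exist1s us (conjs (map2 (\<lambda>u t. Eq (Var u) t) us (map Cst cs) @ [Inc us xs]))"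
proof -
  define ps :: "(('a, 'b) tm \<times> ('a, 'b) tm) list" where "ps = zip (map Cst cs) (map Var xs)"
  have us: "length us = length xs" unfolding us_def by (simp add: fresh_vars)
  have fst: "map fst ps = map Cst cs" and snd: "map snd ps = map Var xs"
    using assms(2) by (auto simp: ps_def)
  have *: "concat (map (\<lambda>t. case t of Cst c \<Rightarrow> [c] | _ \<Rightarrow> []) (map Cst cs :: ('a, 'b) tm list)) = cs"
    "concat (map (\<lambda>t. case t of Cst c \<Rightarrow> [c] | _ \<Rightarrow> []) (map Var xs :: ('a, 'b) tm list)) = []"
    by (induction cs) auto
  have cs: "incl_consts ps = cs"
    unfolding incl_consts_def fst snd map_append concat_append * using assms(1) by simp
  have "(\<Union>(s, t)\<in>set ps. tfv s \<union> tfv t) = (\<Union>t\<in>fst ` set ps \<union> snd ` set ps. tfv t)" by force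
  also have "\<dots> = set xs" unfolding set_map[symmetric] fst snd by auto
  finally have fv: "(\<Union>(s, t)\<in>set ps. tfv s \<union> tfv t) = set xs" .
  have "map (\<lambda>(s, t). (case s of Var x \<Rightarrow> x | Cst c \<Rightarrow> the (map_of (zip cs us) c) | Fn f ts \<Rightarrow> 0,
          case t of Var x \<Rightarrow> x | Cst c \<Rightarrow> the (map_of (zip cs us) c) | Fn f ts \<Rightarrow> 0)) ps = zip us xs"
    using assms(1,2) us by (auto intro!: nth_equalityI simp: ps_def map_of_zip_nth)
  then have "incl ps = Exist1s us (conjs (map2 (\<lambda>u c. Eq (Var u) (Cst c)) us cs @ [Inc us xs]))"
    unfolding incl_def Let_def cs fv assms(2) us_def[symmetric] by (rule arg_cong)
  then show ?thesis by (simp add: ps_def zip_map2 comp_def case_prod_unfold)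
qed

lemma fsubst_named:
  fixes \<Psi> :: "('c, 'f, 'r) fm list"
  assumes "distinct us" "length ts = length us" "length ws = length us"
    "set us \<inter> (\<Union>t\<in>set ts. tfv t) = {}"
  shows "fsubst (Var \<circ> upds id us ws) (conjs (map2 (\<lambda>u t. Eq (Var u) t) us ts @ \<Psi>)) =
    conjs (map2 (\<lambda>w t. Eq (Var w) t) ws ts @ map (fsubst (Var \<circ> upds id us ws)) \<Psi>)"
proof -
  have "tsubst (Var \<circ> upds id us ws) t = t" if "t \<in> set ts" for t
  proof -
    have "tsubst (Var \<circ> upds id us ws) t = tsubst Var t"
      using that assms(4) by (intro tsubst_cong) (simp, subst upds_notin, auto)
    then show ?thesis by (simp add: tsubst_Var)
  qed
  then have "map (fsubst (Var \<circ> upds id us ws)) (map2 (\<lambda>u t. Eq (Var u) t) us ts) =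
      (map2 (\<lambda>w t. Eq (Var w) t) ws ts :: ('c, 'f, 'r) fm list)"
    using assms by (auto intro!: nth_equalityI simp: upds_nth)
  then show ?thesis by (simp only: fsubst_conjs map_append)
qed

lemma bv_conjs: "(\<And>\<phi>. \<phi> \<in> set \<Phi> \<Longrightarrow> bv \<phi> = {}) \<Longrightarrow> \<Phi> \<noteq> [] \<Longrightarrow> bv (conjs \<Phi>) = {}"
  by (induction \<Phi> rule: conjs.induct) auto

lemma ball_map2_iff:
  "length ws = length ts \<Longrightarrow> (\<forall>\<phi>\<in>set (map2 (\<lambda>w t. Eq (Var w) t) ws ts). Q \<phi>) \<longleftrightarrow>
    (\<forall>i<length ts. Q (Eq (Var (ws ! i)) (ts ! i)))"
  by (simp add: all_set_conv_all_nth)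

section \<open>Properties of Henkin sets\<close>

context henkin
begin

lemma S_iff: "\<phi> \<in> lang A B C \<Longrightarrow> \<phi> \<in> S \<longleftrightarrow> S \<tturnstile> \<phi>"
  using S_max S_con der_negI der_negE der_asm by metis

lemma S_neg: "\<phi> \<in> lang A B C \<Longrightarrow> S \<tturnstile> Neg \<phi> \<longleftrightarrow> \<not> S \<tturnstile> \<phi>"
  using S_iff[of \<phi>] S_max[of \<phi>] S_con der_negI[of \<phi> S] der_negE[of S \<phi> Bot] by blast

lemma S_or: "\<phi> \<in> lang A B C \<Longrightarrow> \<psi> \<in> lang A B C \<Longrightarrow> S \<tturnstile> Or1 \<phi> \<psi> \<longleftrightarrow> S \<tturnstile> \<phi> \<or> S \<tturnstile> \<psi>"
proof -
  assume *: "\<phi> \<in> lang A B C" "\<psi> \<in> lang A B C"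
  have "S \<tturnstile> Or1 \<phi> \<psi>" if "S \<tturnstile> \<phi>" using ded_orI1 that by (rule der_lift1)
  moreover have "S \<tturnstile> Or1 \<phi> \<psi>" if "S \<tturnstile> \<psi>" using ded_orI2 that by (rule der_lift1)
  moreover have "S \<tturnstile> Bot" if "S \<tturnstile> Or1 \<phi> \<psi>" "\<phi> \<notin> S" "\<psi> \<notin> S"
    using that(1) S_max[OF *(1) that(2)] S_max[OF *(2) that(3)] by (rule der_orE)
  ultimately show ?thesis using S_con S_iff[OF *(1)] S_iff[OF *(2)] by blast
qed

text \<open>The elements of the model to come, before identification of equal ones.\<close>

definition D :: "nat set" where
  "D = {w. N \<le> w \<and> S \<tturnstile> dep [Var w]}"

lemma S_exE:
  assumes "S \<tturnstile> Exist1 x \<psi>" "\<psi> \<in> lang A B C"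
  obtains w where "w \<in> D" "w \<notin> fv \<psi> \<union> bv \<psi>" "S \<tturnstile> rep \<psi> [Var w] [x]"
proof -
  have "Exist1 x \<psi> \<in> S" using assms S_iff by simp
  from conjunct1[OF S_wit[OF this, unfolded witnessed_def]]
  obtain w where "w \<ge> N" "w \<notin> fv \<psi> \<union> bv \<psi>" "rep \<psi> [Var w] [x] \<in> S" "dep [Var w] \<in> S" by blast
  then show thesis using that[of w] by (simp add: D_def der_asm)
qed

text \<open>The witnesses are chosen outermost first; each avoids the variables quantified further inside, so
  the successive renamings amount to a simultaneous one.\<close>

lemma S_Exist1sE:
  assumes "S \<tturnstile> Exist1s us \<phi>" "\<phi> \<in> lang A B C" "distinct us" "bv \<phi> = {}"
  obtains ws where "length ws = length us" "set ws \<subseteq> D" "S \<tturnstile> fsubst (Var \<circ> upds id us ws) \<phi>"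
proof -
  have "\<exists>ws. length ws = length us \<and> set ws \<subseteq> D \<and> S \<tturnstile> fsubst (Var \<circ> upds id us ws) \<phi>"
    using assms
  proof (induction us arbitrary: \<phi>)
    case Nil
    have "Var \<circ> id = Var" by auto
    then show ?case using Nil by (simp add: Exist1s_def fsubst_Var)
  next
    case (Cons u us)
    obtain w where w: "w \<in> D" "w \<notin> bv (Exist1s us \<phi>)" "S \<tturnstile> rep (Exist1s us \<phi>) [Var w] [u]"
      using S_exE[of u "Exist1s us \<phi>"] Cons(2,3) by (auto simp: Exist1s_Cons)
    have "S \<tturnstile> Exist1s us (fsubst (Var \<circ> id(u := w)) \<phi>)"
      using w(3) Cons(4) fsubst_Exist1s_upd[of u us w \<phi>] unfolding sb_Var1 by (metis distinct.simps(2))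
    then obtain ws where ws: "length ws = length us" "set ws \<subseteq> D"
      "S \<tturnstile> fsubst (Var \<circ> upds id us ws) (fsubst (Var \<circ> id(u := w)) \<phi>)"
      using Cons(1)[of "fsubst (Var \<circ> id(u := w)) \<phi>"] Cons(3-5) bv_fsubst_Var lang_rep_Var
      by (metis distinct.simps(2))
    have "upds id us ws \<circ> id(u := w) = upds id (u # us) (w # ws)"
      using w(2) Cons(4) by (intro upds_id_Cons) (auto simp: bv_Exist1s)
    then have "S \<tturnstile> fsubst (Var \<circ> upds id (u # us) (w # ws)) \<phi>"
      using ws(3) fsubst_comp_qf_Var[OF Cons(5)] by metis
    moreover have "length (w # ws) = length (u # us)" "set (w # ws) \<subseteq> D" using ws w(1) by simp_all
    ultimately show ?case by blast
  qed
  then show thesis using that by blast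
qed

lemma S_Exist1sI:
  assumes "S \<tturnstile> fsubst (Var \<circ> upds id us ws) \<phi>" "length ws = length us" "set ws \<subseteq> D"
    "distinct us" "bv \<phi> = {}" "set ws \<inter> set us = {}"
  shows "S \<tturnstile> Exist1s us \<phi>"
  using assms
proof (induction us arbitrary: ws \<phi>)
  case Nil
  have "Var \<circ> id = Var" by auto
  then show ?case using Nil by (simp add: Exist1s_def fsubst_Var)
next
  case (Cons u us)
  then obtain w ws' where ws: "ws = w # ws'" by (cases ws) auto
  have "upds id us ws' \<circ> id(u := w) = upds id (u # us) ws"
    unfolding ws using Cons ws by (intro upds_id_Cons) auto
  then have "S \<tturnstile> fsubst (Var \<circ> upds id us ws') (fsubst (Var \<circ> id(u := w)) \<phi>)"
    using Cons(2) fsubst_comp_qf_Var[OF Cons(6)] by metis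
  then have "S \<tturnstile> Exist1s us (fsubst (Var \<circ> id(u := w)) \<phi>)"
    by (rule Cons(1)) (use Cons(3-) ws in \<open>auto simp: bv_fsubst_Var\<close>)
  then have "S \<tturnstile> rep (Exist1s us \<phi>) [Var w] [u]"
    using Cons(5) fsubst_Exist1s_upd[of u us w \<phi>] unfolding sb_Var1 by (metis distinct.simps(2))
  moreover have "rep_ok (Exist1s us \<phi>) [Var w] [u]"
    using Cons ws by (intro rep_ok_Var) (auto simp: bv_Exist1s)
  moreover have "S \<tturnstile> dep [Var w]" using Cons(4) ws by (auto simp: D_def)
  ultimately show ?case unfolding Exist1s_Cons by (rule der_exI)
qed

lemma S_namedE:
  assumes "S \<tturnstile> Exist1s us (conjs (map2 (\<lambda>u t. Eq (Var u) t) us ts @ \<Psi>))"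
    and us: "distinct us" "length ts = length us" "set us \<inter> (\<Union>t\<in>set ts. tfv t) = {}"
    and "set ts \<subseteq> tlang A B" "set \<Psi> \<subseteq> lang A B C" "\<And>\<psi>. \<psi> \<in> set \<Psi> \<Longrightarrow> bv \<psi> = {}" "ts \<noteq> [] \<or> \<Psi> \<noteq> []"
  obtains ws where "length ws = length ts" "set ws \<subseteq> D"
    "\<And>i. i < length ts \<Longrightarrow> S \<tturnstile> Eq (Var (ws ! i)) (ts ! i)"
    "\<And>\<psi>. \<psi> \<in> set \<Psi> \<Longrightarrow> S \<tturnstile> fsubst (Var \<circ> upds id us ws) \<psi>"
proof -
  let ?\<phi> = "conjs (map2 (\<lambda>u t. Eq (Var u) t) us ts @ \<Psi>)"
  have "?\<phi> \<in> lang A B C" using assms(5,6) by (auto dest!: set_zip_rightD)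
  moreover have "bv ?\<phi> = {}" using assms(2,3,7,8) by (intro bv_conjs) auto
  ultimately obtain ws where ws: "length ws = length us" "set ws \<subseteq> D" "S \<tturnstile> fsubst (Var \<circ> upds id us ws) ?\<phi>"
    using S_Exist1sE[OF assms(1) _ us(1)] by blast
  have *: "length ws = length ts" using ws us by simp
  have "\<forall>\<phi>\<in>set (map2 (\<lambda>w t. Eq (Var w) t) ws ts). S \<tturnstile> \<phi>" "\<forall>\<psi>\<in>set \<Psi>. S \<tturnstile> fsubst (Var \<circ> upds id us ws) \<psi>"
    using ws(3) unfolding fsubst_named[OF us(1,2) ws(1) us(3)] der_conjs_iff by auto
  then show thesis using that[OF * ws(2)] unfolding ball_map2_iff[OF *] by blast
qed

lemma S_namedI:
  assumes us: "distinct us" "length ts = length us" "set us \<inter> (\<Union>t\<in>set ts. tfv t) = {}"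
    and ws: "length ws = length ts" "set ws \<subseteq> D" "set ws \<inter> set us = {}"
    and "\<And>i. i < length ts \<Longrightarrow> S \<tturnstile> Eq (Var (ws ! i)) (ts ! i)"
    and "\<And>\<psi>. \<psi> \<in> set \<Psi> \<Longrightarrow> S \<tturnstile> fsubst (Var \<circ> upds id us ws) \<psi>"
    and "\<And>\<psi>. \<psi> \<in> set \<Psi> \<Longrightarrow> bv \<psi> = {}" "ts \<noteq> [] \<or> \<Psi> \<noteq> []"
  shows "S \<tturnstile> Exist1s us (conjs (map2 (\<lambda>u t. Eq (Var u) t) us ts @ \<Psi>))"
proof (rule S_Exist1sI)
  have *: "length ws = length us" using us ws by simp
  show "S \<tturnstile> fsubst (Var \<circ> upds id us ws) (conjs (map2 (\<lambda>u t. Eq (Var u) t) us ts @ \<Psi>))"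
    unfolding fsubst_named[OF us(1,2) * us(3)] der_conjs_iff set_append ball_Un ball_map2_iff[OF ws(1)]
    using assms(7,8) by auto
  show "bv (conjs (map2 (\<lambda>u t. Eq (Var u) t) us ts @ \<Psi>)) = {}"
    using assms(2,9,10) us by (intro bv_conjs) auto
qed (use us ws in auto)

lemma S_dep_Vars:
  assumes "set ws \<subseteq> D"
  shows "S \<tturnstile> dep (map Var ws)"
proof (cases "ws = []")
  case True
  have "S \<tturnstile> dep (map Cst [])" by (rule der_lift0[OF ded_dep_cst])
  then show ?thesis using True by simp
next
  case False
  define us where "us = fresh_vars (set ws) (length ws)"
  have us: "distinct us" "length us = length ws" "set us \<inter> set ws = {}"
    unfolding us_def by (simp_all add: fresh_vars)
  have "S \<tturnstile> Exist1s us (conjs (map2 (\<lambda>u t. Eq (Var u) t) us (map Var ws) @ []))"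
    by (rule S_namedI[where ws = ws]) (use us assms False in \<open>auto intro: der_eq_refl\<close>)
  then show ?thesis by (simp add: dep_def Let_def us_def comp_def)
qed

lemma S_depE:
  assumes "S \<tturnstile> dep [t]" "t \<in> tlang A B"
  obtains w where "w \<in> D" "S \<tturnstile> Eq (Var w) t"
proof -
  define us where "us = fresh_vars (tfv t) 1"
  have us: "distinct us" "length us = 1" "set us \<inter> tfv t = {}"
    unfolding us_def by (simp_all add: fresh_vars)
  have "S \<tturnstile> Exist1s us (conjs (map2 (\<lambda>u t. Eq (Var u) t) us [t] @ []))"
    using assms(1) by (simp add: dep_def Let_def us_def)
  then obtain ws where "length ws = length [t]" "set ws \<subseteq> D" "\<And>i. i < length [t] \<Longrightarrow> S \<tturnstile> Eq (Var (ws ! i)) ([t] ! i)"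
    by (rule S_namedE) (use us assms in auto)
  then show thesis using that[of "ws ! 0"] by (auto simp: length_Suc_conv)
qed

lemma S_incl_CstE:
  assumes "S \<tturnstile> incl (zip (map Cst cs) (map Var xs))" "distinct cs" "length cs = length xs" "set cs \<subseteq> A"
  obtains ws where "length ws = length xs" "set ws \<subseteq> D" "S \<tturnstile> Inc ws xs"
    "\<And>i. i < length xs \<Longrightarrow> S \<tturnstile> Eq (Var (ws ! i)) (Cst (cs ! i))"
proof -
  define us where "us = fresh_vars (set xs) (length xs)"
  have us: "distinct us" "length us = length xs" "set us \<inter> set xs = {}"
    unfolding us_def by (simp_all add: fresh_vars)
  have "S \<tturnstile> Exist1s us (conjs (map2 (\<lambda>u t. Eq (Var u) t) us (map Cst cs) @ [Inc us xs]))"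
    using assms(1) unfolding incl_Cst[OF assms(2,3)] us_def .
  then obtain ws where ws: "length ws = length (map Cst cs)" "set ws \<subseteq> D"
    "\<And>i. i < length (map Cst cs) \<Longrightarrow> S \<tturnstile> Eq (Var (ws ! i)) (map Cst cs ! i)"
    "S \<tturnstile> fsubst (Var \<circ> upds id us ws) (Inc us xs)"
    by (rule S_namedE) (use us assms in auto)
  have "fsubst (Var \<circ> upds id us ws) (Inc us xs) = (Inc ws xs :: ('c, 'f, 'r) fm)"
    unfolding fsubst_Var_Incl using us ws(1) assms(3)
    by (auto intro!: nth_equalityI simp: upds_nth) (metis disjoint_iff id_apply nth_mem upds_notin)
  then have "S \<tturnstile> Inc ws xs" using ws(4) by metis
  then show thesis using that[of ws] ws assms(3) by simp
qed

text \<open>Every element of the model has a name outside any given finite set \<open>Z\<close>. The inclusion atom in \<open>\<psi>\<close> is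
  trivially true; its purpose is to make the variables of \<open>Z\<close> free in \<open>\<psi>\<close>, so that the witness avoids them.\<close>

lemma S_variant:
  assumes "w \<in> D" "finite Z"
  obtains w' where "w' \<in> D" "w' \<notin> Z" "S \<tturnstile> Eq (Var w') (Var w)"
proof -
  obtain zs where zs: "set zs = Z" using assms(2) finite_list by blast
  obtain x where x: "x \<notin> insert w Z" using ex_new_if_finite[OF infinite_UNIV_nat, of "insert w Z"] assms(2) by auto
  define \<psi> :: "('c, 'f, 'r) fm" where "\<psi> = And (Eq (Var x) (Var w)) (Incl (map (\<lambda>z. (z, z)) zs))"
  have rep: "rep \<psi> [Var v] [x] = And (Eq (Var v) (Var w)) (Incl (map (\<lambda>z. (z, z)) zs))" for v
  proof -
    have "map (map_prod (id(x := v)) (id(x := v))) (map (\<lambda>z. (z, z)) zs) = map (\<lambda>z. (z, z)) zs"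
      using x zs by auto
    then show ?thesis using x unfolding sb_Var1 \<psi>_def fsubst.simps(1,5) fsubst_Var_Incl by simp
  qed
  have "S \<tturnstile> Exist1 x \<psi>"
  proof (rule der_exI)
    show "S \<tturnstile> rep \<psi> [Var w] [x]" unfolding rep by (intro der_andI der_eq_refl der_inc_refl)
    show "rep_ok \<psi> [Var w] [x]" by (rule rep_ok_Var) (simp add: \<psi>_def)
    show "S \<tturnstile> dep [Var w]" using assms(1) by (simp add: D_def)
  qed
  moreover have "\<psi> \<in> lang A B C" by (simp add: \<psi>_def)
  ultimately obtain w' where w': "w' \<in> D" "w' \<notin> fv \<psi> \<union> bv \<psi>" "S \<tturnstile> rep \<psi> [Var w'] [x]" by (rule S_exE)
  have "w' \<notin> Z" using w'(2) zs by (force simp: \<psi>_def)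
  then show thesis using that w' by (auto simp: rep der_and_iff)
qed

text \<open>The variables that the abbreviation quantifies over may coincide with members of \<open>ws\<close>, which
  therefore are replaced by variants first.\<close>

lemma S_incl_CstI:
  assumes "length ws = length xs" "set ws \<subseteq> D" "S \<tturnstile> Inc ws xs"
    "\<And>i. i < length xs \<Longrightarrow> S \<tturnstile> Eq (Var (ws ! i)) (Cst (cs ! i))"
    "distinct cs" "length cs = length xs"
  shows "S \<tturnstile> incl (zip (map Cst cs) (map Var xs))"
proof -
  define us where "us = fresh_vars (set xs) (length xs)"
  have us: "distinct us" "length us = length xs" "set us \<inter> set xs = {}"
    unfolding us_def by (simp_all add: fresh_vars)
  have "\<exists>w'. w' \<in> D \<and> w' \<notin> set us \<and> S \<tturnstile> Eq (Var w') (Var w)" if "w \<in> D" for w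
    using S_variant[OF that, of "set us"] by blast
  then obtain f where f: "\<And>w. w \<in> D \<Longrightarrow> f w \<in> D \<and> f w \<notin> set us \<and> S \<tturnstile> Eq (Var (f w)) (Var w)" by metis
  define vs where "vs = map f ws"
  have ws: "ws ! i \<in> D" if "i < length xs" for i using assms(1,2) that by auto
  have vs: "length vs = length xs" "set vs \<subseteq> D" "set vs \<inter> set us = {}"
    "\<And>i. i < length xs \<Longrightarrow> S \<tturnstile> Eq (Var (vs ! i)) (Var (ws ! i))"
    using f assms(1,2) ws by (auto simp: vs_def)
  have "S \<tturnstile> Inc vs xs"
    by (rule der_Inc_cong[OF _ _ _ assms(3)]) (use vs assms(1) der_eq_sym[OF vs(4)] in auto)
  moreover have "fsubst (Var \<circ> upds id us vs) (Inc us xs) = (Inc vs xs :: ('c, 'f, 'r) fm)"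
    unfolding fsubst_Var_Incl using us vs(1)
    by (auto intro!: nth_equalityI simp: upds_nth) (metis disjoint_iff id_apply nth_mem upds_notin)
  ultimately have "S \<tturnstile> fsubst (Var \<circ> upds id us vs) (Inc us xs)" by metis
  then have "S \<tturnstile> Exist1s us (conjs (map2 (\<lambda>u t. Eq (Var u) t) us (map Cst cs) @ [Inc us xs]))"
    using us vs assms(4,6) der_eq_trans[OF vs(4) assms(4)]
    by (intro S_namedI[where ws = vs]) (auto simp: assms(6) simp del: fsubst.simps)
  then show ?thesis unfolding incl_Cst[OF assms(5,6)] us_def .
qed

end

context henkin
begin

lemma S_underivable_atom:
  assumes "\<not> S \<tturnstile> l" "is_atom l" "l \<in> lang A B C"
  defines "xs \<equiv> sorted_list_of_set (fv l)"
  obtains cs where "distinct cs" "length cs = length xs" "set cs \<subseteq> A"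
    "S \<tturnstile> incl (zip (map Cst cs) (map Var xs))" "\<not> S \<tturnstile> rep l (map Cst cs) xs"
proof -
  have "S \<tturnstile> Neg l" using assms(1,3) by (simp add: S_neg)
  then have "Neg l \<in> S" using assms(3) by (simp add: S_iff)
  from conjunct1[OF conjunct2[OF S_wit[OF this, unfolded witnessed_def]]] assms(2)
  obtain cs where cs: "distinct cs" "length cs = card (fv l)" "set cs \<subseteq> P"
    "incl (zip (map Cst cs) (map Var xs)) \<in> S" "Neg (rep l (map Cst cs) xs) \<in> S"
    unfolding xs_def by blast
  have "\<not> S \<tturnstile> rep l (map Cst cs) xs" using der_negE[OF _ der_asm[OF cs(5)]] S_con by metis
  moreover have "length cs = length xs" using cs(2) by (simp add: xs_def)
  moreover have "set cs \<subseteq> A" using cs(3) P by simp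
  ultimately show thesis using that cs(1) der_asm[OF cs(4)] by metis
qed

lemma S_underivable_inc:
  assumes "\<not> S \<tturnstile> Inc xs ys" "length xs = length ys"
  obtains cs where "distinct cs" "length cs = length xs" "set cs \<subseteq> A"
    "S \<tturnstile> incl (zip (map Cst cs) (map Var xs))" "\<not> S \<tturnstile> incl (zip (map Cst cs) (map Var ys))"
proof -
  have "S \<tturnstile> Neg (Inc xs ys)" using assms(1) by (simp add: S_neg)
  then have "Neg (Inc xs ys) \<in> S" by (simp add: S_iff)
  from conjunct2[OF conjunct2[OF S_wit[OF this, unfolded witnessed_def]]]
  obtain cs where cs: "distinct cs" "length cs = length (zip xs ys)" "set cs \<subseteq> P"
    "incl (zip (map Cst cs) (map Var (map fst (zip xs ys)))) \<in> S"
    "Neg (incl (zip (map Cst cs) (map Var (map snd (zip xs ys))))) \<in> S" by blast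
  have xy: "map fst (zip xs ys) = xs" "map snd (zip xs ys) = ys" using assms(2) by simp_all
  have "\<not> S \<tturnstile> incl (zip (map Cst cs) (map Var ys))"
    using der_negE[OF _ der_asm[OF cs(5)]] S_con unfolding xy by metis
  moreover have "length cs = length xs" using cs(2) assms(2) by simp
  moreover have "set cs \<subseteq> A" using cs(3) P by simp
  ultimately show thesis using that cs(1) der_asm[OF cs(4)] unfolding xy by metis
qed

text \<open>A variable included in a constant one is equal to it: after \<open>d\<close> is adjoined on both sides, \<open>a\<close> and \<open>d\<close> are
  jointly included in \<open>d d\<close>.\<close>

lemma S_const_eq:
  assumes "S \<tturnstile> Incl [(a, d)]" "d \<in> D"
  shows "S \<tturnstile> Eq (Var a) (Var d)"
proof -
  have "S \<tturnstile> dep (map Var [d])" using assms(2) by (simp add: D_def)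
  then have "S \<tturnstile> Incl (map (\<lambda>w. (w, w)) [d] @ [(a, d)])" using assms(1) by (rule der_inc_dep)
  then have "S \<tturnstile> Incl [(a, d), (d, d)]" by (rule der_incl_mono) auto
  then show ?thesis by (rule der_pair_eq)
qed

lemma D_nonempty: "D \<noteq> {}"
proof -
  obtain c where c: "c \<in> A" using P by blast
  have "S \<tturnstile> dep (map Cst [c])" by (rule der_lift0[OF ded_dep_cst])
  then have "S \<tturnstile> dep [Cst c]" by simp
  then show ?thesis using S_depE[of "Cst c"] c by auto
qed

section \<open>The team described by a Henkin set\<close>

text \<open>The rows of the team, as assignments of witness variables. Setting \<open>\<delta>\<close> to the identity on \<open>D\<close> lets a row
  act on formulas in which some variables have already been replaced by witnesses; elsewhere the
  values are irrelevant.\<close>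

definition rows :: "(nat \<Rightarrow> nat) set" where
  "rows = {\<delta>. (\<forall>x. \<delta> x \<in> D) \<and> (\<forall>x\<in>D. \<delta> x = x) \<and> S \<tturnstile> Incl (map (\<lambda>x. (\<delta> x, x)) [0..<N])}"

lemma rows_D: "\<delta> \<in> rows \<Longrightarrow> \<delta> x \<in> D" "\<delta> \<in> rows \<Longrightarrow> x \<in> D \<Longrightarrow> \<delta> x = x"
  by (auto simp: rows_def)

lemma rows_incl:
  assumes "\<delta> \<in> rows" "set as \<subseteq> {..<N} \<union> D"
  shows "S \<tturnstile> Inc (map \<delta> as) as"
proof -
  define ws where "ws = filter (\<lambda>a. a \<in> D) as"
  have "S \<tturnstile> dep (map Var ws)" by (rule S_dep_Vars) (auto simp: ws_def)
  moreover have "S \<tturnstile> Incl (map (\<lambda>x. (\<delta> x, x)) [0..<N])" using assms(1) by (simp add: rows_def)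
  ultimately have "S \<tturnstile> Incl (map (\<lambda>w. (w, w)) ws @ map (\<lambda>x. (\<delta> x, x)) [0..<N])" by (rule der_inc_dep)
  then have "S \<tturnstile> Incl (map (\<lambda>x. (\<delta> x, x)) as)"
  proof (rule der_incl_mono)
    show "set (map (\<lambda>x. (\<delta> x, x)) as) \<subseteq> set (map (\<lambda>w. (w, w)) ws @ map (\<lambda>x. (\<delta> x, x)) [0..<N])"
      using assms rows_D(2)[OF assms(1)] by (auto simp: ws_def image_iff)
  qed
  moreover have "zip (map \<delta> as) as = map (\<lambda>x. (\<delta> x, x)) as"
    by (simp add: zip_map1 zip_same_conv_map)
  ultimately show ?thesis by simp
qed

text \<open>The rule for extending an inclusion atom by a quantified tuple gives \<open>zs us \<subseteq> 0 \<dots> N - 1 as\<close>, and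
  witnesses for \<open>zs\<close> form a row \<open>\<delta>\<close>. Where \<open>as\<close> has a variable below \<open>N\<close>, the member of \<open>us\<close> and the value of \<open>\<delta>\<close>
  are jointly included in that variable twice and hence equal; where \<open>as\<close> has a member of \<open>D\<close>, the
  member of \<open>us\<close> equals it because it is constant.\<close>

lemma rows_extend:
  assumes "S \<tturnstile> Inc us as" "length us = length as" "set us \<subseteq> D" "set as \<subseteq> {..<N} \<union> D"
  obtains \<delta> where "\<delta> \<in> rows" "\<And>i. i < length as \<Longrightarrow> S \<tturnstile> Eq (Var (us ! i)) (Var (\<delta> (as ! i)))"
proof -
  define zs where "zs = fresh_vars (set us \<union> set as \<union> {..<N}) N"
  have zs: "distinct zs" "length zs = N" "set zs \<inter> (set us \<union> set as \<union> {..<N}) = {}"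
    unfolding zs_def by (simp_all add: fresh_vars)
  have "S \<tturnstile> Exist1s zs (Inc (zs @ us) ([0..<N] @ as))"
    by (rule der_inc_ex[OF S_dep_Vars[OF assms(3)] assms(1)]) (use zs assms(2) in auto)
  then obtain ws where ws: "length ws = length zs" "set ws \<subseteq> D"
    "S \<tturnstile> fsubst (Var \<circ> upds id zs ws) (Inc (zs @ us) ([0..<N] @ as))"
    by (rule S_Exist1sE) (use zs in auto)
  let ?\<rho> = "upds id zs ws"
  have unmoved: "map ?\<rho> vs = vs" if "set vs \<inter> set zs = {}" for vs
    using that by (intro map_idI) (auto simp: disjoint_iff upds_notin)
  have \<rho>: "map ?\<rho> zs = ws" using zs(1) ws(1) by (rule map_upds)
  have \<rho>': "map ?\<rho> us = us" "map ?\<rho> as = as" "map ?\<rho> [0..<N] = [0..<N]"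
    by (rule unmoved, use zs(3) in auto)+
  have "map (map_prod ?\<rho> ?\<rho>) (zip (zs @ us) ([0..<N] @ as)) =
    zip (map ?\<rho> (zs @ us)) (map ?\<rho> ([0..<N] @ as))"
    by (simp only: zip_map_map map_prod_def)
  also have "\<dots> = zip (ws @ us) ([0..<N] @ as)" by (simp only: map_append \<rho> \<rho>')
  finally have "map (map_prod ?\<rho> ?\<rho>) (zip (zs @ us) ([0..<N] @ as)) = zip (ws @ us) ([0..<N] @ as)" .
  then have inc: "S \<tturnstile> Inc (ws @ us) ([0..<N] @ as)"
    using ws(3) unfolding fsubst_Var_Incl by metis
  obtain d0 where d0: "d0 \<in> D" using D_nonempty by blast
  have DN: "x \<notin> D" if "x < N" for x using that by (simp add: D_def)
  have wsD: "ws ! x \<in> D" if "x < N" for x using ws(1,2) zs(2) that by auto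
  define \<delta> where "\<delta> x = (if x \<in> D then x else if x < N then ws ! x else d0)" for x
  have zip: "zip (ws @ us) ([0..<N] @ as) = zip ws [0..<N] @ zip us as"
    using ws(1) zs(2) by simp
  have zip1: "zip ws [0..<N] = map (\<lambda>x. (\<delta> x, x)) [0..<N]"
    using ws(1) zs(2) DN by (auto intro!: nth_equalityI simp: \<delta>_def)
  have "S \<tturnstile> Incl (map (\<lambda>x. (\<delta> x, x)) [0..<N])"
    using inc unfolding zip zip1 by (rule der_incl_mono) auto
  then have "\<delta> \<in> rows" using d0 wsD by (auto simp: rows_def \<delta>_def)
  moreover have "S \<tturnstile> Eq (Var (us ! i)) (Var (\<delta> (as ! i)))" if i: "i < length as" for i
  proof (cases "as ! i \<in> D")
    case True
    have "(us ! i, as ! i) \<in> set (zip us as)" using i assms(2) by (auto simp: set_zip)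
    then have "S \<tturnstile> Incl [(us ! i, as ! i)]" using inc unfolding zip by (elim der_incl_mono) auto
    then show ?thesis using S_const_eq True by (simp add: \<delta>_def)
  next
    case False
    have "as ! i \<in> set as" using i by simp
    then have lt: "as ! i < N" using assms(4) False by auto
    have "(us ! i, as ! i) \<in> set (zip us as)" using i assms(2) by (auto simp: set_zip)
    then have "S \<tturnstile> Incl [(us ! i, as ! i), (\<delta> (as ! i), as ! i)]"
      using inc lt unfolding zip zip1 by (elim der_incl_mono) auto
    then show ?thesis by (rule der_pair_eq)
  qed
  ultimately show thesis by (rule that)
qed

lemma rows_nonempty: "rows \<noteq> {}"
proof -
  have "S \<tturnstile> Incl (map (\<lambda>x. (x, x)) [])" by (rule der_inc_refl)
  then show ?thesis using rows_extend[of "[]" "[]"] by auto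
qed

text \<open>The domain is closed under the function symbols: the value of a function at constant arguments is
  constant, and a constancy atom provides a witness variable for it.\<close>

lemma S_term:
  assumes "\<And>x. \<eta> x \<in> D"
  shows "t \<in> tlang A B \<Longrightarrow> \<exists>w\<in>D. S \<tturnstile> Eq (Var w) (tsubst (Var \<circ> \<eta>) t)"
proof (induction t)
  case (Var x)
  then show ?case using assms by (auto intro: der_eq_refl)
next
  case (Cst c)
  have "S \<tturnstile> dep (map Cst [c])" by (rule der_lift0[OF ded_dep_cst])
  then have "S \<tturnstile> dep [Cst c]" by simp
  then show ?case using Cst S_depE[of "Cst c"] by auto
next
  case (Fn f ts)
  have "\<exists>w. w \<in> D \<and> S \<tturnstile> Eq (Var w) (tsubst (Var \<circ> \<eta>) t)" if "t \<in> set ts" for t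
  proof -
    have "t \<in> tlang A B" using Fn(2) that by auto
    from Fn(1)[OF that this] show ?thesis by blast
  qed
  then obtain g where g: "\<And>t. t \<in> set ts \<Longrightarrow> g t \<in> D \<and> S \<tturnstile> Eq (Var (g t)) (tsubst (Var \<circ> \<eta>) t)" by metis
  have "S \<tturnstile> dep (map Var (map g ts))" by (rule S_dep_Vars) (use g in auto)
  with ded_dep_fn have "S \<tturnstile> dep [Fn f (map Var (map g ts))]" by (rule der_lift1)
  moreover have "Fn f (map Var (map g ts)) \<in> tlang A B" using Fn(2) by auto
  ultimately obtain w where w: "w \<in> D" "S \<tturnstile> Eq (Var w) (Fn f (map Var (map g ts)))" by (rule S_depE)
  have "S \<tturnstile> Eq (Fn f (map Var (map g ts))) (Fn f (map (tsubst (Var \<circ> \<eta>)) ts))"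
    by (rule der_Fn_cong) (use g in auto)
  with w(2) have "S \<tturnstile> Eq (Var w) (Fn f (map (tsubst (Var \<circ> \<eta>)) ts))" by (rule der_eq_trans)
  then show ?case unfolding tsubst.simps using w(1) by (rule bexI)
qed

end

section \<open>The canonical model\<close>

text \<open>The embedding \<open>e\<close> moves the model from the variables into the given infinite universe.\<close>

locale henkin_model = henkin S A B C P N
  for S :: "('c, 'f, 'r) fm set" and A B C P N +
  fixes e :: "nat \<Rightarrow> 'u"
  assumes e: "inj e"
begin

definition class_rep :: "nat \<Rightarrow> nat" where
  "class_rep w = (LEAST w'. w' \<in> D \<and> S \<tturnstile> Eq (Var w) (Var w'))"

definition h :: "nat \<Rightarrow> 'u" where
  "h w = e (class_rep w)"

lemma h_eq_iff:
  assumes "w \<in> D" "w' \<in> D"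
  shows "h w = h w' \<longleftrightarrow> S \<tturnstile> Eq (Var w) (Var w')"
proof
  have class_rep: "S \<tturnstile> Eq (Var v) (Var (class_rep v))" if "v \<in> D" for v
    using LeastI[of "\<lambda>v'. v' \<in> D \<and> S \<tturnstile> Eq (Var v) (Var v')" v] that unfolding class_rep_def by (simp add: der_eq_refl)
  assume "h w = h w'"
  then have "class_rep w = class_rep w'" using e by (simp add: h_def inj_eq)
  then show "S \<tturnstile> Eq (Var w) (Var w')" using class_rep[OF assms(1)] class_rep[OF assms(2)] der_eq_sym der_eq_trans by metis
next
  assume "S \<tturnstile> Eq (Var w) (Var w')"
  then have "(S \<tturnstile> Eq (Var w) (Var v)) = (S \<tturnstile> Eq (Var w') (Var v))" for v
    using der_eq_sym der_eq_trans by metis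
  then show "h w = h w'" by (simp add: h_def class_rep_def)
qed

lemma map_h_eqD:
  assumes "map h ws = map h ws'" "set ws \<subseteq> D" "set ws' \<subseteq> D"
  shows "length ws = length ws'" "i < length ws \<Longrightarrow> S \<tturnstile> Eq (Var (ws ! i)) (Var (ws' ! i))"
proof -
  show len: "length ws = length ws'" using assms(1) by (rule map_eq_imp_length_eq)
  assume i: "i < length ws"
  then have "h (ws ! i) = h (ws' ! i)" using assms(1) len by (metis nth_map)
  moreover have "ws ! i \<in> D" "ws' ! i \<in> D" using assms(2,3) i len by auto
  ultimately show "S \<tturnstile> Eq (Var (ws ! i)) (Var (ws' ! i))" by (simp add: h_eq_iff)
qed

text \<open>The element determined by \<open>Q\<close>. A default value is needed for symbols outside the language, whose
  values need not be named by a variable.\<close>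

definition pick :: "(nat \<Rightarrow> bool) \<Rightarrow> 'u" where
  "pick Q = (if \<exists>w\<in>D. Q w then h (SOME w. w \<in> D \<and> Q w) else h (SOME w. w \<in> D))"

lemma pick_in: "pick Q \<in> h ` D"
proof -
  have "(SOME w. w \<in> D) \<in> D" using D_nonempty by (simp add: some_in_eq)
  moreover have "(SOME w. w \<in> D \<and> Q w) \<in> D" if "\<exists>w\<in>D. Q w"
    using someI_ex[of "\<lambda>w. w \<in> D \<and> Q w"] that by blast
  ultimately show ?thesis by (auto simp: pick_def)
qed

lemma pick_eq:
  assumes "w \<in> D" "Q w" "\<And>w'. w' \<in> D \<Longrightarrow> Q w' \<Longrightarrow> S \<tturnstile> Eq (Var w) (Var w')"
  shows "pick Q = h w"
proof -
  have "(SOME w. w \<in> D \<and> Q w) \<in> D \<and> Q (SOME w. w \<in> D \<and> Q w)"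
    using someI_ex[of "\<lambda>w. w \<in> D \<and> Q w"] assms(1,2) by blast
  then have "h w = h (SOME w. w \<in> D \<and> Q w)" using assms(1,3) by (simp add: h_eq_iff)
  moreover have "\<exists>w\<in>D. Q w" using assms(1,2) by blast
  ultimately show ?thesis by (simp add: pick_def)
qed

definition M :: "('c, 'f, 'r, 'u) model" where
  "M = \<lparr>carrier = h ` D,
    cst = (\<lambda>c. pick (\<lambda>w. S \<tturnstile> Eq (Var w) (Cst c))),
    fun_of = (\<lambda>f as. pick (\<lambda>w. \<exists>ws. set ws \<subseteq> D \<and> as = map h ws \<and> S \<tturnstile> Eq (Var w) (Fn f (map Var ws)))),
    rel_of = (\<lambda>r as. \<exists>ws. set ws \<subseteq> D \<and> as = map h ws \<and> S \<tturnstile> Rel r (map Var ws))\<rparr>"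

lemma M_simps [simp]:
  "carrier M = h ` D"
  "cst M c = pick (\<lambda>w. S \<tturnstile> Eq (Var w) (Cst c))"
  "fun_of M f as = pick (\<lambda>w. \<exists>ws. set ws \<subseteq> D \<and> as = map h ws \<and> S \<tturnstile> Eq (Var w) (Fn f (map Var ws)))"
  "rel_of M r as \<longleftrightarrow> (\<exists>ws. set ws \<subseteq> D \<and> as = map h ws \<and> S \<tturnstile> Rel r (map Var ws))"
  by (simp_all add: M_def)

lemma fo_structure_M: "fo_structure M"
  using D_nonempty by (auto simp: fo_structure_def pick_in)

lemma tval_M:
  assumes \<eta>: "\<And>x. \<eta> x \<in> D"
  shows "t \<in> tlang A B \<Longrightarrow> w \<in> D \<Longrightarrow> S \<tturnstile> Eq (Var w) (tsubst (Var \<circ> \<eta>) t) \<Longrightarrow> tval M (h \<circ> \<eta>) t = h w"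
proof (induction t arbitrary: w)
  case (Var x)
  then have "h w = h (\<eta> x)" using \<eta> by (simp add: h_eq_iff)
  then show ?case by simp
next
  case (Cst c)
  then have "S \<tturnstile> Eq (Var w) (Cst c)" by simp
  moreover have "S \<tturnstile> Eq (Var w) (Var w')" if "S \<tturnstile> Eq (Var w') (Cst c)" for w'
    using calculation der_eq_sym[OF that] by (rule der_eq_trans)
  ultimately show ?case using Cst(2) unfolding tval.simps M_simps by (intro pick_eq) auto
next
  case (Fn f ts)
  have "\<exists>w. w \<in> D \<and> S \<tturnstile> Eq (Var w) (tsubst (Var \<circ> \<eta>) t)" if "t \<in> set ts" for t
  proof -
    have "t \<in> tlang A B" using Fn(2) that by auto
    from S_term[of \<eta>, OF \<eta> this] show ?thesis by blast
  qed
  then obtain g where g: "\<And>t. t \<in> set ts \<Longrightarrow> g t \<in> D \<and> S \<tturnstile> Eq (Var (g t)) (tsubst (Var \<circ> \<eta>) t)" by metis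
  define ws where "ws = map g ts"
  have g': "S \<tturnstile> Eq (tsubst (Var \<circ> \<eta>) t) (Var (g t))" if "t \<in> set ts" for t
    using g[OF that] der_eq_sym by blast
  have ws: "set ws \<subseteq> D" using g by (auto simp: ws_def)
  have "tval M (h \<circ> \<eta>) t = h (g t)" if "t \<in> set ts" for t
  proof -
    have "t \<in> tlang A B" using Fn(2) that by auto
    then show ?thesis using g[OF that] by (intro Fn(1)[OF that]) blast+
  qed
  then have m: "map (tval M (h \<circ> \<eta>)) ts = map h ws" by (simp add: ws_def)
  have fn: "S \<tturnstile> Eq (Fn f (map (tsubst (Var \<circ> \<eta>)) ts)) (Fn f (map Var ws))"
    by (rule der_Fn_cong) (use g' in \<open>auto simp: ws_def\<close>)
  have w: "S \<tturnstile> Eq (Var w) (Fn f (map Var ws))"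
    by (rule der_eq_trans[OF Fn(4)[unfolded tsubst.simps] fn])
  show ?case
    unfolding tval.simps M_simps m
  proof (rule pick_eq[OF Fn(3)])
    show "\<exists>ws'. set ws' \<subseteq> D \<and> map h ws = map h ws' \<and> S \<tturnstile> Eq (Var w) (Fn f (map Var ws'))"
      using ws w by blast
    fix w' assume "\<exists>ws'. set ws' \<subseteq> D \<and> map h ws = map h ws' \<and> S \<tturnstile> Eq (Var w') (Fn f (map Var ws'))"
    then obtain ws' where ws': "set ws' \<subseteq> D" "map h ws = map h ws'" "S \<tturnstile> Eq (Var w') (Fn f (map Var ws'))" by blast
    have "S \<tturnstile> Eq (Fn f (map Var ws)) (Fn f (map Var ws'))"
      by (rule der_Fn_cong) (use map_h_eqD[OF ws'(2) ws ws'(1)] in auto)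
    then show "S \<tturnstile> Eq (Var w) (Var w')" using w ws'(3) der_eq_sym der_eq_trans by metis
  qed
qed

lemma sat_M_atom:
  assumes "is_atom \<psi>" "\<psi> \<in> lang A B C" and \<eta>: "\<And>x. \<eta> x \<in> D"
  shows "S \<tturnstile> fsubst (Var \<circ> \<eta>) \<psi> \<longleftrightarrow> sat M {h \<circ> \<eta>} \<psi>"
proof (cases \<psi>)
  case (Eq t t')
  then have l: "t \<in> tlang A B" "t' \<in> tlang A B" using assms(2) by auto
  obtain w where w: "w \<in> D" "S \<tturnstile> Eq (Var w) (tsubst (Var \<circ> \<eta>) t)" using S_term[of \<eta>, OF \<eta> l(1)] by blast
  obtain w' where w': "w' \<in> D" "S \<tturnstile> Eq (Var w') (tsubst (Var \<circ> \<eta>) t')" using S_term[of \<eta>, OF \<eta> l(2)] by blast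
  have "S \<tturnstile> Eq (tsubst (Var \<circ> \<eta>) t) (tsubst (Var \<circ> \<eta>) t') \<longleftrightarrow> S \<tturnstile> Eq (Var w) (Var w')"
    using w(2) w'(2) der_eq_sym der_eq_trans by metis
  also have "\<dots> \<longleftrightarrow> tval M (h \<circ> \<eta>) t = tval M (h \<circ> \<eta>) t'"
    using tval_M[of \<eta>, OF \<eta> l(1) w] tval_M[of \<eta>, OF \<eta> l(2) w'] h_eq_iff[OF w(1) w'(1)] by simp
  finally show ?thesis unfolding Eq by simp
next
  case (Rel r ts)
  then have l: "set ts \<subseteq> tlang A B" using assms(2) by auto
  have "\<exists>w. w \<in> D \<and> S \<tturnstile> Eq (Var w) (tsubst (Var \<circ> \<eta>) t)" if "t \<in> set ts" for t
  proof -
    have "t \<in> tlang A B" using l that by auto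
    from S_term[of \<eta>, OF \<eta> this] show ?thesis by blast
  qed
  then obtain g where g: "\<And>t. t \<in> set ts \<Longrightarrow> g t \<in> D \<and> S \<tturnstile> Eq (Var (g t)) (tsubst (Var \<circ> \<eta>) t)" by metis
  define ws where "ws = map g ts"
  have g': "S \<tturnstile> Eq (tsubst (Var \<circ> \<eta>) t) (Var (g t))" if "t \<in> set ts" for t
    using g[OF that] der_eq_sym by blast
  have ws: "set ws \<subseteq> D" using g by (auto simp: ws_def)
  have "tval M (h \<circ> \<eta>) t = h (g t)" if "t \<in> set ts" for t
  proof -
    have "t \<in> tlang A B" using l that by auto
    then show ?thesis using g[OF that] by (intro tval_M \<eta>) blast+
  qed
  then have m: "map (tval M (h \<circ> \<eta>)) ts = map h ws" by (simp add: ws_def)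
  have "S \<tturnstile> Rel r (map (tsubst (Var \<circ> \<eta>)) ts) \<longleftrightarrow> S \<tturnstile> Rel r (map Var ws)"
  proof
    assume "S \<tturnstile> Rel r (map (tsubst (Var \<circ> \<eta>)) ts)"
    then show "S \<tturnstile> Rel r (map Var ws)"
      by (rule der_Rel_cong[rotated 2]) (use g' in \<open>auto simp: ws_def\<close>)
  next
    assume "S \<tturnstile> Rel r (map Var ws)"
    then show "S \<tturnstile> Rel r (map (tsubst (Var \<circ> \<eta>)) ts)"
      by (rule der_Rel_cong[rotated 2]) (use g in \<open>auto simp: ws_def\<close>)
  qed
  also have "\<dots> \<longleftrightarrow> rel_of M r (map h ws)"
  proof
    show "S \<tturnstile> Rel r (map Var ws) \<Longrightarrow> rel_of M r (map h ws)" using ws by auto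
    assume "rel_of M r (map h ws)"
    then obtain ws' where ws': "set ws' \<subseteq> D" "map h ws' = map h ws" "S \<tturnstile> Rel r (map Var ws')"
      unfolding M_simps by metis
    show "S \<tturnstile> Rel r (map Var ws)"
      by (rule der_Rel_cong[OF _ _ ws'(3)]) (use map_h_eqD[OF ws'(2,1) ws] in auto)
  qed
  finally show ?thesis using m by (simp add: Rel del: M_simps)
qed (use assms(1) in auto)

text \<open>From left to right, the value of \<open>as\<close> at a row is a tuple included in \<open>bs\<close>, which extends to a row. From
  right to left, if \<open>as \<subseteq> bs\<close> failed, its witness would be a tuple included in \<open>as\<close>, hence the value of \<open>as\<close> at
  some row; by assumption it is the value of \<open>bs\<close> at some row, hence included in \<open>bs\<close>.\<close>

lemma S_incl_iff:
  assumes "length as = length bs" "set as \<subseteq> {..<N} \<union> D" "set bs \<subseteq> {..<N} \<union> D"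
  shows "S \<tturnstile> Inc as bs \<longleftrightarrow> (\<forall>\<delta>\<in>rows. \<exists>\<delta>'\<in>rows. map (h \<circ> \<delta>) as = map (h \<circ> \<delta>') bs)"
proof
  assume inc: "S \<tturnstile> Inc as bs"
  show "\<forall>\<delta>\<in>rows. \<exists>\<delta>'\<in>rows. map (h \<circ> \<delta>) as = map (h \<circ> \<delta>') bs"
  proof
    fix \<delta> assume \<delta>: "\<delta> \<in> rows"
    have "S \<tturnstile> Inc (map \<delta> as) bs"
      using rows_incl[OF \<delta> assms(2)] inc by (rule der_inc_trans) (use assms(1) in auto)
    then obtain \<delta>' where \<delta>': "\<delta>' \<in> rows"
      "\<And>i. i < length bs \<Longrightarrow> S \<tturnstile> Eq (Var (map \<delta> as ! i)) (Var (\<delta>' (bs ! i)))"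
      by (rule rows_extend) (use assms rows_D(1)[OF \<delta>] in auto)
    have "map (h \<circ> \<delta>) as = map (h \<circ> \<delta>') bs"
      using assms(1) \<delta>' rows_D(1)[OF \<delta>] rows_D(1)[OF \<delta>'(1)] by (intro nth_equalityI) (auto simp: h_eq_iff)
    then show "\<exists>\<delta>'\<in>rows. map (h \<circ> \<delta>) as = map (h \<circ> \<delta>') bs" using \<delta>'(1) by blast
  qed
next
  assume team: "\<forall>\<delta>\<in>rows. \<exists>\<delta>'\<in>rows. map (h \<circ> \<delta>) as = map (h \<circ> \<delta>') bs"
  show "S \<tturnstile> Inc as bs"
  proof (rule ccontr)
    assume "\<not> S \<tturnstile> Inc as bs"
    then obtain cs where cs: "distinct cs" "length cs = length as" "set cs \<subseteq> A"
      "S \<tturnstile> incl (zip (map Cst cs) (map Var as))" "\<not> S \<tturnstile> incl (zip (map Cst cs) (map Var bs))"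
      using assms(1) by (rule S_underivable_inc)
    obtain ws where ws: "length ws = length as" "set ws \<subseteq> D" "S \<tturnstile> Inc ws as"
      "\<And>i. i < length as \<Longrightarrow> S \<tturnstile> Eq (Var (ws ! i)) (Cst (cs ! i))"
      using S_incl_CstE[OF cs(4,1-3)] by blast
    obtain \<delta> where \<delta>: "\<delta> \<in> rows" "\<And>i. i < length as \<Longrightarrow> S \<tturnstile> Eq (Var (ws ! i)) (Var (\<delta> (as ! i)))"
      using rows_extend[OF ws(3,1,2) assms(2)] by blast
    obtain \<delta>' where \<delta>': "\<delta>' \<in> rows" "map (h \<circ> \<delta>) as = map (h \<circ> \<delta>') bs" using team \<delta>(1) by blast
    have "S \<tturnstile> Eq (Var (\<delta>' (bs ! i))) (Var (ws ! i))" if i: "i < length as" for i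
    proof -
      have "(h \<circ> \<delta>) (as ! i) = (h \<circ> \<delta>') (bs ! i)" using \<delta>'(2) assms(1) i by (metis nth_map)
      then have "S \<tturnstile> Eq (Var (\<delta> (as ! i))) (Var (\<delta>' (bs ! i)))"
        using h_eq_iff rows_D(1)[OF \<delta>(1)] rows_D(1)[OF \<delta>'(1)] by simp
      then show ?thesis using \<delta>(2)[OF i] der_eq_sym der_eq_trans by metis
    qed
    then have "S \<tturnstile> Inc ws bs"
      by (intro der_Inc_cong[OF _ _ _ rows_incl[OF \<delta>'(1) assms(3)]]) (simp_all add: assms(1) ws(1))
    then have "S \<tturnstile> incl (zip (map Cst cs) (map Var bs))"
      using S_incl_CstI[of ws bs cs] ws(1,2,4) cs(1,2) assms(1) by simp
    then show False using cs(5) by simp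
  qed
qed

text \<open>A first-order atom holds iff it holds at each row. This is flatness on the side of derivations.\<close>

lemma S_atom_iff:
  assumes \<alpha>: "is_atom \<alpha>" "\<alpha> \<in> lang A B C" "fv \<alpha> \<subseteq> {..<N} \<union> D"
  shows "S \<tturnstile> \<alpha> \<longleftrightarrow> (\<forall>\<delta>\<in>rows. S \<tturnstile> fsubst (Var \<circ> \<delta>) \<alpha>)"
proof
  define xs where "xs = sorted_list_of_set (fv \<alpha>)"
  have xs: "distinct xs" "set xs = fv \<alpha>" "length xs = card (fv \<alpha>)" by (auto simp: xs_def)
  have sb: "fsubst (sb (map f xs) xs) \<alpha> = fsubst f \<alpha>" for f
    using xs(2) by (intro fsubst_cong) (auto simp: sb_def map_of_zip_map)
  {
    assume S: "S \<tturnstile> \<alpha>"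
    show "\<forall>\<delta>\<in>rows. S \<tturnstile> fsubst (Var \<circ> \<delta>) \<alpha>"
    proof
      fix \<delta> assume \<delta>: "\<delta> \<in> rows"
      have "S \<tturnstile> Inc (map \<delta> xs) xs" using rows_incl[OF \<delta>] xs(2) \<alpha>(3) by simp
      moreover have "S \<tturnstile> rep \<alpha> (map Var xs) xs" using S unfolding sb fsubst_Var .
      ultimately have "S \<tturnstile> rep \<alpha> (map Var (map \<delta> xs)) xs"
      proof (rule der_lift2[rotated])
        show "\<Delta> \<turnstile> rep \<alpha> (map Var (map \<delta> xs)) xs"
          if "\<Delta> \<turnstile> Inc (map \<delta> xs) xs" "\<Delta> \<turnstile> rep \<alpha> (map Var xs) xs" for \<Delta>
          by (rule ded_inc_subst[OF that])
            (use xs \<alpha>(1) in \<open>auto intro: substitutable_atom simp del: map_map, (cases \<alpha>; simp)+\<close>)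
      qed
      then show "S \<tturnstile> fsubst (Var \<circ> \<delta>) \<alpha>" unfolding map_map sb .
    qed
  }
  assume team: "\<forall>\<delta>\<in>rows. S \<tturnstile> fsubst (Var \<circ> \<delta>) \<alpha>"
  show "S \<tturnstile> \<alpha>"
  proof (rule ccontr)
    assume "\<not> S \<tturnstile> \<alpha>"
    then obtain cs where cs: "distinct cs" "length cs = length xs" "set cs \<subseteq> A"
      "S \<tturnstile> incl (zip (map Cst cs) (map Var xs))" "\<not> S \<tturnstile> rep \<alpha> (map Cst cs) xs"
      using \<alpha>(1,2) unfolding xs_def by (rule S_underivable_atom)
    obtain ws where ws: "length ws = length xs" "set ws \<subseteq> D" "S \<tturnstile> Inc ws xs"
      "\<And>i. i < length xs \<Longrightarrow> S \<tturnstile> Eq (Var (ws ! i)) (Cst (cs ! i))"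
      using S_incl_CstE[OF cs(4,1-3)] by blast
    obtain \<delta> where \<delta>: "\<delta> \<in> rows" "\<And>i. i < length xs \<Longrightarrow> S \<tturnstile> Eq (Var (ws ! i)) (Var (\<delta> (xs ! i)))"
      using rows_extend[OF ws(3,1,2)] xs(2) \<alpha>(3) by blast
    have "S \<tturnstile> fsubst (sb (map Cst cs) xs) \<alpha>"
    proof (rule der_cong)
      show "S \<tturnstile> fsubst (Var \<circ> \<delta>) \<alpha>" using team \<delta>(1) by blast
      fix x assume "x \<in> fv \<alpha>"
      then obtain i where i: "i < length xs" "x = xs ! i" using xs(2) by (metis in_set_conv_nth)
      then have "sb (map Cst cs) xs x = (Cst (cs ! i) :: ('c, 'f) tm)"
        using xs(1) cs(2) by (simp add: sb_upds upds_nth)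
      moreover have "S \<tturnstile> Eq (Var (\<delta> (xs ! i))) (Cst (cs ! i))"
        by (rule der_eq_trans[OF der_eq_sym[OF \<delta>(2)[OF i(1)]] ws(4)[OF i(1)]])
      ultimately show "S \<tturnstile> Eq ((Var \<circ> \<delta>) x) (sb (map Cst cs) xs x)" by (simp add: i(2))
    qed (use \<alpha>(1) in simp)
    then show False using cs(5) by simp
  qed
qed

lemma sat_atom_iff: "is_atom \<psi> \<Longrightarrow> sat K (F ` I) \<psi> \<longleftrightarrow> (\<forall>i\<in>I. sat K {F i} \<psi>)"
  by (cases \<psi>) auto

lemma fv_atom_fsubst_Var:
  fixes \<psi> :: "('c, 'f, 'r) fm"
  assumes "is_atom \<psi>"
  shows "fv (fsubst (Var \<circ> \<rho>) \<psi>) = \<rho> ` fv \<psi>"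
proof -
  have t: "tfv (tsubst (Var \<circ> \<rho>) t) = \<rho> ` tfv t" for t :: "('c, 'f) tm" by (induction t) auto
  show ?thesis
  proof (cases \<psi>)
    case (Eq s t)
    then show ?thesis by (simp only: fsubst.simps fv.simps t image_Un)
  next
    case (Rel r ts)
    then show ?thesis by (simp only: fsubst.simps fv.simps set_map image_image t image_UN)
  qed (use \<open>is_atom \<psi>\<close> in auto)
qed

lemma fsubst_inst:
  assumes "bv \<psi> \<subseteq> {..<N}" "x < N" "\<And>y. \<rho> y = y \<or> N \<le> \<rho> y"
  shows "fsubst (Var \<circ> id(x := w)) (fsubst (Var \<circ> \<rho>(x := x)) \<psi>) = fsubst (Var \<circ> \<rho>(x := w)) \<psi>"
proof -
  have "id(x := w) \<circ> \<rho>(x := x) = \<rho>(x := w)"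
  proof
    fix y
    show "(id(x := w) \<circ> \<rho>(x := x)) y = (\<rho>(x := w)) y" using assms(2) assms(3)[of y] by auto
  qed
  then show ?thesis using fsubst_comp[OF assms(1), of "\<rho>(x := x)" "id(x := w)"] assms(3) by auto
qed

text \<open>The renaming \<open>\<rho>\<close> records the witnesses substituted for quantified variables so far. Speaking about
  \<open>\<psi>\<close> under all such renamings, rather than about the instances of \<open>\<psi>\<close>, keeps the induction structural.\<close>

theorem truth_lemma:
  assumes "\<psi> \<in> lang A B C" "fv \<psi> \<union> bv \<psi> \<subseteq> {..<N}" "\<And>x. \<rho> x = x \<or> \<rho> x \<in> D"
  shows "S \<tturnstile> fsubst (Var \<circ> \<rho>) \<psi> \<longleftrightarrow> sat M ((\<lambda>\<delta>. h \<circ> \<delta> \<circ> \<rho>) ` rows) \<psi>"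
proof -
  have atom: "S \<tturnstile> fsubst (Var \<circ> \<rho>) \<psi> \<longleftrightarrow> sat M ((\<lambda>\<delta>. h \<circ> \<delta> \<circ> \<rho>) ` rows) \<psi>"
    if \<psi>: "is_atom \<psi>" "\<psi> \<in> lang A B C" "fv \<psi> \<subseteq> {..<N}" "\<And>x. \<rho> x = x \<or> \<rho> x \<in> D" for \<psi> \<rho>
  proof -
    let ?\<alpha> = "fsubst (Var \<circ> \<rho>) \<psi>"
    have "\<rho> ` fv \<psi> \<subseteq> {..<N} \<union> D"
    proof
      fix y assume "y \<in> \<rho> ` fv \<psi>"
      then obtain x where "x \<in> fv \<psi>" "y = \<rho> x" by blast
      then show "y \<in> {..<N} \<union> D" using \<psi>(3) \<psi>(4)[of x] by auto
    qed
    then have "S \<tturnstile> ?\<alpha> \<longleftrightarrow> (\<forall>\<delta>\<in>rows. S \<tturnstile> fsubst (Var \<circ> \<delta>) ?\<alpha>)"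
      using \<psi> by (intro S_atom_iff) (auto intro: is_atom_fsubst lang_rep_Var simp: fv_atom_fsubst_Var)
    also have "\<dots> \<longleftrightarrow> (\<forall>\<delta>\<in>rows. S \<tturnstile> fsubst (Var \<circ> (\<delta> \<circ> \<rho>)) \<psi>)"
      using fsubst_comp_qf_Var[OF bv_atom[OF \<psi>(1)]] by metis
    also have "\<dots> \<longleftrightarrow> (\<forall>\<delta>\<in>rows. sat M {h \<circ> (\<delta> \<circ> \<rho>)} \<psi>)"
      using \<psi> rows_D(1) by (intro ball_cong refl sat_M_atom) auto
    also have "\<dots> \<longleftrightarrow> sat M ((\<lambda>\<delta>. h \<circ> \<delta> \<circ> \<rho>) ` rows) \<psi>"
      unfolding sat_atom_iff[OF \<psi>(1)] by (simp add: comp_assoc)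
    finally show ?thesis .
  qed
  have quantifier: "S \<tturnstile> rep (fsubst (Var \<circ> \<rho>(x := x)) \<psi>) [Var w] [x] \<longleftrightarrow>
      sat M (team_upd ((\<lambda>\<delta>. h \<circ> \<delta> \<circ> \<rho>) ` rows) x (h w)) \<psi>"
    if "w \<in> D" "x < N" "bv \<psi> \<subseteq> {..<N}" "\<And>x. \<rho> x = x \<or> \<rho> x \<in> D"
      and IH: "S \<tturnstile> fsubst (Var \<circ> \<rho>(x := w)) \<psi> \<longleftrightarrow> sat M ((\<lambda>\<delta>. h \<circ> \<delta> \<circ> \<rho>(x := w)) ` rows) \<psi>"
    for \<psi> \<rho> x w
  proof -
    have "rep (fsubst (Var \<circ> \<rho>(x := x)) \<psi>) [Var w] [x] = fsubst (Var \<circ> \<rho>(x := w)) \<psi>"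
      unfolding sb_Var1
    proof (rule fsubst_inst[OF that(3,2)])
      show "\<rho> y = y \<or> N \<le> \<rho> y" for y using that(4)[of y] by (auto simp: D_def)
    qed
    moreover have "(\<lambda>\<delta>. h \<circ> \<delta> \<circ> \<rho>(x := w)) ` rows = team_upd ((\<lambda>\<delta>. h \<circ> \<delta> \<circ> \<rho>) ` rows) x (h w)"
      unfolding team_upd_image
    proof (rule image_cong[OF refl])
      fix \<delta> assume "\<delta> \<in> rows"
      from rows_D(2)[OF this that(1)] show "h \<circ> \<delta> \<circ> \<rho>(x := w) = (h \<circ> \<delta> \<circ> \<rho>)(x := h w)"
        by (simp add: fun_eq_iff)
    qed
    ultimately show ?thesis using IH by metis
  qed
  show ?thesis
    using assms
  proof (induction \<psi> arbitrary: \<rho>)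
    case (Eq t t')
    show ?case by (rule atom) (use Eq in auto)
  next
    case (Rel r ts)
    show ?case by (rule atom) (use Rel in auto)
  next
    case (Incl ps)
    let ?as = "map (\<rho> \<circ> fst) ps" and ?bs = "map (\<rho> \<circ> snd) ps"
    have *: "\<rho> x \<in> {..<N} \<union> D" if "x < N" for x using Incl(3)[of x] that by auto
    have "set ?as \<subseteq> {..<N} \<union> D" "set ?bs \<subseteq> {..<N} \<union> D" using Incl(2) by (auto intro!: *)
    then have "S \<tturnstile> Inc ?as ?bs \<longleftrightarrow> (\<forall>\<delta>\<in>rows. \<exists>\<delta>'\<in>rows. map (h \<circ> \<delta>) ?as = map (h \<circ> \<delta>') ?bs)"
      by (intro S_incl_iff) auto
    moreover have "map (map_prod \<rho> \<rho>) ps = zip ?as ?bs" by (induction ps) auto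
    ultimately show ?case unfolding fsubst_Var_Incl by (simp add: comp_assoc)
  next
    case (Neg \<psi>)
    have "S \<tturnstile> fsubst (Var \<circ> \<rho>) \<psi> \<longleftrightarrow> sat M ((\<lambda>\<delta>. h \<circ> \<delta> \<circ> \<rho>) ` rows) \<psi>" by (rule Neg(1)) (use Neg(2-) in auto)
    moreover have "fsubst (Var \<circ> \<rho>) \<psi> \<in> lang A B C" using Neg(2) by (intro lang_rep_Var) simp
    ultimately show ?case unfolding fsubst.simps sat.simps using S_neg rows_nonempty by simp
  next
    case (And \<psi> \<chi>)
    have "S \<tturnstile> fsubst (Var \<circ> \<rho>) \<psi> \<longleftrightarrow> sat M ((\<lambda>\<delta>. h \<circ> \<delta> \<circ> \<rho>) ` rows) \<psi>" by (rule And(1)) (use And(3-) in auto)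
    moreover have "S \<tturnstile> fsubst (Var \<circ> \<rho>) \<chi> \<longleftrightarrow> sat M ((\<lambda>\<delta>. h \<circ> \<delta> \<circ> \<rho>) ` rows) \<chi>" by (rule And(2)) (use And(3-) in auto)
    ultimately show ?case unfolding fsubst.simps sat.simps der_and_iff by blast
  next
    case (Or1 \<psi> \<chi>)
    have "S \<tturnstile> fsubst (Var \<circ> \<rho>) \<psi> \<longleftrightarrow> sat M ((\<lambda>\<delta>. h \<circ> \<delta> \<circ> \<rho>) ` rows) \<psi>" by (rule Or1(1)) (use Or1(3-) in auto)
    moreover have "S \<tturnstile> fsubst (Var \<circ> \<rho>) \<chi> \<longleftrightarrow> sat M ((\<lambda>\<delta>. h \<circ> \<delta> \<circ> \<rho>) ` rows) \<chi>" by (rule Or1(2)) (use Or1(3-) in auto)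
    moreover have "S \<tturnstile> Or1 (fsubst (Var \<circ> \<rho>) \<psi>) (fsubst (Var \<circ> \<rho>) \<chi>) \<longleftrightarrow>
      S \<tturnstile> fsubst (Var \<circ> \<rho>) \<psi> \<or> S \<tturnstile> fsubst (Var \<circ> \<rho>) \<chi>"
      using Or1(3) by (intro S_or lang_rep_Var) auto
    ultimately show ?case unfolding fsubst.simps sat.simps by blast
  next
    case (Exist1 x \<psi>)
    let ?\<chi> = "fsubst (Var \<circ> \<rho>(x := x)) \<psi>"
    have x: "x < N" and \<psi>: "\<psi> \<in> lang A B C" "fv \<psi> \<union> bv \<psi> \<subseteq> {..<N}" using Exist1.prems by auto
    have bv: "bv ?\<chi> = bv \<psi>" by (rule bv_fsubst_Var)
    have inst: "S \<tturnstile> rep ?\<chi> [Var w] [x] \<longleftrightarrow> sat M (team_upd ((\<lambda>\<delta>. h \<circ> \<delta> \<circ> \<rho>) ` rows) x (h w)) \<psi>"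
      if w: "w \<in> D" for w
      using x \<psi>(2) Exist1.prems(3) w
    proof (intro quantifier)
      show "S \<tturnstile> fsubst (Var \<circ> \<rho>(x := w)) \<psi> \<longleftrightarrow> sat M ((\<lambda>\<delta>. h \<circ> \<delta> \<circ> \<rho>(x := w)) ` rows) \<psi>"
        by (rule Exist1.IH) (use \<psi> Exist1.prems(3) w in auto)
    qed auto
    have "S \<tturnstile> Exist1 x ?\<chi> \<longleftrightarrow> (\<exists>w\<in>D. S \<tturnstile> rep ?\<chi> [Var w] [x])"
    proof
      assume "S \<tturnstile> Exist1 x ?\<chi>"
      then obtain w where "w \<in> D" "S \<tturnstile> rep ?\<chi> [Var w] [x]" by (rule S_exE) (rule lang_rep_Var[OF \<psi>(1)])
      then show "\<exists>w\<in>D. S \<tturnstile> rep ?\<chi> [Var w] [x]" by blast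
    next
      assume "\<exists>w\<in>D. S \<tturnstile> rep ?\<chi> [Var w] [x]"
      then obtain w where w: "w \<in> D" "S \<tturnstile> rep ?\<chi> [Var w] [x]" by blast
      have "w \<notin> bv ?\<chi>" using w(1) \<psi>(2) unfolding bv by (auto simp: D_def)
      from der_exI[OF w(2) rep_ok_Var[OF this]] w(1) show "S \<tturnstile> Exist1 x ?\<chi>"
        by (simp only: D_def mem_Collect_eq)
    qed
    then show ?case
      unfolding fsubst.simps Var_comp_upd sat.simps M_simps(1)
      by (simp only: inst bex_simps cong: bex_cong)
  next
    case (Forall1 x \<psi>)
    let ?\<chi> = "fsubst (Var \<circ> \<rho>(x := x)) \<psi>"
    have x: "x < N" and \<psi>: "\<psi> \<in> lang A B C" "fv \<psi> \<union> bv \<psi> \<subseteq> {..<N}" using Forall1.prems by auto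
    have bv: "bv ?\<chi> = bv \<psi>" by (rule bv_fsubst_Var)
    have l: "?\<chi> \<in> lang A B C" by (rule lang_rep_Var[OF \<psi>(1)])
    have inst: "S \<tturnstile> rep ?\<chi> [Var w] [x] \<longleftrightarrow> sat M (team_upd ((\<lambda>\<delta>. h \<circ> \<delta> \<circ> \<rho>) ` rows) x (h w)) \<psi>"
      if w: "w \<in> D" for w
      using x \<psi>(2) Forall1.prems(3) w
    proof (intro quantifier)
      show "S \<tturnstile> fsubst (Var \<circ> \<rho>(x := w)) \<psi> \<longleftrightarrow> sat M ((\<lambda>\<delta>. h \<circ> \<delta> \<circ> \<rho>(x := w)) ` rows) \<psi>"
        by (rule Forall1.IH) (use \<psi> Forall1.prems(3) w in auto)
    qed auto
    have "S \<tturnstile> Forall1 x ?\<chi> \<longleftrightarrow> (\<forall>w\<in>D. S \<tturnstile> rep ?\<chi> [Var w] [x])"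
    proof
      assume all: "S \<tturnstile> Forall1 x ?\<chi>"
      show "\<forall>w\<in>D. S \<tturnstile> rep ?\<chi> [Var w] [x]"
      proof
        fix w assume w: "w \<in> D"
        have "w \<notin> bv ?\<chi>" using w \<psi>(2) unfolding bv by (auto simp: D_def)
        from der_allE[OF all rep_ok_Var[OF this]] w show "S \<tturnstile> rep ?\<chi> [Var w] [x]"
          by (simp only: D_def mem_Collect_eq)
      qed
    next
      assume all: "\<forall>w\<in>D. S \<tturnstile> rep ?\<chi> [Var w] [x]"
      show "S \<tturnstile> Forall1 x ?\<chi>"
      proof (rule ccontr)
        assume "\<not> S \<tturnstile> Forall1 x ?\<chi>"
        then have "S \<tturnstile> Neg (Forall1 x ?\<chi>)" using S_neg l lang_simps(8) by blast
        then have "S \<tturnstile> Exist1 x (Neg ?\<chi>)" by (rule der_not_all)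
        then obtain w where "w \<in> D" "S \<tturnstile> rep (Neg ?\<chi>) [Var w] [x]"
          by (rule S_exE) (use l in \<open>simp only: lang_simps\<close>)
        then have "S \<tturnstile> Neg (rep ?\<chi> [Var w] [x])" "S \<tturnstile> rep ?\<chi> [Var w] [x]" using all by auto
        then show False using der_negE S_con by blast
      qed
    qed
    then show ?case
      unfolding fsubst.simps Var_comp_upd sat.simps M_simps(1)
      by (simp only: inst ball_simps cong: ball_cong)
  qed
qed

end

section \<open>Weak completeness\<close>

theorem completeness:
  fixes \<phi> :: "('c, 'f, 'r) fm"
  assumes "infinite (UNIV :: 'c set)" "infinite (UNIV :: 'u set)" "finite G" "\<not> G \<turnstile> \<phi>"
  obtains M :: "('c, 'f, 'r, 'u) model" and X
  where "fo_structure M" "X \<subseteq> tot M" "\<And>\<theta>. \<theta> \<in> G \<Longrightarrow> sat M X \<theta>" "\<not> sat M X \<phi>"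
proof -
  define S0 where "S0 = insert (Neg \<phi>) G"
  have fin: "finite S0" using assms(3) by (simp add: S0_def)
  have con: "con S0"
  proof
    assume "S0 \<tturnstile> Bot"
    then have "insert (Neg \<phi>) G \<turnstile> Bot" using fin by (intro der_finite) (auto simp: S0_def)
    then show False using assms(4) ded_raa by blast
  qed
  \<comment> \<open>The pool of fresh constants may contain symbols of \<open>S0\<close>: freshness only ever excludes finitely many.\<close>
  obtain P :: "'c set" where P: "countable P" "infinite P"
    using infinite_countable_subset'[OF assms(1)] by blast
  define A where "A = P \<union> (\<Union>\<theta>\<in>S0. csts \<theta>)"
  define B where "B = (\<Union>\<theta>\<in>S0. set2_fm \<theta>)"
  define C where "C = (\<Union>\<theta>\<in>S0. set3_fm \<theta>)"
  have "finite (set2_tm t)" for t :: "('c, 'f) tm" by (induction t) auto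
  then have "finite (set2_fm \<theta>)" for \<theta> :: "('c, 'f, 'r) fm" by (induction \<theta>) auto
  then have cB: "countable B" using fin unfolding B_def by (auto intro: countable_finite)
  have "finite (set3_fm \<theta>)" for \<theta> :: "('c, 'f, 'r) fm" by (induction \<theta>) auto
  then have cC: "countable C" using fin unfolding C_def by (auto intro: countable_finite)
  have cA: "countable A" using fin P(1) unfolding A_def by (auto intro: countable_finite)
  have lang: "S0 \<subseteq> lang A B C" by (auto simp: lang_def A_def B_def C_def)
  have "finite (\<Union>\<theta>\<in>S0. fv \<theta> \<union> bv \<theta>)" using fin by auto
  then obtain N where "\<forall>x\<in>(\<Union>\<theta>\<in>S0. fv \<theta> \<union> bv \<theta>). x < N"
    unfolding finite_nat_set_iff_bounded by blast
  then have N: "(\<Union>\<theta>\<in>S0. fv \<theta> \<union> bv \<theta>) \<subseteq> {..<N}" by blast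
  have "P \<subseteq> A" by (simp add: A_def)
  obtain S where S: "S0 \<subseteq> S" "henkin S A B C P N"
    using con_extends_to_henkin[OF fin con lang P(2) \<open>P \<subseteq> A\<close> cA cB cC] by blast
  obtain e :: "nat \<Rightarrow> 'u" where "inj e" using infinite_countable_subset[OF assms(2)] by blast
  then interpret henkin_model S A B C P N e
    using S(2) by (simp add: henkin_model_def henkin_model_axioms_def)
  define X where "X = (\<lambda>\<delta>. h \<circ> \<delta>) ` rows"
  have true: "sat M X \<theta>" if "\<theta> \<in> S0" for \<theta>
  proof -
    have "S \<tturnstile> fsubst (Var \<circ> id) \<theta>" using S(1) that by (auto simp: fsubst_Var intro: der_asm)
    moreover have "\<theta> \<in> lang A B C" "fv \<theta> \<union> bv \<theta> \<subseteq> {..<N}" using that lang N by auto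
    ultimately have "sat M ((\<lambda>\<delta>. h \<circ> \<delta> \<circ> id) ` rows) \<theta>" using truth_lemma[of \<theta> id] by simp
    then show ?thesis by (simp add: X_def)
  qed
  show thesis
  proof (rule that)
    show "fo_structure M" by (rule fo_structure_M)
    show "X \<subseteq> tot M" using rows_D(1) by (auto simp: X_def)
    show "sat M X \<theta>" if "\<theta> \<in> G" for \<theta> using true that by (simp add: S0_def)
    have "X \<noteq> {}" using rows_nonempty by (simp add: X_def)
    then show "\<not> sat M X \<phi>" using true[of "Neg \<phi>"] by (simp add: S0_def)
  qed
qed

text \<open>Derivations may use the additional symbols \<open>Inr n\<close>, which a model of the original vocabulary has to
  interpret in some way and which are forgotten on the way back.\<close>

definition reduct :: "('c + nat, 'f, 'r + nat, 'u) model \<Rightarrow> ('c, 'f, 'r, 'u) model" where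
  "reduct M = \<lparr>carrier = carrier M, cst = (\<lambda>c. cst M (Inl c)), fun_of = fun_of M,
     rel_of = (\<lambda>r. rel_of M (Inl r))\<rparr>"

definition expansion :: "'u \<Rightarrow> ('c, 'f, 'r, 'u) model \<Rightarrow> ('c + nat, 'f, 'r + nat, 'u) model" where
  "expansion a M = \<lparr>carrier = carrier M, cst = case_sum (cst M) (\<lambda>_. a), fun_of = fun_of M,
     rel_of = case_sum (rel_of M) (\<lambda>_ _. False)\<rparr>"

lemma sat_reduct: "sat (reduct M) X \<phi> \<longleftrightarrow> sat M X (embed \<phi>)"
proof -
  have t: "tval M s (map_tm Inl id t) = tval (reduct M) s t" for s t
    by (induction t) (auto simp: reduct_def comp_def intro!: arg_cong[where f = "fun_of M _"])
  show ?thesis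
    unfolding embed_def
    by (induction \<phi> arbitrary: X) (auto simp: t comp_def reduct_def)
qed

lemma reduct_expansion: "reduct (expansion a M) = M"
  by (simp add: reduct_def expansion_def)

text \<open>Validity may be tested with total assignments: values outside \<open>V\<close> do not matter by locality.\<close>

lemma valid_in_iff:
  assumes "\<And>M. K M \<Longrightarrow> fo_structure M"
  shows "valid_in K \<phi> \<longleftrightarrow> (\<forall>M X. K M \<longrightarrow> X \<subseteq> tot M \<longrightarrow> sat M X \<phi>)"
proof
  assume v: "valid_in K \<phi>"
  show "\<forall>M X. K M \<longrightarrow> X \<subseteq> tot M \<longrightarrow> sat M X \<phi>"
  proof (intro allI impI)
    fix M X assume "K M" "X \<subseteq> tot M"
    moreover have "tot M = (UNIV \<rightarrow>\<^sub>E carrier M)" by auto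
    ultimately show "sat M X \<phi>" using v unfolding valid_in_def by (metis subset_UNIV)
  qed
next
  assume v: "\<forall>M X. K M \<longrightarrow> X \<subseteq> tot M \<longrightarrow> sat M X \<phi>"
  show "valid_in K \<phi>"
    unfolding valid_in_def
  proof (intro allI impI)
    fix M V X assume M: "K M" "fv \<phi> \<subseteq> V" "X \<subseteq> (V \<rightarrow>\<^sub>E carrier M)"
    then obtain a where a: "a \<in> carrier M" using assms[OF M(1)] by (auto simp: fo_structure_def)
    define F where "F s x = (if x \<in> V then s x else a)" for s x
    have "s x \<in> carrier M" if "s \<in> X" "x \<in> V" for s x using M(3) that by (blast dest: PiE_mem)
    then have "F ` X \<subseteq> tot M" using a by (auto simp: F_def)
    then have "sat M (F ` X) \<phi>" using v M(1) by blast
    moreover have "sat M (F ` X) \<phi> \<longleftrightarrow> sat M X \<phi>"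
      using M(2) by (intro sat_image_cong) (auto simp: F_def)
    ultimately show "sat M X \<phi>" by simp
  qed
qed

text \<open>Soundness and completeness for finitely many premises. A set \<open>G\<close> of premises keeps the two
  notions of validity in the theorem under one proof.\<close>

lemma derives_iff:
  fixes \<phi> :: "('c, 'f, 'r) fm"
  assumes "infinite (UNIV :: 'u set)" "finite G"
  shows "G \<turnstile>\<^sub>F\<^sub>O\<^sub>T \<phi> \<longleftrightarrow> (\<forall>(M :: ('c, 'f, 'r, 'u) model) X. fo_structure M \<longrightarrow> X \<subseteq> tot M \<longrightarrow>
    (\<forall>\<theta>\<in>G. sat M X \<theta>) \<longrightarrow> sat M X \<phi>)"
proof
  assume d: "G \<turnstile>\<^sub>F\<^sub>O\<^sub>T \<phi>"
  show "\<forall>(M :: ('c, 'f, 'r, 'u) model) X. fo_structure M \<longrightarrow> X \<subseteq> tot M \<longrightarrow> (\<forall>\<theta>\<in>G. sat M X \<theta>) \<longrightarrow> sat M X \<phi>"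
  proof (intro allI impI)
    fix M :: "('c, 'f, 'r, 'u) model" and X
    assume M: "fo_structure M" "X \<subseteq> tot M" "\<forall>\<theta>\<in>G. sat M X \<theta>"
    obtain a where a: "a \<in> carrier M" using M(1) by (auto simp: fo_structure_def)
    have "fo_structure (expansion a M)" "X \<subseteq> tot (expansion a M)"
      using M a by (auto simp: fo_structure_def expansion_def split: sum.split)
    moreover have "\<forall>\<theta>\<in>embed ` G. sat (expansion a M) X \<theta>"
      using M(3) sat_reduct[of "expansion a M" X] by (simp add: reduct_expansion)
    ultimately have "sat (expansion a M) X (embed \<phi>)"
      using soundness d unfolding fot_derives_def by blast
    then show "sat M X \<phi>" using sat_reduct[of "expansion a M" X \<phi>] by (simp add: reduct_expansion)
  qed
next
  assume v: "\<forall>(M :: ('c, 'f, 'r, 'u) model) X. fo_structure M \<longrightarrow> X \<subseteq> tot M \<longrightarrow> (\<forall>\<theta>\<in>G. sat M X \<theta>) \<longrightarrow> sat M X \<phi>"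
  show "G \<turnstile>\<^sub>F\<^sub>O\<^sub>T \<phi>"
  proof (rule ccontr)
    assume "\<not> G \<turnstile>\<^sub>F\<^sub>O\<^sub>T \<phi>"
    then have "\<not> embed ` G \<turnstile> embed \<phi>" by (simp add: fot_derives_def)
    moreover have "infinite (UNIV :: ('c + nat) set)" by (simp add: finite_Plus_UNIV_iff)
    ultimately obtain M :: "('c + nat, 'f, 'r + nat, 'u) model" and X where
      M: "fo_structure M" "X \<subseteq> tot M" "\<And>\<theta>. \<theta> \<in> embed ` G \<Longrightarrow> sat M X \<theta>" "\<not> sat M X (embed \<phi>)"
      using completeness[of "embed ` G" "embed \<phi>"] assms by blast
    have "fo_structure (reduct M)" "X \<subseteq> tot (reduct M)"
      using M(1,2) by (auto simp: fo_structure_def reduct_def)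
    moreover have "\<forall>\<theta>\<in>G. sat (reduct M) X \<theta>" "\<not> sat (reduct M) X \<phi>"
      using M(3,4) by (simp_all add: sat_reduct)
    ultimately show False using v by blast
  qed
qed

lemma sat_two_elements:
  assumes "X \<noteq> {}"
  shows "sat M X two_elements \<longleftrightarrow> (\<exists>a\<in>carrier M. \<exists>b\<in>carrier M. a \<noteq> b)"
  using assms by (auto simp: two_elements_def team_upd_def)

theorem theorem4p10:
  fixes \<phi> :: "('c, 'f, 'r) fm"
  assumes "infinite (UNIV :: 'u set)"
  shows "(fot_valid1 TYPE('u) \<phi> \<longleftrightarrow> {} \<turnstile>\<^sub>F\<^sub>O\<^sub>T \<phi>) \<and>
    (fot_valid TYPE('u) \<phi> \<longleftrightarrow> {two_elements} \<turnstile>\<^sub>F\<^sub>O\<^sub>T \<phi>)"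
proof
  show "fot_valid1 TYPE('u) \<phi> \<longleftrightarrow> {} \<turnstile>\<^sub>F\<^sub>O\<^sub>T \<phi>"
    unfolding fot_valid1_def derives_iff[OF assms finite.emptyI] by (subst valid_in_iff) auto
  \<comment> \<open>The empty team satisfies everything, also in a structure with a single element.\<close>
  have "sat M X \<phi>" if "fo_structure M" "X = {}" for M :: "('c, 'f, 'r, 'u) model" and X
    using that by (rule sat_emptyI)
  then have "(fo_structure2 M \<longrightarrow> X \<subseteq> tot M \<longrightarrow> sat M X \<phi>) \<longleftrightarrow>
    (fo_structure M \<longrightarrow> X \<subseteq> tot M \<longrightarrow> (\<forall>\<theta>\<in>{two_elements}. sat M X \<theta>) \<longrightarrow> sat M X \<phi>)"
    for M :: "('c, 'f, 'r, 'u) model" and X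
    using sat_two_elements[of X M] by (cases "X = {}") (auto simp: fo_structure2_def)
  then show "fot_valid TYPE('u) \<phi> \<longleftrightarrow> {two_elements} \<turnstile>\<^sub>F\<^sub>O\<^sub>T \<phi>"
    unfolding fot_valid_def derives_iff[OF assms finite.insertI[OF finite.emptyI]]
    by (subst valid_in_iff) (auto simp: fo_structure2_def)
qed

end
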